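(* Let $R=R_0\bar\Theta$ with $R_0=\sum_{\mu,\nu\in\Lambda/\Lambda'}f(\mu,\nu)K_\mu\otimes K_\nu$ be an $R$-matrix for $u_q(\mathfrak g,\Lambda,\Lambda')$, where $f\colon\Lambda/\Lambda'\times\Lambda/\Lambda'\to\mathbb C$ vanishes outside $G_1\times G_2$ for subgroups $G_1,G_2$ of $\Lambda/\Lambda'$ containing $\Lambda_R/\Lambda'$ and satisfies the system (E) of the context. Then $R$ is factorizable if and only if the complex matrix $m$ with rows and columns indexed by $\mu,\nu\in\Lambda/\Lambda'$ and entries $$m_{\mu,\nu}:=\sum_{\mu',\nu'\in\Lambda/\Lambda'}f(\mu-\mu',\nu-\nu')\,f(\nu',\mu')$$ is invertible.
   Context: Lattices. Let $\mathfrak g$ be a finite-dimensional simple complex Lie algebra with simple roots $\alpha_i$ ($i\in I$), $(\cdot,\cdot)$ the invariant form normalized so that short roots have $(\alpha,\alpha)=2$, $d_i=(\alpha_i,\alpha_i)/2$, root lattice $\Lambda_R$, weight lattice $\Lambda_W$ (spanned by $\lambda_i$, $(\lambda_i,\alpha_j)=\delta_{ij}d_i$). Fix $\ell\ge1$, a primitive $\ell$-th root of unity $q$ with $q^{2d_i}\ne1$ for all $i$, a lattice $\Lambda_R\subseteq\Lambda\subseteq\Lambda_W$, and a finite-index sublattice $\Lambda'\subseteq\{\nu\in\Lambda_R\mid(\nu,\mu)\in\ell\mathbb Z\ \forall\mu\in\Lambda_R\}$. Quantum group. $u_q(\mathfrak g,\Lambda,\Lambda')$ is the finite-dimensional Hopf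 algebra over $\mathbb C$ generated by $K_\lambda$ ($\lambda\in\Lambda/\Lambda'$), $E_i,F_i$ ($i\in I$) with $K_\lambda K_\mu=K_{\lambda+\mu}$, $K_0=1$, $K_\lambda E_iK_\lambda^{-1}=q^{(\lambda,\alpha_i)}E_i$, $K_\lambda F_iK_\lambda^{-1}=q^{-(\lambda,\alpha_i)}F_i$, $E_iF_j-F_jE_i=\delta_{ij}\frac{K_{\alpha_i}-K_{\alpha_i}^{-1}}{q^{d_i}-q^{-d_i}}$, together with all relations $x(E_i)=0$ and $x(F_i)=0$ for $x$ in the radical of Lusztig's form on the free algebra $T$ on symbols $\theta_i$: the form with $(1,1)=1$, $(\theta_i,\theta_j)=\delta_{ij}$, $(xy,z)=(x\otimes y,r(z))$, where $r\colon T\to T\otimes T$ is the algebra map with $r(\theta_i)=\theta_i\otimes1+1\otimes\theta_i$ for the product $(x_1\otimes x_2)(y_1\otimes y_2)=q^{(|x_2|,|y_1|)}x_1y_1\otimes x_2y_2$ on homogeneous elements ($|\theta_i|=\alpha_i$). Coproduct: $\Delta(K_\lambda)=K_\lambda\otimes K_\lambda$, $\Delta(E_i)=E_i\otimes1+K_{\alpha_i}\otimes E_i$, $\Delta(F_i)=F_i\otimes K_{\alpha_i}^{-1}+1\otimes F_i$. $u^\pm$ denote the subalgebras generated by the $E_i$, resp. $F_i$, graded by $\mathbb N_0[\alpha_i]$ with pieces $u^\pm_\beta$ ($E_i\in u^+_{\alpha_i}$, $F_i\in u^-_{\alpha_i}$). $\bar\Theta$ is the unique element $\bar\Theta=\sum_\beta\bar\Theta_\beta$,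 $\bar\Theta_\beta\in u^-_\beta\otimes u^+_\beta$, $\bar\Theta_0=1\otimes1$, with $\bar\Delta(x)\bar\Theta=\bar\Theta\Delta(x)$ for all $x$, where $\bar\Delta$ is the algebra map with $\bar\Delta(K_\lambda)=K_\lambda\otimes K_\lambda$, $\bar\Delta(E_i)=E_i\otimes1+K_{\alpha_i}^{-1}\otimes E_i$, $\bar\Delta(F_i)=F_i\otimes K_{\alpha_i}+1\otimes F_i$. System (E), for all $\alpha\in\Lambda_R$, $\mu,\mu_1,\mu_2\in G_1$, $\nu,\nu_1,\nu_2\in G_2$ (sums over $G_1$, resp. $G_2$): (1) $f(\mu+\alpha,\nu)=q^{-(\nu,\alpha)}f(\mu,\nu)$, $f(\mu,\nu+\alpha)=q^{-(\mu,\alpha)}f(\mu,\nu)$; (2) $\sum_{\nu_1+\nu_2=\nu}f(\mu_1,\nu_1)f(\mu_2,\nu_2)=\delta_{\mu_1,\mu_2}f(\mu_1,\nu)$, $\sum_{\mu_1+\mu_2=\mu}f(\mu_1,\nu_1)f(\mu_2,\nu_2)=\delta_{\nu_1,\nu_2}f(\mu,\nu_1)$; (3) $\sum_{\mu}f(\mu,\nu)=\delta_{\nu,0}$, $\sum_\nu f(\mu,\nu)=\delta_{\mu,0}$. A finite-dimensional quasitriangular Hopf algebra $(H,R)$ is factorizable if for $M=R_{21}R\in H\otimes H$ the linear map $H^*\to H$, $\phi\mapsto(\operatorname{id}\otimes\phi)(M)$ is bijective. *)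

theory Defs
  imports Complex_Main "HOL-Algebra.Coset" "HOL-Library.Poly_Mapping" "HOL-Library.Function_Algebras"
begin

section \<open>Complex vector spaces and algebras\<close>

class complex_vector = ab_group_add +
  fixes scaleC :: "complex \<Rightarrow> 'a \<Rightarrow> 'a" (infixr "*\<^sub>C" 75)
  assumes scaleC_add_right: "a *\<^sub>C (x + y) = a *\<^sub>C x + a *\<^sub>C y"
    and scaleC_add_left: "(a + b) *\<^sub>C x = a *\<^sub>C x + b *\<^sub>C x"
    and scaleC_scaleC [simp]: "a *\<^sub>C (b *\<^sub>C x) = (a * b) *\<^sub>C x"
    and scaleC_one [simp]: "1 *\<^sub>C x = x"

class complex_algebra_1 = complex_vector + ring_1 +
  assumes mult_scaleC_left [simp]: "(a *\<^sub>C x) * y = a *\<^sub>C (x * y)"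
    and mult_scaleC_right [simp]: "x * (a *\<^sub>C y) = a *\<^sub>C (x * y)"

global_interpretation cvec: vector_space "scaleC :: complex \<Rightarrow> 'a \<Rightarrow> 'a::complex_vector"
  by unfold_locales (simp_all add: scaleC_add_right scaleC_add_left)

global_interpretation cvec_pair: vector_space_pair
  "scaleC :: complex \<Rightarrow> 'a \<Rightarrow> 'a::complex_vector"
  "scaleC :: complex \<Rightarrow> 'b \<Rightarrow> 'b::complex_vector"
  by unfold_locales

instantiation complex :: complex_algebra_1
begin
definition scaleC_complex_def [simp]: "scaleC (a::complex) (x::complex) = a * x"
instance by standard (simp_all add: algebra_simps)
end

abbreviation clinear :: "('a::complex_vector \<Rightarrow> 'b::complex_vector) \<Rightarrow> bool" where
  "clinear \<equiv> Vector_Spaces.linear scaleC scaleC"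

lemma clinearI:
  assumes "\<And>x y. f (x + y) = f x + f y" "\<And>c x. f (c *\<^sub>C x) = c *\<^sub>C f x"
  shows "clinear f"
  by unfold_locales (auto simp: assms scaleC_add_right scaleC_add_left)

definition cbilinear :: "('a::complex_vector \<Rightarrow> 'b::complex_vector \<Rightarrow> 'c::complex_vector) \<Rightarrow> bool" where
  "cbilinear B \<longleftrightarrow> (\<forall>x. clinear (B x)) \<and> (\<forall>y. clinear (\<lambda>x. B x y))"

lemma cbilinearD:
  assumes "cbilinear B"
  shows "B (x + x') y = B x y + B x' y" "B x (y + y') = B x y + B x y'"
    "B (c *\<^sub>C x) y = c *\<^sub>C B x y" "B x (c *\<^sub>C y) = c *\<^sub>C B x y"
  using assms unfolding cbilinear_def
  by (auto dest: cvec_pair.linear_add cvec_pair.linear_scale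
      simp: cvec_pair.linear_add[of "\<lambda>x. B x y"] cvec_pair.linear_scale[of "\<lambda>x. B x y"])

lemma cbilinearI:
  assumes "\<And>x x' y. B (x + x') y = B x y + B x' y" "\<And>x y y'. B x (y + y') = B x y + B x y'"
    "\<And>c x y. B (c *\<^sub>C x) y = c *\<^sub>C B x y" "\<And>c x y. B x (c *\<^sub>C y) = c *\<^sub>C B x y"
  shows "cbilinear B"
  unfolding cbilinear_def by (auto intro!: clinearI simp: assms)

definition algebra_hom :: "('a::complex_algebra_1 \<Rightarrow> 'b::complex_algebra_1) \<Rightarrow> bool" where
  "algebra_hom f \<longleftrightarrow> clinear f \<and> (\<forall>x y. f (x * y) = f x * f y) \<and> f 1 = 1"

section \<open>Free vector spaces and free algebras\<close>

lemma lookup_map_scaleC: "Poly_Mapping.lookup (Poly_Mapping.map (\<lambda>x. c *\<^sub>C x) p) k = c *\<^sub>C Poly_Mapping.lookup p k"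
  by (simp add: map.rep_eq when_def)

lemma poly_mapping_add_induct [case_names single add]:
  fixes p :: "'k \<Rightarrow>\<^sub>0 'a::monoid_add"
  assumes single: "\<And>k v. P (Poly_Mapping.single k v)" and add: "\<And>p p'. P p \<Longrightarrow> P p' \<Longrightarrow> P (p + p')"
  shows "P p"
proof (induct p rule: update_induct)
  case const
  show ?case using single[of undefined 0] by simp
next
  case (update f k v)
  have "Poly_Mapping.update k v f = f + Poly_Mapping.single k v"
    using update(1) by (intro poly_mapping_eqI)
      (auto simp: lookup_update lookup_add lookup_single when_def in_keys_iff)
  then show ?case by (simp add: add single update)
qed

instantiation poly_mapping :: (type, complex_vector) complex_vector
begin
definition scaleC_poly_mapping :: "complex \<Rightarrow> ('a \<Rightarrow>\<^sub>0 'b) \<Rightarrow> ('a \<Rightarrow>\<^sub>0 'b)" where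
  "scaleC_poly_mapping c p = Poly_Mapping.map (\<lambda>x. c *\<^sub>C x) p"
instance
proof
  fix a b :: complex and x y :: "'a \<Rightarrow>\<^sub>0 'b"
  have L: "Poly_Mapping.lookup (c *\<^sub>C z) k = c *\<^sub>C Poly_Mapping.lookup z k" for c and z :: "'a \<Rightarrow>\<^sub>0 'b" and k
    unfolding scaleC_poly_mapping_def by (rule lookup_map_scaleC)
  show "a *\<^sub>C (x + y) = a *\<^sub>C x + a *\<^sub>C y" "(a + b) *\<^sub>C x = a *\<^sub>C x + b *\<^sub>C x"
    "a *\<^sub>C b *\<^sub>C x = (a * b) *\<^sub>C x" "1 *\<^sub>C x = x"
    by (rule poly_mapping_eqI, simp add: L lookup_add scaleC_add_right scaleC_add_left)+
qed
end

lemma lookup_scaleC [simp]: "Poly_Mapping.lookup (c *\<^sub>C p) k = c *\<^sub>C Poly_Mapping.lookup p k"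
  by (simp add: scaleC_poly_mapping_def lookup_map_scaleC)

lemma scaleC_single [simp]: "c *\<^sub>C Poly_Mapping.single k x = Poly_Mapping.single k (c *\<^sub>C x)"
  by (rule poly_mapping_eqI) (simp add: lookup_single when_def)

instance poly_mapping :: (monoid_add, complex_algebra_1) complex_algebra_1
proof
  fix a :: complex and x y :: "'a \<Rightarrow>\<^sub>0 'b"
  have *: "(a *\<^sub>C Poly_Mapping.single k u) * y = a *\<^sub>C (Poly_Mapping.single k u * y)" for k u
    by (induct y rule: poly_mapping_add_induct) (simp_all add: mult_single distrib_left scaleC_add_right)
  show "(a *\<^sub>C x) * y = a *\<^sub>C (x * y)"
    by (induct x rule: poly_mapping_add_induct)
      (simp_all add: * distrib_right scaleC_add_right del: scaleC_single)
  have *: "Poly_Mapping.single k u * (a *\<^sub>C y) = a *\<^sub>C (Poly_Mapping.single k u * y)" for k u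
    by (induct y rule: poly_mapping_add_induct) (simp_all add: mult_single distrib_left scaleC_add_right)
  show "x * (a *\<^sub>C y) = a *\<^sub>C (x * y)"
    by (induct x rule: poly_mapping_add_induct)
      (simp_all add: * distrib_right scaleC_add_right del: scaleC_single)
qed

definition linext :: "('k \<Rightarrow> 'c) \<Rightarrow> ('k \<Rightarrow>\<^sub>0 complex) \<Rightarrow> 'c::complex_vector" where
  "linext g p = (\<Sum>k\<in>Poly_Mapping.keys p. Poly_Mapping.lookup p k *\<^sub>C g k)"

lemma linext_superset:
  assumes "finite A" "Poly_Mapping.keys p \<subseteq> A"
  shows "linext g p = (\<Sum>k\<in>A. Poly_Mapping.lookup p k *\<^sub>C g k)"
  unfolding linext_def using assms
  by (intro sum.mono_neutral_left) (auto simp: in_keys_iff)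

lemma linext_add: "linext g (p + p') = linext g p + linext g p'"
proof -
  let ?A = "Poly_Mapping.keys p \<union> Poly_Mapping.keys p'"
  have "linext g (p + p') = (\<Sum>k\<in>?A. Poly_Mapping.lookup (p + p') k *\<^sub>C g k)"
    by (rule linext_superset) (auto dest: subsetD[OF Poly_Mapping.keys_add])
  also have "\<dots> = (\<Sum>k\<in>?A. Poly_Mapping.lookup p k *\<^sub>C g k) + (\<Sum>k\<in>?A. Poly_Mapping.lookup p' k *\<^sub>C g k)"
    by (simp add: lookup_add scaleC_add_left sum.distrib)
  also have "\<dots> = linext g p + linext g p'"
    by (simp add: linext_superset[of ?A])
  finally show ?thesis .
qed

lemma linext_scaleC: "linext g (c *\<^sub>C p) = c *\<^sub>C linext g p"
proof -
  have "linext g (c *\<^sub>C p) = (\<Sum>k\<in>Poly_Mapping.keys p. Poly_Mapping.lookup (c *\<^sub>C p) k *\<^sub>C g k)"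
    by (rule linext_superset) (auto simp: in_keys_iff)
  then show ?thesis by (simp add: linext_def cvec.scale_sum_right)
qed

lemma clinear_linext: "clinear (linext g)"
  by (rule clinearI) (simp_all add: linext_add linext_scaleC)

lemma linext_single [simp]: "linext g (Poly_Mapping.single k c) = c *\<^sub>C g k"
  by (simp add: linext_def)

text \<open>Words form the free monoid, so \<^typ>\<open>'x list \<Rightarrow>\<^sub>0 complex\<close> with its convolution product
  is the free associative unital algebra on the letters \<^typ>\<open>'x\<close>.\<close>

instantiation list :: (type) monoid_add
begin
definition zero_list_def: "0 = ([] :: 'a list)"
definition plus_list_def: "xs + ys = (xs @ ys :: 'a list)"
instance by standard (simp_all add: zero_list_def plus_list_def)
end

type_synonym 'x free_algebra = "'x list \<Rightarrow>\<^sub>0 complex"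

definition word :: "'x list \<Rightarrow> 'x free_algebra" where
  "word w = Poly_Mapping.single w 1"

abbreviation gen :: "'x \<Rightarrow> 'x free_algebra" where
  "gen x \<equiv> word [x]"

definition eval :: "('x \<Rightarrow> 'a) \<Rightarrow> 'x free_algebra \<Rightarrow> 'a::complex_algebra_1" where
  "eval g = linext (\<lambda>w. prod_list (map g w))"

definition free_on :: "'x set \<Rightarrow> 'x free_algebra set" where
  "free_on X = {p. \<forall>w\<in>Poly_Mapping.keys p. set w \<subseteq> X}"

text \<open>\<open>g\<close> presents the algebra \<^typ>\<open>'a\<close> by the generators \<open>X\<close> and the relations \<open>r = 0\<close>,
  \<open>r \<in> Rels\<close>: evaluation at \<open>g\<close> is onto, and its kernel is the two-sided ideal generated by
  \<open>Rels\<close>.\<close>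

definition presented_by :: "'x set \<Rightarrow> ('x \<Rightarrow> 'a::complex_algebra_1) \<Rightarrow> 'x free_algebra set \<Rightarrow> bool" where
  "presented_by X g Rels \<longleftrightarrow> eval g ` free_on X = UNIV \<and>
     {p \<in> free_on X. eval g p = 0} =
       cvec.span {a * r * b | a r b. a \<in> free_on X \<and> r \<in> Rels \<and> b \<in> free_on X}"

section \<open>Tensor products\<close>

definition tensor_rels :: "(('a::complex_vector \<times> 'b::complex_vector) \<Rightarrow>\<^sub>0 complex) set" where
  "tensor_rels =
     {Poly_Mapping.single (x + x', y) 1 - Poly_Mapping.single (x, y) 1 - Poly_Mapping.single (x', y) 1 | x x' y. True} \<union>
     {Poly_Mapping.single (x, y + y') 1 - Poly_Mapping.single (x, y) 1 - Poly_Mapping.single (x, y') 1 | x y y'. True} \<union>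
     {Poly_Mapping.single (c *\<^sub>C x, y) 1 - c *\<^sub>C Poly_Mapping.single (x, y) 1 | c x y. True} \<union>
     {Poly_Mapping.single (x, c *\<^sub>C y) 1 - c *\<^sub>C Poly_Mapping.single (x, y) 1 | c x y. True}"

definition tensor_eq :: "(('a::complex_vector \<times> 'b::complex_vector) \<Rightarrow>\<^sub>0 complex) \<Rightarrow> ('a \<times> 'b \<Rightarrow>\<^sub>0 complex) \<Rightarrow> bool" where
  "tensor_eq p p' \<longleftrightarrow> p - p' \<in> cvec.span tensor_rels"

quotient_type (overloaded) ('a, 'b) tensor = "('a::complex_vector \<times> 'b::complex_vector) \<Rightarrow>\<^sub>0 complex" / tensor_eq
proof (rule equivpI)
  show "reflp (tensor_eq :: ('a \<times> 'b \<Rightarrow>\<^sub>0 complex) \<Rightarrow> _)"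
    by (auto simp: reflp_def tensor_eq_def cvec.span_zero)
  show "symp (tensor_eq :: ('a \<times> 'b \<Rightarrow>\<^sub>0 complex) \<Rightarrow> _)"
    using cvec.span_neg by (force simp: symp_def tensor_eq_def)
  show "transp (tensor_eq :: ('a \<times> 'b \<Rightarrow>\<^sub>0 complex) \<Rightarrow> _)"
  proof (rule transpI)
    fix p p' p'' :: "'a \<times> 'b \<Rightarrow>\<^sub>0 complex"
    assume "tensor_eq p p'" "tensor_eq p' p''"
    then show "tensor_eq p p''"
      using cvec.span_add[of "p - p'" tensor_rels "p' - p''"] by (simp add: tensor_eq_def)
  qed
qed

lemma tensor_eq_refl: "p = p' \<Longrightarrow> tensor_eq p p'"
  by (simp add: tensor_eq_def cvec.span_zero)

instantiation tensor :: (complex_vector, complex_vector) complex_vector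
begin
lift_definition zero_tensor :: "('a, 'b) tensor" is 0 .
lift_definition plus_tensor :: "('a, 'b) tensor \<Rightarrow> ('a, 'b) tensor \<Rightarrow> ('a, 'b) tensor" is "(+)"
  unfolding tensor_eq_def add_diff_add by (rule cvec.span_add)
lift_definition uminus_tensor :: "('a, 'b) tensor \<Rightarrow> ('a, 'b) tensor" is uminus
  unfolding tensor_eq_def minus_diff_minus by (rule cvec.span_neg)
lift_definition minus_tensor :: "('a, 'b) tensor \<Rightarrow> ('a, 'b) tensor \<Rightarrow> ('a, 'b) tensor" is "(-)"
proof -
  fix p p' r r' :: "'a \<times> 'b \<Rightarrow>\<^sub>0 complex"
  assume "tensor_eq p p'" "tensor_eq r r'"
  moreover have "p - r - (p' - r') = (p - p') - (r - r')" by simp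
  ultimately show "tensor_eq (p - r) (p' - r')"
    unfolding tensor_eq_def by (simp only: cvec.span_diff)
qed
lift_definition scaleC_tensor :: "complex \<Rightarrow> ('a, 'b) tensor \<Rightarrow> ('a, 'b) tensor" is scaleC
  unfolding tensor_eq_def cvec.scale_right_diff_distrib[symmetric] by (rule cvec.span_scale)
instance
proof
  fix s t u :: "('a, 'b) tensor" and a b :: complex
  show "s + t + u = s + (t + u)" by transfer (rule tensor_eq_refl, rule add.assoc)
  show "s + t = t + s" by transfer (rule tensor_eq_refl, rule add.commute)
  show "0 + s = s" by transfer (rule tensor_eq_refl, rule add_0_left)
  show "- s + s = 0" by transfer (rule tensor_eq_refl, rule left_minus)
  show "s - t = s + - t" by transfer (rule tensor_eq_refl, rule diff_conv_add_uminus)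
  show "a *\<^sub>C (s + t) = a *\<^sub>C s + a *\<^sub>C t" by transfer (rule tensor_eq_refl, rule scaleC_add_right)
  show "(a + b) *\<^sub>C s = a *\<^sub>C s + b *\<^sub>C s" by transfer (rule tensor_eq_refl, rule scaleC_add_left)
  show "a *\<^sub>C b *\<^sub>C s = (a * b) *\<^sub>C s" by transfer (rule tensor_eq_refl, rule scaleC_scaleC)
  show "1 *\<^sub>C s = s" by transfer (rule tensor_eq_refl, rule scaleC_one)
qed
end

lift_definition tensor :: "'a::complex_vector \<Rightarrow> 'b::complex_vector \<Rightarrow> ('a, 'b) tensor" (infixr "\<otimes>\<^sub>C" 72)
  is "\<lambda>x y. Poly_Mapping.single (x, y) 1" .

lemma cbilinear_tensor: "cbilinear (\<otimes>\<^sub>C)"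
proof (rule cbilinearI)
  show "(x + x') \<otimes>\<^sub>C y = x \<otimes>\<^sub>C y + x' \<otimes>\<^sub>C y" for x x' :: 'a and y :: 'b
    by transfer (unfold tensor_eq_def tensor_rels_def diff_diff_add[symmetric], rule cvec.span_base, blast)
  show "x \<otimes>\<^sub>C (y + y') = x \<otimes>\<^sub>C y + x \<otimes>\<^sub>C y'" for x :: 'a and y y' :: 'b
    by transfer (unfold tensor_eq_def tensor_rels_def diff_diff_add[symmetric], rule cvec.span_base, blast)
  show "(c *\<^sub>C x) \<otimes>\<^sub>C y = c *\<^sub>C (x \<otimes>\<^sub>C y)" for c and x :: 'a and y :: 'b
    by transfer (unfold tensor_eq_def tensor_rels_def, rule cvec.span_base, blast)
  show "x \<otimes>\<^sub>C (c *\<^sub>C y) = c *\<^sub>C (x \<otimes>\<^sub>C y)" for c and x :: 'a and y :: 'b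
    by transfer (unfold tensor_eq_def tensor_rels_def, rule cvec.span_base, blast)
qed

text \<open>The linear map \<open>x \<otimes> y \<mapsto> B x y\<close> induced by a bilinear map \<open>B\<close>.  It is computed on an
  arbitrary representative, so it is meaningful only for bilinear \<open>B\<close>.\<close>

definition tensor_lift :: "('a::complex_vector \<Rightarrow> 'b::complex_vector \<Rightarrow> 'c::complex_vector) \<Rightarrow> ('a, 'b) tensor \<Rightarrow> 'c" where
  "tensor_lift B t = linext (\<lambda>(x, y). B x y) (rep_tensor t)"

lemma tensor_lift_abs:
  assumes "cbilinear B"
  shows "tensor_lift B (abs_tensor p) = linext (\<lambda>(x, y). B x y) p"
proof -
  let ?L = "linext (\<lambda>(x, y). B x y)"
  interpret L: Vector_Spaces.linear scaleC scaleC ?L by (rule clinear_linext)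
  have "?L r = 0" if "r \<in> tensor_rels" for r
    using that assms by (auto simp: tensor_rels_def L.diff cbilinearD)
  then have 0: "?L r = 0" if "r \<in> cvec.span tensor_rels" for r
    using that L.eq_0_on_span by blast
  have "tensor_eq (rep_tensor (abs_tensor p)) p"
    by (metis Quotient3_tensor Quotient3_rep_abs tensor.abs_eq_iff Quotient3_abs_rep)
  then show ?thesis
    unfolding tensor_lift_def tensor_eq_def using 0 by (metis L.diff eq_iff_diff_eq_0)
qed

lemma tensor_lift_tensor: "cbilinear B \<Longrightarrow> tensor_lift B (x \<otimes>\<^sub>C y) = B x y"
  by (simp add: tensor.abs_eq tensor_lift_abs)

lemma clinear_tensor_lift:
  assumes "cbilinear B" shows "clinear (tensor_lift B)"
proof (rule clinearI)
  show "tensor_lift B (s + t) = tensor_lift B s + tensor_lift B t" for s t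
    by (induct s; induct t) (simp add: tensor_lift_abs[OF assms] plus_tensor.abs_eq linext_add)
  show "tensor_lift B (c *\<^sub>C s) = c *\<^sub>C tensor_lift B s" for c s
    by (induct s) (simp add: tensor_lift_abs[OF assms] scaleC_tensor.abs_eq linext_scaleC)
qed

lemma tensor_induct [case_names tensor add]:
  assumes "\<And>x y. P (x \<otimes>\<^sub>C y)" "\<And>s t. P s \<Longrightarrow> P t \<Longrightarrow> P (s + t)"
  shows "P t"
proof (induct t)
  fix p :: "'a \<times> 'b \<Rightarrow>\<^sub>0 complex"
  show "P (abs_tensor p)"
  proof (induct p rule: poly_mapping_add_induct)
    case (single k v)
    have "abs_tensor (Poly_Mapping.single k v) = v *\<^sub>C (fst k \<otimes>\<^sub>C snd k)"
      by (simp add: tensor.abs_eq scaleC_tensor.abs_eq)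
    also have "\<dots> = (v *\<^sub>C fst k) \<otimes>\<^sub>C snd k"
      by (simp add: cbilinearD[OF cbilinear_tensor])
    finally show ?case by (simp add: assms(1))
  next
    case (add p p')
    then show ?case by (metis assms(2) plus_tensor.abs_eq)
  qed
qed

lemma tensor_mult_bilinear:
  fixes a c :: "'a::complex_algebra_1" and b d :: "'b::complex_algebra_1"
  shows "cbilinear (\<lambda>c d. (a * c) \<otimes>\<^sub>C (b * d))" "cbilinear (\<lambda>a b. (a * c) \<otimes>\<^sub>C (b * d))"
  by (rule cbilinearI; simp add: distrib_left distrib_right cbilinearD[OF cbilinear_tensor])+

instantiation tensor :: (complex_algebra_1, complex_algebra_1) complex_algebra_1
begin

definition one_tensor :: "('a, 'b) tensor" where
  "one_tensor = 1 \<otimes>\<^sub>C 1"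

definition times_tensor :: "('a, 'b) tensor \<Rightarrow> ('a, 'b) tensor \<Rightarrow> ('a, 'b) tensor" where
  "times_tensor s t = tensor_lift (\<lambda>a b. tensor_lift (\<lambda>c d. (a * c) \<otimes>\<^sub>C (b * d)) t) s"

lemma cbilinear_times_aux:
  "cbilinear (\<lambda>a b. tensor_lift (\<lambda>c d. (a * c) \<otimes>\<^sub>C (b * d)) (t :: ('a, 'b) tensor))"
proof -
  define m where "m a b t = tensor_lift (\<lambda>c d. (a * c) \<otimes>\<^sub>C (b * d)) t" for a b and t :: "('a, 'b) tensor"
  have m: "m a b (c \<otimes>\<^sub>C d) = (a * c) \<otimes>\<^sub>C (b * d)" "m a b (s + s') = m a b s + m a b s'" for a b c d s s'
    unfolding m_def
    by (rule tensor_lift_tensor[OF tensor_mult_bilinear(1)],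
        rule cvec_pair.linear_add[OF clinear_tensor_lift[OF tensor_mult_bilinear(1)]])
  have "cbilinear (\<lambda>a b. m a b t)"
    by (rule cbilinearI; induct t rule: tensor_induct)
      (simp_all add: m scaleC_add_right distrib_right cbilinearD[OF cbilinear_tensor])
  then show ?thesis by (simp add: m_def)
qed

lemma times_tensor_left_aux: "clinear (\<lambda>s. s * (t :: ('a, 'b) tensor))"
  unfolding times_tensor_def by (rule clinear_tensor_lift[OF cbilinear_times_aux])

lemma tensor_times_aux:
  "(a \<otimes>\<^sub>C b) * t = tensor_lift (\<lambda>c d. (a * c) \<otimes>\<^sub>C (b * d :: 'b)) t" for a :: 'a
  unfolding times_tensor_def by (rule tensor_lift_tensor[OF cbilinear_times_aux])

lemma times_tensor_tensor_aux:
  "(a \<otimes>\<^sub>C b) * (c \<otimes>\<^sub>C d) = (a * c) \<otimes>\<^sub>C (b * d :: 'b)" for a c :: 'a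
  unfolding tensor_times_aux by (rule tensor_lift_tensor[OF tensor_mult_bilinear(1)])

lemma times_tensor_right_aux: "clinear (\<lambda>t. s * (t :: ('a, 'b) tensor))"
proof -
  note L = clinear_tensor_lift[OF tensor_mult_bilinear(1)]
  have 1: "(a \<otimes>\<^sub>C b) * (t + t') = (a \<otimes>\<^sub>C b) * t + (a \<otimes>\<^sub>C b) * t'"
    "(a \<otimes>\<^sub>C b) * (k *\<^sub>C t) = k *\<^sub>C ((a \<otimes>\<^sub>C b) * t)" for a b k and t t' :: "('a, 'b) tensor"
    unfolding tensor_times_aux by (rule cvec_pair.linear_add[OF L], rule cvec_pair.linear_scale[OF L])
  show ?thesis
    by (rule clinearI; induct s rule: tensor_induct)
      (simp_all add: 1 cvec_pair.linear_add[OF times_tensor_left_aux] scaleC_add_right)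
qed

instance
proof
  fix s t u :: "('a, 'b) tensor" and k :: complex
  note simps = cvec_pair.linear_add[OF times_tensor_left_aux]
    cvec_pair.linear_add[OF times_tensor_right_aux] times_tensor_tensor_aux
  show "s * t * u = s * (t * u)"
  proof (induct s rule: tensor_induct)
    case (tensor a b)
    show ?case
    proof (induct t rule: tensor_induct)
      case (tensor c d)
      show ?case by (induct u rule: tensor_induct) (simp_all add: simps mult.assoc)
    qed (simp add: simps)
  qed (simp add: simps)
  show "1 * s = s" "s * 1 = s"
    by (induct s rule: tensor_induct) (simp_all add: one_tensor_def simps)
  show "(s + t) * u = s * u + t * u" "s * (t + u) = s * t + s * u"
    by (simp_all add: simps)
  show "(k *\<^sub>C s) * t = k *\<^sub>C (s * t)" "s * (k *\<^sub>C t) = k *\<^sub>C (s * t)"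
    by (fact cvec_pair.linear_scale[OF times_tensor_left_aux]
        cvec_pair.linear_scale[OF times_tensor_right_aux])+
  obtain \<phi> :: "'a \<Rightarrow> complex" where \<phi>: "clinear \<phi>" "\<phi> 1 = 1"
    using cvec_pair.linear_independent_extend[of "{1 :: 'a}" "\<lambda>_. 1 :: complex"] by auto
  obtain \<psi> :: "'b \<Rightarrow> complex" where \<psi>: "clinear \<psi>" "\<psi> 1 = 1"
    using cvec_pair.linear_independent_extend[of "{1 :: 'b}" "\<lambda>_. 1 :: complex"] by auto
  have B: "cbilinear (\<lambda>a b. \<phi> a * \<psi> b)"
    by (rule cbilinearI) (simp_all add: cvec_pair.linear_add[OF \<phi>(1)] cvec_pair.linear_add[OF \<psi>(1)]
        cvec_pair.linear_scale[OF \<phi>(1)] cvec_pair.linear_scale[OF \<psi>(1)] algebra_simps)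
  show "(0 :: ('a, 'b) tensor) \<noteq> 1"
  proof
    assume "(0 :: ('a, 'b) tensor) = 1"
    then have "tensor_lift (\<lambda>a b. \<phi> a * \<psi> b) (1 :: ('a, 'b) tensor) = 0"
      by (metis cvec_pair.linear_0 clinear_tensor_lift[OF B])
    then show False
      by (simp add: one_tensor_def tensor_lift_tensor[OF B] \<phi> \<psi>)
  qed
qed

end

lemmas times_tensor_tensor = times_tensor_tensor_aux

definition tensor_map :: "('a::complex_vector \<Rightarrow> 'c::complex_vector) \<Rightarrow> ('b::complex_vector \<Rightarrow> 'd::complex_vector) \<Rightarrow>
    ('a, 'b) tensor \<Rightarrow> ('c, 'd) tensor" where
  "tensor_map f g = tensor_lift (\<lambda>a b. f a \<otimes>\<^sub>C g b)"

definition tensor_swap :: "('a::complex_vector, 'b::complex_vector) tensor \<Rightarrow> ('b, 'a) tensor" where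
  "tensor_swap = tensor_lift (\<lambda>a b. b \<otimes>\<^sub>C a)"

definition tensor_assoc :: "(('a::complex_vector, 'b::complex_vector) tensor, 'c::complex_vector) tensor \<Rightarrow>
    ('a, ('b, 'c) tensor) tensor" where
  "tensor_assoc = tensor_lift (\<lambda>t c. tensor_lift (\<lambda>a b. a \<otimes>\<^sub>C (b \<otimes>\<^sub>C c)) t)"

definition tensor_of :: "'a::complex_vector set \<Rightarrow> 'b::complex_vector set \<Rightarrow> ('a, 'b) tensor set" where
  "tensor_of U V = cvec.span {u \<otimes>\<^sub>C v | u v. u \<in> U \<and> v \<in> V}"

section \<open>Quasitriangular and factorizable Hopf algebras\<close>

definition hopf_algebra :: "('h::complex_algebra_1 \<Rightarrow> ('h, 'h) tensor) \<Rightarrow> ('h \<Rightarrow> complex) \<Rightarrow> ('h \<Rightarrow> 'h) \<Rightarrow> bool" where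
  "hopf_algebra \<Delta> \<epsilon> S \<longleftrightarrow> algebra_hom \<Delta> \<and> algebra_hom \<epsilon> \<and> clinear S \<and>
     (\<forall>x. tensor_assoc (tensor_map \<Delta> id (\<Delta> x)) = tensor_map id \<Delta> (\<Delta> x)) \<and>
     (\<forall>x. tensor_lift (\<lambda>a b. \<epsilon> a *\<^sub>C b) (\<Delta> x) = x) \<and>
     (\<forall>x. tensor_lift (\<lambda>a b. \<epsilon> b *\<^sub>C a) (\<Delta> x) = x) \<and>
     (\<forall>x. tensor_lift (\<lambda>a b. S a * b) (\<Delta> x) = \<epsilon> x *\<^sub>C 1) \<and>
     (\<forall>x. tensor_lift (\<lambda>a b. a * S b) (\<Delta> x) = \<epsilon> x *\<^sub>C 1)"

definition R_matrix :: "('h::complex_algebra_1 \<Rightarrow> ('h, 'h) tensor) \<Rightarrow> ('h, 'h) tensor \<Rightarrow> bool" where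
  "R_matrix \<Delta> R \<longleftrightarrow>
     (\<exists>R'. R * R' = 1 \<and> R' * R = 1) \<and>
     (\<forall>x. tensor_swap (\<Delta> x) * R = R * \<Delta> x) \<and>
     (let R\<^sub>1\<^sub>2 = tensor_lift (\<lambda>a b. a \<otimes>\<^sub>C b \<otimes>\<^sub>C 1) R;
          R\<^sub>1\<^sub>3 = tensor_lift (\<lambda>a b. a \<otimes>\<^sub>C 1 \<otimes>\<^sub>C b) R;
          R\<^sub>2\<^sub>3 = tensor_lift (\<lambda>a b. 1 \<otimes>\<^sub>C a \<otimes>\<^sub>C b) R
      in tensor_assoc (tensor_map \<Delta> id R) = R\<^sub>1\<^sub>3 * R\<^sub>2\<^sub>3 \<and>
         tensor_map id \<Delta> R = R\<^sub>1\<^sub>3 * R\<^sub>1\<^sub>2)"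

definition finite_dimensional :: "'a::complex_vector itself \<Rightarrow> bool" where
  "finite_dimensional _ \<longleftrightarrow> (\<exists>B :: 'a set. finite B \<and> cvec.span B = UNIV)"

definition factorizable ::
  "('h::complex_algebra_1 \<Rightarrow> ('h, 'h) tensor) \<Rightarrow> ('h \<Rightarrow> complex) \<Rightarrow> ('h \<Rightarrow> 'h) \<Rightarrow> ('h, 'h) tensor \<Rightarrow> bool" where
  "factorizable \<Delta> \<epsilon> S R \<longleftrightarrow>
     finite_dimensional TYPE('h) \<and> hopf_algebra \<Delta> \<epsilon> S \<and> R_matrix \<Delta> R \<and>
     bij_betw (\<lambda>\<phi>. tensor_lift (\<lambda>a b. \<phi> b *\<^sub>C a) (tensor_swap R * R)) {\<phi> :: 'h \<Rightarrow> complex. clinear \<phi>} UNIV"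

section \<open>Simple Lie algebras and their lattices\<close>

definition lie_algebra :: "('g::complex_vector \<Rightarrow> 'g \<Rightarrow> 'g) \<Rightarrow> bool" where
  "lie_algebra br \<longleftrightarrow> cbilinear br \<and> (\<forall>x. br x x = 0) \<and>
     (\<forall>x y z. br x (br y z) + br y (br z x) + br z (br x y) = 0)"

definition simple_lie_algebra :: "('g::complex_vector \<Rightarrow> 'g \<Rightarrow> 'g) \<Rightarrow> bool" where
  "simple_lie_algebra br \<longleftrightarrow> lie_algebra br \<and> (\<exists>x y. br x y \<noteq> 0) \<and>
     (\<forall>J. cvec.subspace J \<and> (\<forall>x. \<forall>y\<in>J. br x y \<in> J) \<longrightarrow> J = {0} \<or> J = UNIV)"

text \<open>For semisimple Lie algebras, a Cartan subalgebra is a maximal abelian subalgebra acting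
  diagonalizably in the adjoint representation.\<close>

definition cartan_subalgebra :: "('g::complex_vector \<Rightarrow> 'g \<Rightarrow> 'g) \<Rightarrow> 'g set \<Rightarrow> bool" where
  "cartan_subalgebra br \<hh> \<longleftrightarrow> cvec.subspace \<hh> \<and> (\<forall>x\<in>\<hh>. \<forall>y\<in>\<hh>. br x y = 0) \<and>
     (\<forall>x. (\<forall>y\<in>\<hh>. br y x = 0) \<longrightarrow> x \<in> \<hh>) \<and>
     (\<forall>y\<in>\<hh>. cvec.span {x. \<exists>c. br y x = c *\<^sub>C x} = UNIV)"

text \<open>Linear forms on \<open>\<hh>\<close> are represented by functions that vanish off \<open>\<hh>\<close>.\<close>

definition dual_of :: "'g::complex_vector set \<Rightarrow> ('g \<Rightarrow> complex) set" where
  "dual_of \<hh> = {\<phi>. (\<forall>x\<in>\<hh>. \<forall>y\<in>\<hh>. \<phi> (x + y) = \<phi> x + \<phi> y) \<and>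
     (\<forall>c. \<forall>x\<in>\<hh>. \<phi> (c *\<^sub>C x) = c * \<phi> x) \<and> (\<forall>x. x \<notin> \<hh> \<longrightarrow> \<phi> x = 0)}"

definition roots :: "('g::complex_vector \<Rightarrow> 'g \<Rightarrow> 'g) \<Rightarrow> 'g set \<Rightarrow> ('g \<Rightarrow> complex) set" where
  "roots br \<hh> = {\<beta> \<in> dual_of \<hh>. \<beta> \<noteq> 0 \<and> (\<exists>x. x \<noteq> 0 \<and> (\<forall>y\<in>\<hh>. br y x = \<beta> y *\<^sub>C x))}"

definition int_span :: "('i::finite \<Rightarrow> 'g \<Rightarrow> complex) \<Rightarrow> ('g \<Rightarrow> complex) set" where
  "int_span v = {\<lambda>x. \<Sum>i\<in>UNIV. of_int (n i) * v i x | n. True}"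

definition nat_span :: "('i::finite \<Rightarrow> 'g \<Rightarrow> complex) \<Rightarrow> ('g \<Rightarrow> complex) set" where
  "nat_span v = {\<lambda>x. \<Sum>i\<in>UNIV. of_nat (n i) * v i x | n. True}"

definition simple_roots ::
  "('g::complex_vector \<Rightarrow> 'g \<Rightarrow> 'g) \<Rightarrow> 'g set \<Rightarrow> ('i::finite \<Rightarrow> 'g \<Rightarrow> complex) \<Rightarrow> bool" where
  "simple_roots br \<hh> \<alpha> \<longleftrightarrow> range \<alpha> \<subseteq> roots br \<hh> \<and>
     (\<forall>c :: 'i \<Rightarrow> complex. (\<forall>x. (\<Sum>i\<in>UNIV. c i * \<alpha> i x) = 0) \<longrightarrow> (\<forall>i. c i = 0)) \<and>
     (\<forall>\<beta>\<in>roots br \<hh>. \<beta> \<in> nat_span \<alpha> \<or> - \<beta> \<in> nat_span \<alpha>)"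

definition invariant_form :: "('g::complex_vector \<Rightarrow> 'g \<Rightarrow> 'g) \<Rightarrow> ('g \<Rightarrow> 'g \<Rightarrow> complex) \<Rightarrow> bool" where
  "invariant_form br \<kappa> \<longleftrightarrow> cbilinear \<kappa> \<and> (\<forall>x y. \<kappa> x y = \<kappa> y x) \<and>
     (\<forall>x y z. \<kappa> (br x y) z = \<kappa> x (br y z)) \<and> (\<forall>x. (\<forall>y. \<kappa> x y = 0) \<longrightarrow> x = 0)"

text \<open>\<open>ip\<close> is the form on \<open>\<hh>\<^sup>*\<close> obtained from \<open>\<kappa>\<close> by transport along the isomorphism
  \<open>\<hh> \<rightarrow> \<hh>\<^sup>*\<close>, \<open>x \<mapsto> \<kappa> x\<close>; its values off \<open>dual_of \<hh>\<close> are irrelevant.\<close>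

definition induced_form ::
  "'g::complex_vector set \<Rightarrow> ('g \<Rightarrow> 'g \<Rightarrow> complex) \<Rightarrow> (('g \<Rightarrow> complex) \<Rightarrow> ('g \<Rightarrow> complex) \<Rightarrow> complex) \<Rightarrow> bool" where
  "induced_form \<hh> \<kappa> ip \<longleftrightarrow>
     (\<forall>\<phi>\<in>dual_of \<hh>. \<forall>\<psi>\<in>dual_of \<hh>. ip \<phi> \<psi> = ip \<psi> \<phi>) \<and>
     (\<forall>\<phi>\<in>dual_of \<hh>. \<forall>\<psi>\<in>dual_of \<hh>. \<forall>\<chi>\<in>dual_of \<hh>. ip (\<phi> + \<psi>) \<chi> = ip \<phi> \<chi> + ip \<psi> \<chi>) \<and>
     (\<forall>c. \<forall>\<phi>\<in>dual_of \<hh>. \<forall>\<psi>\<in>dual_of \<hh>. ip (\<lambda>x. c * \<phi> x) \<psi> = c * ip \<phi> \<psi>) \<and>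
     (\<forall>x\<in>\<hh>. \<forall>y\<in>\<hh>. ip (\<lambda>z. if z \<in> \<hh> then \<kappa> x z else 0) (\<lambda>z. if z \<in> \<hh> then \<kappa> y z else 0) = \<kappa> x y)"

text \<open>The short roots are those of minimal length (all roots, in the simply laced case).\<close>

definition short_normalized ::
  "('g \<Rightarrow> complex) set \<Rightarrow> (('g \<Rightarrow> complex) \<Rightarrow> ('g \<Rightarrow> complex) \<Rightarrow> complex) \<Rightarrow> bool" where
  "short_normalized \<Phi> ip \<longleftrightarrow> (\<exists>\<beta>\<in>\<Phi>. ip \<beta> \<beta> = 2) \<and> (\<forall>\<beta>\<in>\<Phi>. \<exists>r::real. r \<ge> 2 \<and> ip \<beta> \<beta> = of_real r)"

text \<open>\<open>(\<phi>, \<psi>)\<close> as an exponent of \<open>q\<close>; used only when one of \<open>\<phi>\<close>, \<open>\<psi>\<close> lies in the weight lattice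
  and the other in the root lattice, and then \<open>(\<phi>, \<psi>)\<close> is an integer.\<close>

definition int_ip :: "(('g \<Rightarrow> complex) \<Rightarrow> ('g \<Rightarrow> complex) \<Rightarrow> complex) \<Rightarrow> ('g \<Rightarrow> complex) \<Rightarrow> ('g \<Rightarrow> complex) \<Rightarrow> int" where
  "int_ip ip \<phi> \<psi> = \<lfloor>Re (ip \<phi> \<psi>)\<rfloor>"

definition lattice_group :: "('g \<Rightarrow> complex) set \<Rightarrow> ('g \<Rightarrow> complex) monoid" where
  "lattice_group L = \<lparr>carrier = L, mult = (+), one = 0\<rparr>"

text \<open>The class of \<open>\<phi> \<in> L\<close> in \<open>lattice_group L Mod L'\<close>.\<close>

definition cls :: "('g \<Rightarrow> complex) set \<Rightarrow> ('g \<Rightarrow> complex) \<Rightarrow> ('g \<Rightarrow> complex) set" where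
  "cls L' \<phi> = L' #>\<^bsub>lattice_group UNIV\<^esub> \<phi>"

text \<open>\<open>L\<close> and \<open>L'\<close> are the lattices \<open>\<Lambda>\<close> and \<open>\<Lambda>'\<close>, the root and weight lattices are \<open>int_span \<alpha>\<close> and
  \<open>int_span \<omega>\<close>, and the \<open>\<omega> i\<close> are the fundamental weights.  The numbers \<open>d i = (\<alpha>\<^sub>i, \<alpha>\<^sub>i)/2 \<in> {1, 2, 3}\<close> occur
  as exponents of \<open>q\<close> and are therefore typed as natural numbers.\<close>

locale quantum_group_data =
  fixes br :: "'g::complex_vector \<Rightarrow> 'g \<Rightarrow> 'g" and \<hh> :: "'g set" and \<kappa> :: "'g \<Rightarrow> 'g \<Rightarrow> complex"
    and ip :: "('g \<Rightarrow> complex) \<Rightarrow> ('g \<Rightarrow> complex) \<Rightarrow> complex"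
    and \<alpha> :: "'i::finite \<Rightarrow> 'g \<Rightarrow> complex" and \<omega> :: "'i \<Rightarrow> 'g \<Rightarrow> complex" and d :: "'i \<Rightarrow> nat"
    and l :: nat and q :: complex and L L' :: "('g \<Rightarrow> complex) set"
  assumes simple: "simple_lie_algebra br" and fin_dim: "finite_dimensional TYPE('g)"
    and cartan: "cartan_subalgebra br \<hh>"
    and simple_roots: "simple_roots br \<hh> \<alpha>"
    and invariant_form: "invariant_form br \<kappa>" and induced_form: "induced_form \<hh> \<kappa> ip"
    and normalized: "short_normalized (roots br \<hh>) ip"
    and d: "\<And>i. of_nat (d i) = ip (\<alpha> i) (\<alpha> i) / 2"
    and fundamental_weights: "\<And>i. \<omega> i \<in> dual_of \<hh>"
      "\<And>i j. ip (\<omega> i) (\<alpha> j) = (if i = j then of_nat (d i) else 0)"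
    and primitive_root: "l \<ge> 1" "q ^ l = 1" "\<And>k. 0 < k \<Longrightarrow> k < l \<Longrightarrow> q ^ k \<noteq> 1"
    and q_power: "\<And>i. q ^ (2 * d i) \<noteq> 1"
    and lattice: "subgroup L (lattice_group (int_span \<omega>))" "int_span \<alpha> \<subseteq> L"
    and sublattice:
      "subgroup L' (lattice_group {\<nu> \<in> int_span \<alpha>. \<forall>\<mu>\<in>int_span \<alpha>. \<exists>k::int. ip \<nu> \<mu> = of_int (int l * k)})"
      "finite (rcosets\<^bsub>lattice_group {\<nu> \<in> int_span \<alpha>. \<forall>\<mu>\<in>int_span \<alpha>. \<exists>k::int. ip \<nu> \<mu> = of_int (int l * k)}\<^esub> L')"

section \<open>Lusztig's form\<close>

definition weight :: "('i \<Rightarrow> 'g \<Rightarrow> complex) \<Rightarrow> 'i list \<Rightarrow> 'g \<Rightarrow> complex" where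
  "weight \<alpha> w = sum_list (map \<alpha> w)"

text \<open>The product \<open>(x\<^sub>1 \<otimes> x\<^sub>2)(y\<^sub>1 \<otimes> y\<^sub>2) = q\<^bsup>(|x\<^sub>2|, |y\<^sub>1|)\<^esup> x\<^sub>1y\<^sub>1 \<otimes> x\<^sub>2y\<^sub>2\<close> on \<open>T \<otimes> T\<close>, where \<open>x\<^sub>2\<close> and \<open>y\<^sub>1\<close> are
  expanded into words, which are homogeneous.\<close>

definition twisted_mult ::
  "complex \<Rightarrow> (('g \<Rightarrow> complex) \<Rightarrow> ('g \<Rightarrow> complex) \<Rightarrow> complex) \<Rightarrow> ('i \<Rightarrow> 'g \<Rightarrow> complex) \<Rightarrow>
   ('i free_algebra, 'i free_algebra) tensor \<Rightarrow> ('i free_algebra, 'i free_algebra) tensor \<Rightarrow>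
   ('i free_algebra, 'i free_algebra) tensor" where
  "twisted_mult q ip \<alpha> s t =
     tensor_lift (\<lambda>x\<^sub>1 x\<^sub>2. tensor_lift (\<lambda>y\<^sub>1 y\<^sub>2.
       linext (\<lambda>u. linext (\<lambda>v. q powi int_ip ip (weight \<alpha> u) (weight \<alpha> v) *\<^sub>C
         ((x\<^sub>1 * word v) \<otimes>\<^sub>C (word u * y\<^sub>2))) y\<^sub>1) x\<^sub>2) t) s"

text \<open>The algebra map \<open>r : T \<rightarrow> T \<otimes> T\<close> for the twisted product with
  \<open>r \<theta>\<^sub>i = \<theta>\<^sub>i \<otimes> 1 + 1 \<otimes> \<theta>\<^sub>i\<close>.\<close>

definition lusztig_r ::
  "complex \<Rightarrow> (('g \<Rightarrow> complex) \<Rightarrow> ('g \<Rightarrow> complex) \<Rightarrow> complex) \<Rightarrow> ('i \<Rightarrow> 'g \<Rightarrow> complex) \<Rightarrow>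
   'i free_algebra \<Rightarrow> ('i free_algebra, 'i free_algebra) tensor" where
  "lusztig_r q ip \<alpha> =
     linext (\<lambda>w. foldr (\<lambda>i t. twisted_mult q ip \<alpha> (gen i \<otimes>\<^sub>C 1 + 1 \<otimes>\<^sub>C gen i) t) w 1)"

definition tensor_form :: "('a::complex_vector \<Rightarrow> 'a \<Rightarrow> complex) \<Rightarrow> ('a, 'a) tensor \<Rightarrow> ('a, 'a) tensor \<Rightarrow> complex" where
  "tensor_form B s t = tensor_lift (\<lambda>a b. tensor_lift (\<lambda>c d. B a c * B b d) t) s"

text \<open>Compatibility in the first argument alone leaves the values of \<open>B (gen i)\<close> outside degree one
  undetermined; as in Lusztig's book, the form is also required to be compatible with \<open>r\<close> in the
  second argument, which forces distinct weight spaces to be orthogonal.\<close>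

definition lusztig_form ::
  "complex \<Rightarrow> (('g \<Rightarrow> complex) \<Rightarrow> ('g \<Rightarrow> complex) \<Rightarrow> complex) \<Rightarrow> ('i \<Rightarrow> 'g \<Rightarrow> complex) \<Rightarrow>
   ('i free_algebra \<Rightarrow> 'i free_algebra \<Rightarrow> complex) \<Rightarrow> bool" where
  "lusztig_form q ip \<alpha> B \<longleftrightarrow> cbilinear B \<and> B 1 1 = 1 \<and>
     (\<forall>i j. B (gen i) (gen j) = (if i = j then 1 else 0)) \<and>
     (\<forall>x y z. B (x * y) z = tensor_form B (x \<otimes>\<^sub>C y) (lusztig_r q ip \<alpha> z)) \<and>
     (\<forall>x y z. B x (y * z) = tensor_form B (lusztig_r q ip \<alpha> x) (y \<otimes>\<^sub>C z))"

definition radical :: "('a \<Rightarrow> 'a \<Rightarrow> complex) \<Rightarrow> 'a set" where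
  "radical B = {x. \<forall>y. B x y = 0}"

section \<open>The small quantum group\<close>

datatype ('k, 'i) generator = GenK 'k | GenE 'i | GenF 'i

definition qg_generators :: "'k monoid \<Rightarrow> ('k, 'i) generator set" where
  "qg_generators Q = GenK ` carrier Q \<union> range GenE \<union> range GenF"

definition qg_relations ::
  "(('g \<Rightarrow> complex) \<Rightarrow> ('g \<Rightarrow> complex) \<Rightarrow> complex) \<Rightarrow> ('i \<Rightarrow> 'g \<Rightarrow> complex) \<Rightarrow> ('i \<Rightarrow> nat) \<Rightarrow> complex \<Rightarrow>
   ('g \<Rightarrow> complex) set \<Rightarrow> ('g \<Rightarrow> complex) set \<Rightarrow> ('i free_algebra \<Rightarrow> 'i free_algebra \<Rightarrow> complex) \<Rightarrow>
   (('g \<Rightarrow> complex) set, 'i) generator free_algebra set" where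
  "qg_relations ip \<alpha> d q L L' B =
     (let K = \<lambda>\<phi>. gen (GenK (cls L' \<phi>)); E = \<lambda>i. gen (GenE i); F = \<lambda>i. gen (GenF i) in
     {K \<phi> * K \<psi> - K (\<phi> + \<psi>) | \<phi> \<psi>. \<phi> \<in> L \<and> \<psi> \<in> L} \<union>
     {K 0 - 1} \<union>
     {K \<phi> * E i * K (- \<phi>) - q powi int_ip ip \<phi> (\<alpha> i) *\<^sub>C E i | \<phi> i. \<phi> \<in> L} \<union>
     {K \<phi> * F i * K (- \<phi>) - q powi (- int_ip ip \<phi> (\<alpha> i)) *\<^sub>C F i | \<phi> i. \<phi> \<in> L} \<union>
     {E i * F j - F j * E i -
        (if i = j then (1 / (q ^ d i - inverse (q ^ d i))) *\<^sub>C (K (\<alpha> i) - K (- \<alpha> i)) else 0) | i j. True} \<union>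
     eval E ` radical B \<union> eval F ` radical B)"

text \<open>The algebra \<^typ>\<open>'h\<close> is determined up to isomorphism by its presentation.  \<open>K c\<close> matters
  only for \<open>c \<in> \<Lambda>/\<Lambda>'\<close>.  Counit and antipode are determined by \<open>\<Delta>\<close>.\<close>

locale small_quantum_group = quantum_group_data br \<hh> \<kappa> ip \<alpha> \<omega> d l q L L'
  for br :: "'g::complex_vector \<Rightarrow> 'g \<Rightarrow> 'g" and \<hh> \<kappa> ip
    and \<alpha> :: "'i::finite \<Rightarrow> 'g \<Rightarrow> complex" and \<omega> d l q L L' +
  fixes B :: "'i free_algebra \<Rightarrow> 'i free_algebra \<Rightarrow> complex"
    and K :: "('g \<Rightarrow> complex) set \<Rightarrow> 'h::complex_algebra_1" and E F :: "'i \<Rightarrow> 'h"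
    and \<Delta> :: "'h \<Rightarrow> ('h, 'h) tensor" and \<epsilon> :: "'h \<Rightarrow> complex" and S :: "'h \<Rightarrow> 'h"
  assumes lusztig_form: "lusztig_form q ip \<alpha> B"
    and presentation: "presented_by (qg_generators (lattice_group L Mod L'))
      (case_generator K E F) (qg_relations ip \<alpha> d q L L' B)"
    and hopf_algebra: "hopf_algebra \<Delta> \<epsilon> S"
    and coproduct_K: "\<And>c. c \<in> carrier (lattice_group L Mod L') \<Longrightarrow> \<Delta> (K c) = K c \<otimes>\<^sub>C K c"
    and coproduct_E: "\<And>i. \<Delta> (E i) = E i \<otimes>\<^sub>C 1 + K (cls L' (\<alpha> i)) \<otimes>\<^sub>C E i"
    and coproduct_F: "\<And>i. \<Delta> (F i) = F i \<otimes>\<^sub>C K (cls L' (- \<alpha> i)) + 1 \<otimes>\<^sub>C F i"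

definition bar_coproduct ::
  "('i \<Rightarrow> 'g \<Rightarrow> complex) \<Rightarrow> ('g \<Rightarrow> complex) set \<Rightarrow> ('g \<Rightarrow> complex) set \<Rightarrow>
   (('g \<Rightarrow> complex) set \<Rightarrow> 'h::complex_algebra_1) \<Rightarrow> ('i \<Rightarrow> 'h) \<Rightarrow> ('i \<Rightarrow> 'h) \<Rightarrow>
   ('h \<Rightarrow> ('h, 'h) tensor) \<Rightarrow> bool" where
  "bar_coproduct \<alpha> L L' K E F \<Delta>b \<longleftrightarrow> algebra_hom \<Delta>b \<and>
     (\<forall>c\<in>carrier (lattice_group L Mod L'). \<Delta>b (K c) = K c \<otimes>\<^sub>C K c) \<and>
     (\<forall>i. \<Delta>b (E i) = E i \<otimes>\<^sub>C 1 + K (cls L' (- \<alpha> i)) \<otimes>\<^sub>C E i) \<and>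
     (\<forall>i. \<Delta>b (F i) = F i \<otimes>\<^sub>C K (cls L' (\<alpha> i)) + 1 \<otimes>\<^sub>C F i)"

text \<open>\<open>u\<^sup>+\<^sub>\<beta>\<close> for \<open>X = E\<close>, and \<open>u\<^sup>-\<^sub>\<beta>\<close> for \<open>X = F\<close>.\<close>

definition graded_piece :: "('i \<Rightarrow> 'g \<Rightarrow> complex) \<Rightarrow> ('i \<Rightarrow> 'h) \<Rightarrow> ('g \<Rightarrow> complex) \<Rightarrow> 'h::complex_algebra_1 set" where
  "graded_piece \<alpha> X \<beta> = cvec.span {prod_list (map X w) | w. weight \<alpha> w = \<beta>}"

definition quasi_R_matrix ::
  "('i::finite \<Rightarrow> 'g \<Rightarrow> complex) \<Rightarrow> ('i \<Rightarrow> 'h::complex_algebra_1) \<Rightarrow> ('i \<Rightarrow> 'h) \<Rightarrow>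
   ('h \<Rightarrow> ('h, 'h) tensor) \<Rightarrow> ('h \<Rightarrow> ('h, 'h) tensor) \<Rightarrow> ('h, 'h) tensor \<Rightarrow> bool" where
  "quasi_R_matrix \<alpha> E F \<Delta> \<Delta>b \<Theta> \<longleftrightarrow>
     (\<exists>T. finite {\<beta> \<in> nat_span \<alpha>. T \<beta> \<noteq> 0} \<and>
        (\<forall>\<beta>\<in>nat_span \<alpha>. T \<beta> \<in> tensor_of (graded_piece \<alpha> F \<beta>) (graded_piece \<alpha> E \<beta>)) \<and>
        T 0 = 1 \<otimes>\<^sub>C 1 \<and> \<Theta> = (\<Sum>\<beta>\<in>{\<beta> \<in> nat_span \<alpha>. T \<beta> \<noteq> 0}. T \<beta>)) \<and>
     (\<forall>x. \<Delta>b x * \<Theta> = \<Theta> * \<Delta> x)"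

definition system_E ::
  "(('g \<Rightarrow> complex) \<Rightarrow> ('g \<Rightarrow> complex) \<Rightarrow> complex) \<Rightarrow> ('i::finite \<Rightarrow> 'g \<Rightarrow> complex) \<Rightarrow> complex \<Rightarrow>
   ('g \<Rightarrow> complex) set \<Rightarrow> ('g \<Rightarrow> complex) set \<Rightarrow> ('g \<Rightarrow> complex) set set \<Rightarrow> ('g \<Rightarrow> complex) set set \<Rightarrow>
   (('g \<Rightarrow> complex) set \<Rightarrow> ('g \<Rightarrow> complex) set \<Rightarrow> complex) \<Rightarrow> bool" where
  "system_E ip \<alpha> q L L' G\<^sub>1 G\<^sub>2 f \<longleftrightarrow>
     (let Q = lattice_group L Mod L' in
     (\<forall>a\<in>int_span \<alpha>. \<forall>\<mu>\<in>G\<^sub>1. \<forall>\<nu>\<in>G\<^sub>2. \<forall>n\<in>\<nu>. f (\<mu> \<otimes>\<^bsub>Q\<^esub> cls L' a) \<nu> = q powi (- int_ip ip n a) * f \<mu> \<nu>) \<and>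
     (\<forall>a\<in>int_span \<alpha>. \<forall>\<mu>\<in>G\<^sub>1. \<forall>\<nu>\<in>G\<^sub>2. \<forall>m\<in>\<mu>. f \<mu> (\<nu> \<otimes>\<^bsub>Q\<^esub> cls L' a) = q powi (- int_ip ip m a) * f \<mu> \<nu>) \<and>
     (\<forall>\<mu>\<^sub>1\<in>G\<^sub>1. \<forall>\<mu>\<^sub>2\<in>G\<^sub>1. \<forall>\<nu>\<in>G\<^sub>2.
        (\<Sum>(\<nu>\<^sub>1, \<nu>\<^sub>2)\<in>{(\<nu>\<^sub>1, \<nu>\<^sub>2) \<in> G\<^sub>2 \<times> G\<^sub>2. \<nu>\<^sub>1 \<otimes>\<^bsub>Q\<^esub> \<nu>\<^sub>2 = \<nu>}. f \<mu>\<^sub>1 \<nu>\<^sub>1 * f \<mu>\<^sub>2 \<nu>\<^sub>2)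
          = (if \<mu>\<^sub>1 = \<mu>\<^sub>2 then f \<mu>\<^sub>1 \<nu> else 0)) \<and>
     (\<forall>\<nu>\<^sub>1\<in>G\<^sub>2. \<forall>\<nu>\<^sub>2\<in>G\<^sub>2. \<forall>\<mu>\<in>G\<^sub>1.
        (\<Sum>(\<mu>\<^sub>1, \<mu>\<^sub>2)\<in>{(\<mu>\<^sub>1, \<mu>\<^sub>2) \<in> G\<^sub>1 \<times> G\<^sub>1. \<mu>\<^sub>1 \<otimes>\<^bsub>Q\<^esub> \<mu>\<^sub>2 = \<mu>}. f \<mu>\<^sub>1 \<nu>\<^sub>1 * f \<mu>\<^sub>2 \<nu>\<^sub>2)
          = (if \<nu>\<^sub>1 = \<nu>\<^sub>2 then f \<mu> \<nu>\<^sub>1 else 0)) \<and>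
     (\<forall>\<nu>\<in>G\<^sub>2. (\<Sum>\<mu>\<in>G\<^sub>1. f \<mu> \<nu>) = (if \<nu> = \<one>\<^bsub>Q\<^esub> then 1 else 0)) \<and>
     (\<forall>\<mu>\<in>G\<^sub>1. (\<Sum>\<nu>\<in>G\<^sub>2. f \<mu> \<nu>) = (if \<mu> = \<one>\<^bsub>Q\<^esub> then 1 else 0)))"

text \<open>Invertibility of the square matrix \<open>m\<close> with rows and columns indexed by the finite set \<open>I\<close>.\<close>

definition invertible_on :: "'k set \<Rightarrow> ('k \<Rightarrow> 'k \<Rightarrow> complex) \<Rightarrow> bool" where
  "invertible_on I m \<longleftrightarrow> (\<exists>m'. \<forall>i\<in>I. \<forall>j\<in>I.
     (\<Sum>k\<in>I. m i k * m' k j) = (if i = j then 1 else 0) \<and>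
     (\<Sum>k\<in>I. m' i k * m k j) = (if i = j then 1 else 0))"

end

theory Submission
  imports Defs "HOL-Library.Multiset"
begin

text \<open>
  Write \<open>\<Theta> = \<Sum>\<^sub>p f\<^sub>p \<otimes> e\<^sub>p\<close> with homogeneous \<open>f\<^sub>p \<in> u\<^sup>-\<close>, \<open>e\<^sub>p \<in> u\<^sup>+\<close> of weights \<open>\<plusminus>\<beta>\<^sub>p\<close> and \<open>e\<^sub>p\<close> linearly
  independent.  By system (E), moving \<open>R\<^sub>0\<close> past \<open>e\<^sub>p \<otimes> f\<^sub>p\<close> costs only a scalar and a shift of the
  indices, so that up to nonzero scalars
  \<open>R\<^sub>2\<^sub>1R = \<Sum> m\<^sub>\<mu>\<^sub>\<nu> K\<^sub>\<mu>\<^sub>+\<^sub>\<beta> e\<^sub>p f\<^sub>p' \<otimes> K\<^sub>\<nu>\<^sub>-\<^sub>\<beta> f\<^sub>p e\<^sub>p'\<close> with \<open>\<beta> = \<beta>\<^sub>p\<close>.  If the two families are bases,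
  the coefficient matrix is block diagonal with blocks \<open>m\<close>.

  Linear independence comes from functionals \<open>K\<^sub>c F\<^sub>x E\<^sub>y \<mapsto> g(c) B(x, a) B(y, b)\<close>, constructed from a module
  with basis \<open>K\<^sub>c F\<^sub>u E\<^sub>v\<close> on which the defining relations act as zero modulo the radical of \<open>B\<close>.
  The intertwining property of \<open>\<Theta>\<close> shows that a functional on \<open>u\<^sup>\<plusminus>\<close> whose slice of \<open>\<Theta>\<close> vanishes is zero; so
  the finite families \<open>(e\<^sub>p)\<close> and \<open>(f\<^sub>p)\<close> are bases of \<open>u\<^sup>\<plusminus>\<close>, which also gives \<open>dim u < \<infinity>\<close>.  This needs
  \<open>2\<alpha>\<^sub>i \<notin> \<Lambda>'\<close>, which is not among the hypotheses but follows from the invertibility of \<open>m\<close>.  Conversely, a kernel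
  vector \<open>v\<close> of \<open>m\<close> yields the functional \<open>K\<^sub>c F\<^sub>x E\<^sub>y \<mapsto> v(c) B(x, 1) B(y, 1)\<close>, whose slice of \<open>R\<^sub>2\<^sub>1R\<close> vanishes.
\<close>

section \<open>Linear maps on free algebras and tensors\<close>

text \<open>A presentation bounds an algebra only from above, so independence has to be forced by
  functionals. They come from the form itself: multiplication by a generator has a skew derivation
  as adjoint, and the same derivations occur when E_i is moved past a product of F's. Hence the
  radical of \<open>B\<close> is respected by the straightening. The form is known only through its
  axioms, so even the orthogonality of 1 and the generators has to be derived.

  Functionals are available for the order K F E only. The order K E F is settled by counting: the
  families of the monodromy element span, and they are indexed like a family in the order K F E that
  is independent.

  The condition on 2\<alpha>_i has its origin in the intertwining property, which only equates an
  element of K(-\<alpha>_i) u^- with one of K(\<alpha>_i) u^- (and likewise for u^+). This forces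
  both to vanish once the two classes differ.\<close>

lemmas clin_add = cvec_pair.linear_add and clin_scale = cvec_pair.linear_scale
  and clin_0 = cvec_pair.linear_0 and clin_diff = cvec_pair.linear_diff
  and clin_sum = cvec_pair.linear_sum

text \<open>As a rewrite rule, \<open>scaleC_complex_def\<close> also rewrites the scalar multiplication inside
  \<^const>\<open>Vector_Spaces.linear\<close>; the congruence rule keeps linearity statements intact.\<close>

lemma linear_weak_cong [cong]: "f = g \<Longrightarrow> Vector_Spaces.linear s s' f = Vector_Spaces.linear s s' g"
  by simp

named_theorems clinear_intros

lemma clinear_id [clinear_intros]: "clinear (\<lambda>x. x)"
  by (rule clinearI) auto

lemma clinear_const_0 [clinear_intros]: "clinear (\<lambda>x. 0)"
  by (rule clinearI) auto

lemma clinear_comp: "clinear f \<Longrightarrow> clinear g \<Longrightarrow> clinear (\<lambda>x. f (g x))"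
  by (rule clinearI) (simp_all add: clin_add clin_scale)

lemma clinear_plus [clinear_intros]: "clinear f \<Longrightarrow> clinear g \<Longrightarrow> clinear (\<lambda>x. f x + g x)"
  by (rule clinearI) (simp_all add: clin_add clin_scale scaleC_add_right)

lemma clinear_minus [clinear_intros]: "clinear f \<Longrightarrow> clinear g \<Longrightarrow> clinear (\<lambda>x. f x - g x)"
  by (rule clinearI) (simp_all add: clin_add clin_scale cvec.scale_right_diff_distrib)

lemma clinear_scaleC [clinear_intros]: "clinear f \<Longrightarrow> clinear (\<lambda>x. c *\<^sub>C f x)"
  by (rule clinearI) (simp_all add: clin_add clin_scale scaleC_add_right mult.commute)

lemma clinear_scaleC_left [clinear_intros]: "clinear f \<Longrightarrow> clinear (\<lambda>x. f x *\<^sub>C v)"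
  by (rule clinearI) (simp_all add: clin_add clin_scale scaleC_add_left)

lemma clinear_mult_right [clinear_intros]:
  "clinear f \<Longrightarrow> clinear (\<lambda>x. (a::'a::complex_algebra_1) * f x)"
  by (rule clinearI) (simp_all add: clin_add clin_scale distrib_left)

lemma clinear_mult_left [clinear_intros]:
  "clinear f \<Longrightarrow> clinear (\<lambda>x. f x * (a::'a::complex_algebra_1))"
  by (rule clinearI) (simp_all add: clin_add clin_scale distrib_right)

lemma clinear_linext' [clinear_intros]: "clinear f \<Longrightarrow> clinear (\<lambda>x. linext g (f x))"
  by (rule clinear_comp[OF clinear_linext])

lemma clinear_tensor_left [clinear_intros]: "clinear f \<Longrightarrow> clinear (\<lambda>x. f x \<otimes>\<^sub>C y)"
  by (rule clinearI) (simp_all add: clin_add clin_scale cbilinearD[OF cbilinear_tensor])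

lemma clinear_tensor_right [clinear_intros]: "clinear f \<Longrightarrow> clinear (\<lambda>x. y \<otimes>\<^sub>C f x)"
  by (rule clinearI) (simp_all add: clin_add clin_scale cbilinearD[OF cbilinear_tensor])

lemma clinear_lookup [clinear_intros]: "clinear (\<lambda>p. Poly_Mapping.lookup p k)"
  by (rule clinearI) (simp_all add: lookup_add)

lemma clinear_sum [clinear_intros]: "(\<And>i. i \<in> A \<Longrightarrow> clinear (f i)) \<Longrightarrow> clinear (\<lambda>x. \<Sum>i\<in>A. f i x)"
  by (induct A rule: infinite_finite_induct) (simp_all add: clinear_intros)

lemma clinear_if [clinear_intros]:
  "clinear f \<Longrightarrow> clinear g \<Longrightarrow> clinear (\<lambda>x. if P then f x else g x)"
  by (cases P) simp_all

lemma cbilinearI': "(\<And>x. clinear (B x)) \<Longrightarrow> (\<And>y. clinear (\<lambda>x. B x y)) \<Longrightarrow> cbilinear B"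
  by (simp add: cbilinear_def)

lemma poly_mapping_linear_eqI:
  assumes "clinear f" "clinear g" "\<And>k. f (Poly_Mapping.single k 1) = g (Poly_Mapping.single k 1)"
  shows "f p = g (p :: 'k \<Rightarrow>\<^sub>0 complex)"
proof (induct p rule: poly_mapping_add_induct)
  case (single k v)
  have "Poly_Mapping.single k v = v *\<^sub>C Poly_Mapping.single k 1" by simp
  then show ?case using assms by (metis clin_scale)
next
  case (add p p')
  then show ?case using assms by (simp add: clin_add)
qed

lemma word_linear_eqI:
  assumes "clinear f" "clinear g" "\<And>w. f (word w) = g (word w)"
  shows "f p = g p"
  using assms unfolding word_def by (rule poly_mapping_linear_eqI)

lemma linext_word [simp]: "linext g (word w) = g w"
  by (simp add: word_def)

lemma linext_clinear: "clinear f \<Longrightarrow> linext (\<lambda>w. f (word w)) p = f p"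
  by (rule word_linear_eqI[of "linext _"]) (simp_all add: clinear_intros)

lemma word_Nil: "word [] = 1"
  by (simp add: word_def zero_list_def flip: single_one)

lemma word_append: "word (u @ v) = word u * word v"
  by (simp add: word_def mult_single plus_list_def)

lemma word_Cons: "word (i # w) = gen i * word w"
  using word_append[of "[i]" w] by simp

lemma tensor_linear_eqI:
  assumes "clinear f" "clinear g" "\<And>x y. f (x \<otimes>\<^sub>C y) = g (x \<otimes>\<^sub>C y)"
  shows "f t = g t"
  by (induct t rule: tensor_induct) (use assms in \<open>simp_all add: clin_add\<close>)

lemma clinear_tensor_lift_comp [clinear_intros]:
  "cbilinear C \<Longrightarrow> clinear f \<Longrightarrow> clinear (\<lambda>x. tensor_lift C (f x))"
  by (rule clinear_comp[OF clinear_tensor_lift])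

definition tensor_pair :: "('a::complex_vector \<Rightarrow> complex) \<Rightarrow> ('b::complex_vector \<Rightarrow> complex) \<Rightarrow> ('a, 'b) tensor \<Rightarrow> complex"
  where "tensor_pair \<phi> \<psi> = tensor_lift (\<lambda>x y. \<phi> x * \<psi> y)"

lemma clinear_cmult [clinear_intros]:
  "clinear f \<Longrightarrow> clinear (\<lambda>x. (a::complex) * f x)" "clinear f \<Longrightarrow> clinear (\<lambda>x. f x * (a::complex))"
  by (rule clinearI; simp add: clin_add clin_scale algebra_simps)+

lemma tensor_pair_bilinear: "clinear \<phi> \<Longrightarrow> clinear \<psi> \<Longrightarrow> cbilinear (\<lambda>x y. \<phi> x * \<psi> y :: complex)"
  by (intro cbilinearI' clinear_intros)

lemma tensor_pair_tensor [simp]: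
  "clinear \<phi> \<Longrightarrow> clinear \<psi> \<Longrightarrow> tensor_pair \<phi> \<psi> (x \<otimes>\<^sub>C y) = \<phi> x * \<psi> y"
  unfolding tensor_pair_def by (rule tensor_lift_tensor[OF tensor_pair_bilinear])

lemma clinear_tensor_pair [clinear_intros]:
  "clinear \<phi> \<Longrightarrow> clinear \<psi> \<Longrightarrow> clinear f \<Longrightarrow> clinear (\<lambda>x. tensor_pair \<phi> \<psi> (f x))"
  unfolding tensor_pair_def by (intro clinear_intros tensor_pair_bilinear)

lemma tensor_pair_0: "clinear \<psi> \<Longrightarrow> tensor_pair (\<lambda>x. 0) \<psi> s = 0"
  by (rule tensor_linear_eqI[of "tensor_pair _ \<psi>"])
    (rule clinear_tensor_pair clinear_const_0 clinear_id | assumption | simp add: clinear_const_0)+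

lemma tensor_pair_0_right: "clinear \<phi> \<Longrightarrow> tensor_pair \<phi> (\<lambda>x. 0) s = 0"
  by (rule tensor_linear_eqI[of "tensor_pair \<phi> _"])
    (rule clinear_tensor_pair clinear_const_0 clinear_id | assumption | simp add: clinear_const_0)+

lemma tensor_pair_scale_left:
  assumes "clinear \<phi>" "clinear \<psi>"
  shows "tensor_pair (\<lambda>x. c * \<phi> x) \<psi> s = c * tensor_pair \<phi> \<psi> s"
proof (rule tensor_linear_eqI[of "tensor_pair _ \<psi>"], goal_cases)
  case 1
  show ?case by (intro clinear_tensor_pair clinear_cmult clinear_id assms)
next
  case 2
  show ?case by (intro clinear_tensor_pair clinear_cmult clinear_id assms)
next
  case (3 x y)
  show ?case by (simp add: assms clinear_cmult)
qed

section \<open>Skew derivations\<close>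

text \<open>The grading, encoded as an action of a torus. With \<open>s = t i\<close> it is the
  factor q^(|x|, \<alpha>_i) of the twisted product; a general \<open>s\<close> detects the number
  of occurrences of each letter.\<close>

definition scale_word :: "('i \<Rightarrow> complex) \<Rightarrow> 'i free_algebra \<Rightarrow> 'i free_algebra" where
  "scale_word s = linext (\<lambda>w. prod_list (map s w) *\<^sub>C word w)"

lemma clinear_scale_word [clinear_intros]: "clinear f \<Longrightarrow> clinear (\<lambda>x. scale_word s (f x))"
  unfolding scale_word_def by (intro clinear_intros)

lemma scale_word_word: "scale_word s (word w) = prod_list (map s w) *\<^sub>C word w"
  by (simp add: scale_word_def)

lemma scale_word_mult: "scale_word s (x * y) = scale_word s x * scale_word s y"
proof (rule word_linear_eqI[of "\<lambda>x. scale_word s (x * y)"], goal_cases)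
  case (3 u)
  show ?case
    by (rule word_linear_eqI[of "\<lambda>y. scale_word s (word u * y)"])
      (intro clinear_intros | simp add: scale_word_word mult.commute flip: word_append)+
qed (intro clinear_intros)+

lemma scale_word_1 [simp]: "scale_word s 1 = 1"
  using scale_word_word[of s "[]"] by (simp add: word_Nil)

lemma scale_word_gen: "scale_word s (gen i) = s i *\<^sub>C gen i"
  by (simp add: scale_word_word)

lemma scale_word_scale_word: "scale_word s (scale_word s' x) = scale_word (\<lambda>i. s i * s' i) x"
proof (rule word_linear_eqI[of "\<lambda>x. scale_word s (scale_word s' x)"], goal_cases)
  case (3 w)
  have "prod_list (map (\<lambda>i. s i * s' i) w) = prod_list (map s w) * prod_list (map s' w)"
    by (induct w) simp_all
  then show ?case
    by (simp add: scale_word_word clin_scale[OF clinear_scale_word[OF clinear_id]] mult.commute)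
qed (intro clinear_intros)+

lemma scale_word_const_1 [simp]: "scale_word (\<lambda>_. 1) x = x"
proof (rule word_linear_eqI[of "scale_word _"], goal_cases)
  case (3 w)
  have "prod_list (map (\<lambda>_. 1 :: complex) w) = 1" by (induct w) simp_all
  then show ?case by (simp add: scale_word_word)
qed (intro clinear_intros clinear_scale_word[OF clinear_id])+

text \<open>The skew derivation that Lusztig writes with the index i on the left of r;
  \<open>t i j\<close> stands for q^(\<alpha>_i, \<alpha>_j).\<close>

primrec ldiff_word :: "('i \<Rightarrow> 'i \<Rightarrow> complex) \<Rightarrow> 'i \<Rightarrow> 'i list \<Rightarrow> 'i free_algebra" where
  "ldiff_word t i [] = 0"
| "ldiff_word t i (j # w) = (if i = j then word w else 0) + t i j *\<^sub>C (gen j * ldiff_word t i w)"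

definition ldiff :: "('i \<Rightarrow> 'i \<Rightarrow> complex) \<Rightarrow> 'i \<Rightarrow> 'i free_algebra \<Rightarrow> 'i free_algebra" where
  "ldiff t i = linext (ldiff_word t i)"

text \<open>Here the letter i is extracted towards the right end, so it collects the factors of all
  letters after it; hence the rescaling of the tail.\<close>

primrec rdiff_word :: "('i \<Rightarrow> 'i \<Rightarrow> complex) \<Rightarrow> 'i \<Rightarrow> 'i list \<Rightarrow> 'i free_algebra" where
  "rdiff_word t i [] = 0"
| "rdiff_word t i (j # w) = (if i = j then scale_word (t i) (word w) else 0) + gen j * rdiff_word t i w"

definition rdiff :: "('i \<Rightarrow> 'i \<Rightarrow> complex) \<Rightarrow> 'i \<Rightarrow> 'i free_algebra \<Rightarrow> 'i free_algebra" where
  "rdiff t i = linext (rdiff_word t i)"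

lemma clinear_ldiff [clinear_intros]: "clinear f \<Longrightarrow> clinear (\<lambda>x. ldiff t i (f x))"
  unfolding ldiff_def by (intro clinear_intros)

lemma clinear_rdiff [clinear_intros]: "clinear f \<Longrightarrow> clinear (\<lambda>x. rdiff t i (f x))"
  unfolding rdiff_def by (intro clinear_intros)

lemma ldiff_1 [simp]: "ldiff t i 1 = 0" and rdiff_1 [simp]: "rdiff t i 1 = 0"
  by (simp_all add: ldiff_def rdiff_def flip: word_Nil)

lemma ldiff_gen_mult:
  "ldiff t i (gen j * x) = (if i = j then x else 0) + t i j *\<^sub>C (gen j * ldiff t i x)"
proof (rule word_linear_eqI[of "\<lambda>x. ldiff t i (gen j * x)"], goal_cases)
  case (3 w)
  show ?case by (simp add: ldiff_def flip: word_Cons)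
qed (intro clinear_intros)+

lemma rdiff_gen_mult:
  "rdiff t i (gen j * x) = (if i = j then scale_word (t i) x else 0) + gen j * rdiff t i x"
proof (rule word_linear_eqI[of "\<lambda>x. rdiff t i (gen j * x)"], goal_cases)
  case (3 w)
  show ?case by (simp add: rdiff_def flip: word_Cons)
qed (intro clinear_intros)+

lemma word_induct [case_names Nil Cons]:
  assumes "P 1" "\<And>i w. P (word w) \<Longrightarrow> P (gen i * word w)"
  shows "P (word w)"
proof (induct w)
  case (Cons i w)
  then show ?case using assms(2) by (subst word_Cons)
qed (use assms(1) in \<open>simp add: word_Nil\<close>)

lemma word_eqI_gen:
  assumes "clinear f" "clinear g" "f 1 = g 1"
    and "\<And>i x. f x = g x \<Longrightarrow> f (gen i * x) = g (gen i * x)"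
  shows "f x = g x"
proof (rule word_linear_eqI[OF assms(1,2)])
  show "f (word w) = g (word w)" for w
    by (induct w rule: word_induct) (rule assms(3), rule assms(4))
qed

text \<open>The derivation lowers the degree by \<alpha>_i, so a rescaling passes through it up to
  the factor of the lost letter.\<close>

lemma ldiff_scale_word: "ldiff t i (scale_word s x) = s i *\<^sub>C scale_word s (ldiff t i x)"
proof (induction x rule: word_eqI_gen)
  case (4 j x)
  note [simp] = clin_add[OF clinear_scale_word[OF clinear_id]]
    clin_scale[OF clinear_ldiff[OF clinear_id]] clin_scale[OF clinear_scale_word[OF clinear_id]]
  show ?case
    by (simp add: scale_word_mult scale_word_gen ldiff_gen_mult 4 scaleC_add_right
        clin_0[OF clinear_scale_word[OF clinear_id]] ac_simps)
qed (intro clinear_intros | simp add: clin_0[OF clinear_scale_word[OF clinear_id]])+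

section \<open>Lusztig's form\<close>

text \<open>Left multiplication by gen i \<otimes> 1 + 1 \<otimes> gen i in the twisted product,
  hence the recursion step of r.\<close>

definition twist_gen :: "('i \<Rightarrow> 'i \<Rightarrow> complex) \<Rightarrow> 'i \<Rightarrow> ('i free_algebra, 'i free_algebra) tensor \<Rightarrow>
    ('i free_algebra, 'i free_algebra) tensor" where
  "twist_gen t i = tensor_lift (\<lambda>x y. (gen i * x) \<otimes>\<^sub>C y + scale_word (t i) x \<otimes>\<^sub>C (gen i * y))"

lemma twist_gen_bilinear:
  "cbilinear (\<lambda>x y. (gen i * x) \<otimes>\<^sub>C y + scale_word (t i) x \<otimes>\<^sub>C (gen i * y))"
  by (intro cbilinearI' clinear_intros)

lemma clinear_twist_gen [clinear_intros]: "clinear f \<Longrightarrow> clinear (\<lambda>x. twist_gen t i (f x))"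
  unfolding twist_gen_def by (intro clinear_intros twist_gen_bilinear)

lemma tensor_pair_twist_gen:
  assumes [clinear_intros]: "clinear \<phi>" "clinear \<psi>"
  shows "tensor_pair \<phi> \<psi> (twist_gen t i s) =
    tensor_pair (\<lambda>x. \<phi> (gen i * x)) \<psi> s + tensor_pair (\<lambda>x. \<phi> (scale_word (t i) x)) (\<lambda>y. \<psi> (gen i * y)) s"
proof -
  have [clinear_intros]: "clinear (\<lambda>x. \<phi> (gen i * x))" "clinear (\<lambda>x. \<phi> (scale_word (t i) x))"
    "clinear (\<lambda>x. \<psi> (gen i * x))"
    by (rule clinear_comp[OF assms(1)] clinear_comp[OF assms(2)], intro clinear_intros)+
  show ?thesis
  proof (rule tensor_linear_eqI[of "\<lambda>s. tensor_pair \<phi> \<psi> (twist_gen t i s)"], goal_cases)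
    case (3 x y)
    have "clinear (tensor_pair \<phi> \<psi>)" using clinear_tensor_pair[OF assms clinear_id] .
    from clin_add[OF this] show ?case
      by (simp add: clinear_intros twist_gen_def tensor_lift_tensor[OF twist_gen_bilinear])
  qed (intro clinear_intros)+
qed

text \<open>Only the recursion of \<open>r\<close> and the numbers \<open>t i j\<close> enter here;
  lattices and powers of q stay out until the form is instantiated.\<close>

locale lusztig_pairing =
  fixes t :: "'i \<Rightarrow> 'i \<Rightarrow> complex"
    and r :: "'i free_algebra \<Rightarrow> ('i free_algebra, 'i free_algebra) tensor"
    and B :: "'i free_algebra \<Rightarrow> 'i free_algebra \<Rightarrow> complex"
  assumes t_sym: "t i j = t j i"
    and r_linear: "clinear r" and r_1: "r 1 = 1 \<otimes>\<^sub>C 1" and r_gen: "r (gen i * x) = twist_gen t i (r x)"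
    and bilinear: "cbilinear B" and B_1: "B 1 1 = 1"
    and B_gen: "B (gen i) (gen j) = (if i = j then 1 else 0)"
    and B_mult_left: "B (x * y) z = tensor_pair (B x) (B y) (r z)"
    and B_mult_right: "B x (y * z) = tensor_pair (\<lambda>u. B u y) (\<lambda>u. B u z) (r x)"
begin

lemma B_lin [clinear_intros]:
  "clinear f \<Longrightarrow> clinear (\<lambda>u. B x (f u))" "clinear f \<Longrightarrow> clinear (\<lambda>u. B (f u) x)"
  using clinear_comp[of "B x" f] clinear_comp[of "\<lambda>u. B u x" f] bilinear by (simp_all add: cbilinear_def)

lemma pair_r_gen:
  assumes "clinear \<phi>" "clinear \<psi>"
  shows "tensor_pair \<phi> \<psi> (r (gen i * x)) =
    tensor_pair (\<lambda>x. \<phi> (gen i * x)) \<psi> (r x) +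
    tensor_pair (\<lambda>x. \<phi> (scale_word (t i) x)) (\<lambda>y. \<psi> (gen i * y)) (r x)"
  by (simp add: r_gen tensor_pair_twist_gen assms)

lemma clinear_gen_mult: "clinear \<phi> \<Longrightarrow> clinear (\<lambda>x. \<phi> (gen i * x))"
  by (rule clinear_comp[of \<phi>]) (assumption, rule clinear_mult_right[OF clinear_id])

lemma clinear_of_scale_word: "clinear \<phi> \<Longrightarrow> clinear (\<lambda>x. \<phi> (scale_word s x))"
  by (rule clinear_comp[of \<phi>]) (assumption, rule clinear_scale_word[OF clinear_id])

lemma pair_r_1:
  assumes "clinear \<phi>" "clinear \<psi>"
  shows "tensor_pair \<phi> \<psi> (r 1) = \<phi> 1 * \<psi> 1"
  by (simp add: r_1 assms)

lemma pair_r_gen1: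
  assumes "clinear \<phi>" "clinear \<psi>"
  shows "tensor_pair \<phi> \<psi> (r (gen i)) = \<phi> (gen i) * \<psi> 1 + \<phi> 1 * \<psi> (gen i)"
  using pair_r_gen[OF assms, of i 1]
  by (simp add: pair_r_1 clinear_gen_mult[OF assms(1)] clinear_gen_mult[OF assms(2)]
      clinear_of_scale_word[OF assms(1)] assms)

text \<open>Exchanging the arguments exchanges the two multiplicativity axioms, so one-sided results
  acquire mirror images.\<close>

lemma flip: "lusztig_pairing t r (\<lambda>x y. B y x)"
  by (rule lusztig_pairing.intro)
    (fact t_sym r_linear r_1 r_gen B_1 B_mult_left B_mult_right | use bilinear B_gen in \<open>simp add: cbilinear_def\<close>)+

text \<open>The axioms normalize the form on pairs of generators, not on a generator and 1. Put c =
  B(g, 1) and s = t_ii. Comparing the two multiplicativity axioms on B(g^2, g) gives (1 + s) c = 0,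
  and on B(g^3, g) it gives 3 c^2 (1 + s + s^2) = 0. The cube covers the case s = -1, where the
  square says nothing.\<close>

lemma B_gen_1_aux:
  assumes d: "\<And>j. B 1 (gen j) = 0"
  shows "B (gen i) 1 = 0"
proof -
  define c s where "c = B (gen i) 1" and "s = t i i"
  have lin: "clinear (B x)" "clinear (\<lambda>u. B u x)" for x
    by (rule B_lin[OF clinear_id])+
  let ?g = "gen i"
  have sc: "B (scale_word (t i) (?g * x)) y = s * B (?g * scale_word (t i) x) y" for x y
    by (simp add: scale_word_mult scale_word_gen s_def clin_scale[OF lin(2)])
  have scc: "B (scale_word (t i) (scale_word (t i) ?g)) y = s * s * B ?g y"
      "B (?g * scale_word (t i) ?g) y = s * B (?g * ?g) y" for y
    by (simp_all add: scale_word_gen s_def clin_scale[OF lin(2)] clin_scale[OF clinear_scale_word[OF clinear_id]])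
  have sg: "B (scale_word (t i) ?g) y = s * B ?g y" for y
    using sc[of 1] by simp
  have g2: "B (?g * ?g) 1 = c * c" "B (?g * ?g) ?g = 2 * c"
    by (simp_all add: B_mult_left pair_r_1 pair_r_gen1 lin B_gen c_def)
  have "B (?g * ?g) (?g * 1) = 2 * c + (1 + s) * c"
    unfolding B_mult_right
    by (simp add: pair_r_gen pair_r_gen1 pair_r_1 lin clinear_intros g2 B_gen d B_1 sg algebra_simps flip: c_def)
  with g2 have 1: "(1 + s) * c = 0" by simp
  have g3: "B (?g * (?g * ?g)) ?g = 3 * c * c"
    by (simp add: B_mult_left pair_r_gen1 pair_r_1 lin B_gen g2 flip: c_def)
  have "B (?g * (?g * ?g)) (?g * 1) = 3 * c * c + 3 * c * c * (1 + s + s * s)"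
    unfolding B_mult_right
    by (simp add: pair_r_gen pair_r_gen1 pair_r_1 lin clinear_intros g2 g3 B_gen d B_1 sg sc scc algebra_simps flip: c_def)
  with g3 have "3 * c * c * (1 + s + s * s) = 0" by simp
  \<comment> \<open>As 1 + s + s^2 = 1 + s (1 + s), the quadratic relation reduces the cubic one to
    3 c^2 = 0.\<close>
  moreover have "3 * c * c * (1 + s + s * s) = 3 * c * c + 3 * c * s * ((1 + s) * c)"
    by (simp add: algebra_simps)
  ultimately have "3 * c * c = 0" using 1 by (simp only: mult_zero_right add_0_right)
  then show ?thesis by (simp add: c_def)
qed

lemma B_gen_1: "B (gen i) 1 = 0"
proof (rule ccontr)
  assume c: "B (gen i) 1 \<noteq> 0"
  have "B 1 (gen j) = 0" for j
  proof -
    \<comment> \<open>Splitting off a factor 1 costs the extra term B(1, gen j) B(gen i, 1), which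
      must therefore vanish.\<close>
    have "B (gen i) (gen j * 1) = B (gen i) (gen j) * B 1 1 + B 1 (gen j) * B (gen i) 1"
      unfolding B_mult_right by (rule pair_r_gen1) (intro B_lin clinear_id)+
    then show ?thesis using c by (simp add: B_1)
  qed
  then show False using c B_gen_1_aux by blast
qed

lemma B_1_gen: "B 1 (gen i) = 0"
  using lusztig_pairing.B_gen_1[OF flip] .

lemma B_gen_mult_1: "B (gen i * x) 1 = 0"
  by (simp add: B_mult_left pair_r_1 B_lin[OF clinear_id] B_gen_1)

lemma B_scale_word_1: "B (scale_word s x) 1 = B x 1"
proof (induction x rule: word_eqI_gen)
  case (4 i x)
  have "scale_word s (gen i * x) = s i *\<^sub>C (gen i * scale_word s x)"
    by (simp add: scale_word_mult scale_word_gen)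
  then show ?case by (simp add: clin_scale[OF B_lin(2)[OF clinear_id]] B_gen_mult_1)
qed (intro clinear_intros | simp)+

lemma pair_r_eqI:
  assumes "clinear \<phi>" "clinear \<psi>" "clinear \<theta>"
    and "\<And>w. tensor_pair \<phi> \<psi> (r (word w)) = \<theta> (word w)"
  shows "tensor_pair \<phi> \<psi> (r x) = \<theta> x"
  by (rule word_linear_eqI[of "\<lambda>x. tensor_pair \<phi> \<psi> (r x)" \<theta>])
    (intro clinear_tensor_pair r_linear assms)+

text \<open>The claim is carried for all functionals at once, because the recursion of
  \<open>r\<close> replaces a functional by its composite with left multiplication by a
  generator.\<close>

lemma pair_r_induct:
  assumes 1: "\<And>\<phi>. clinear \<phi> \<Longrightarrow> p \<phi> 1 = \<phi> (D 1)"
    and gen: "\<And>i w \<phi>. clinear \<phi> \<Longrightarrow> (\<And>\<phi>. clinear \<phi> \<Longrightarrow> p \<phi> (word w) = \<phi> (D (word w))) \<Longrightarrow>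
      p \<phi> (gen i * word w) = \<phi> (D (gen i * word w))"
    and "clinear \<phi>"
  shows "p \<phi> (word w) = \<phi> (D (word w))"
proof -
  have "\<forall>\<phi>. clinear \<phi> \<longrightarrow> p \<phi> (word w) = \<phi> (D (word w))"
    by (induct w rule: word_induct) (use 1 gen in blast)+
  then show ?thesis using assms(3) by blast
qed

text \<open>B(-, 1) is the counit of \<open>r\<close>: it kills every nonempty word, so of the two
  terms of the recursion only the one with 1 \<otimes> gen i survives.\<close>

lemma pair_counit_left:
  assumes "clinear \<psi>"
  shows "tensor_pair (\<lambda>u. B u 1) \<psi> (r x) = \<psi> x"
proof (rule pair_r_eqI[OF B_lin(2)[OF clinear_id] assms assms],
    rule pair_r_induct[where p = "\<lambda>\<psi> x. tensor_pair (\<lambda>u. B u 1) \<psi> (r x)" and D = "\<lambda>x. x"])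
  fix i w and \<psi> :: "'i free_algebra \<Rightarrow> complex"
  assume \<psi>: "clinear \<psi>" and IH: "\<And>\<psi>. clinear \<psi> \<Longrightarrow> tensor_pair (\<lambda>u. B u 1) \<psi> (r (word w)) = \<psi> (word w)"
  show "tensor_pair (\<lambda>u. B u 1) \<psi> (r (gen i * word w)) = \<psi> (gen i * word w)"
    using IH clinear_gen_mult[OF \<psi>] \<psi>
    by (simp add: pair_r_gen B_lin[OF clinear_id] B_gen_mult_1 B_scale_word_1 tensor_pair_0)
qed (simp_all add: assms pair_r_1 B_lin[OF clinear_id] B_1)

lemma pair_counit_right:
  assumes "clinear \<phi>"
  shows "tensor_pair \<phi> (\<lambda>u. B u 1) (r x) = \<phi> x"
proof (rule pair_r_eqI[OF assms B_lin(2)[OF clinear_id] assms],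
    rule pair_r_induct[where p = "\<lambda>\<phi> x. tensor_pair \<phi> (\<lambda>u. B u 1) (r x)" and D = "\<lambda>x. x"])
  fix i w and \<phi> :: "'i free_algebra \<Rightarrow> complex"
  assume \<phi>: "clinear \<phi>" and IH: "\<And>\<phi>. clinear \<phi> \<Longrightarrow> tensor_pair \<phi> (\<lambda>u. B u 1) (r (word w)) = \<phi> (word w)"
  show "tensor_pair \<phi> (\<lambda>u. B u 1) (r (gen i * word w)) = \<phi> (gen i * word w)"
    using IH clinear_gen_mult[OF \<phi>] clinear_of_scale_word[OF \<phi>] \<phi>
    by (simp add: pair_r_gen B_lin[OF clinear_id] B_gen_mult_1 tensor_pair_0_right)
qed (simp_all add: assms pair_r_1 B_lin[OF clinear_id] B_1)

lemma B_gen_mult_gen: "B (gen j * x) (gen i) = (if i = j then B x 1 else 0)"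
  by (simp add: B_mult_left pair_r_gen1 B_lin[OF clinear_id] B_gen B_gen_1)

text \<open>B(-, gen i) sees only degree \<alpha>_i, where rescaling by \<open>t j\<close> is a
  single factor.\<close>

lemma B_scale_word_gen: "B (scale_word (t j) x) (gen i) = t i j * B x (gen i)"
proof (induction x rule: word_eqI_gen)
  case (4 k x)
  have "scale_word (t j) (gen k * x) = t j k *\<^sub>C (gen k * scale_word (t j) x)"
    by (simp add: scale_word_mult scale_word_gen)
  then show ?case
    by (simp add: clin_scale[OF B_lin(2)[OF clinear_id]] B_gen_mult_gen B_scale_word_1 t_sym[of j k])
qed (intro clinear_intros | simp add: B_1_gen)+

text \<open>Contracting the left factor of \<open>r x\<close> with gen i extracts that letter. This
  is the bridge from the coproduct to explicit recursions.\<close>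

lemma pair_gen_left:
  assumes "clinear \<psi>"
  shows "tensor_pair (\<lambda>u. B u (gen i)) \<psi> (r x) = \<psi> (ldiff t i x)"
proof (rule pair_r_eqI[OF B_lin(2)[OF clinear_id] assms clinear_comp[OF assms clinear_ldiff[OF clinear_id]]],
    rule pair_r_induct[where p = "\<lambda>\<psi> x. tensor_pair (\<lambda>u. B u (gen i)) \<psi> (r x)" and D = "ldiff t i"])
  fix j w and \<psi> :: "'i free_algebra \<Rightarrow> complex"
  assume \<psi>: "clinear \<psi>"
    and IH: "\<And>\<psi>. clinear \<psi> \<Longrightarrow> tensor_pair (\<lambda>u. B u (gen i)) \<psi> (r (word w)) = \<psi> (ldiff t i (word w))"
  have "tensor_pair (\<lambda>u. B (gen j * u) (gen i)) \<psi> (r (word w)) = (if i = j then \<psi> (word w) else 0)"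
    using \<psi> by (simp add: B_gen_mult_gen pair_counit_left tensor_pair_0)
  moreover have "tensor_pair (\<lambda>u. B (scale_word (t j) u) (gen i)) (\<lambda>u. \<psi> (gen j * u)) (r (word w)) =
      t i j * \<psi> (gen j * ldiff t i (word w))"
    unfolding B_scale_word_gen tensor_pair_scale_left[OF B_lin(2)[OF clinear_id] clinear_gen_mult[OF \<psi>]]
    using IH clinear_gen_mult[OF \<psi>] by simp
  ultimately show "tensor_pair (\<lambda>u. B u (gen i)) \<psi> (r (gen j * word w)) = \<psi> (ldiff t i (gen j * word w))"
    by (simp add: pair_r_gen[OF B_lin(2)[OF clinear_id] \<psi>] ldiff_gen_mult clin_add[OF \<psi>]
        clin_scale[OF \<psi>] clin_0[OF \<psi>])
next
  fix \<psi> :: "'i free_algebra \<Rightarrow> complex" assume \<psi>: "clinear \<psi>"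
  show "tensor_pair (\<lambda>u. B u (gen i)) \<psi> (r 1) = \<psi> (ldiff t i 1)"
    by (simp add: pair_r_1[OF B_lin(2)[OF clinear_id] \<psi>] B_1_gen clin_0[OF \<psi>])
qed (rule assms)

lemma pair_gen_right:
  assumes "clinear \<phi>"
  shows "tensor_pair \<phi> (\<lambda>u. B u (gen i)) (r x) = \<phi> (rdiff t i x)"
proof (rule pair_r_eqI[OF assms B_lin(2)[OF clinear_id] clinear_comp[OF assms clinear_rdiff[OF clinear_id]]],
    rule pair_r_induct[where p = "\<lambda>\<phi> x. tensor_pair \<phi> (\<lambda>u. B u (gen i)) (r x)" and D = "rdiff t i"])
  fix j w and \<phi> :: "'i free_algebra \<Rightarrow> complex"
  assume \<phi>: "clinear \<phi>"
    and IH: "\<And>\<phi>. clinear \<phi> \<Longrightarrow> tensor_pair \<phi> (\<lambda>u. B u (gen i)) (r (word w)) = \<phi> (rdiff t i (word w))"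
  have "tensor_pair (\<lambda>u. \<phi> (scale_word (t j) u)) (\<lambda>u. B (gen j * u) (gen i)) (r (word w)) =
      (if i = j then \<phi> (scale_word (t j) (word w)) else 0)"
    using clinear_of_scale_word[OF \<phi>] by (simp add: B_gen_mult_gen pair_counit_right tensor_pair_0_right)
  then show "tensor_pair \<phi> (\<lambda>u. B u (gen i)) (r (gen j * word w)) = \<phi> (rdiff t i (gen j * word w))"
    using IH clinear_gen_mult[OF \<phi>]
    by (simp add: pair_r_gen[OF \<phi> B_lin(2)[OF clinear_id]] rdiff_gen_mult clin_add[OF \<phi>] clin_0[OF \<phi>])
next
  fix \<phi> :: "'i free_algebra \<Rightarrow> complex" assume \<phi>: "clinear \<phi>"
  show "tensor_pair \<phi> (\<lambda>u. B u (gen i)) (r 1) = \<phi> (rdiff t i 1)"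
    by (simp add: pair_r_1[OF \<phi> B_lin(2)[OF clinear_id]] B_1_gen clin_0[OF \<phi>])
qed (rule assms)

section \<open>Adjunctions, orthogonality of weights, stability of the radical\<close>

lemma B_gen_mult_right: "B x (gen i * z) = B (ldiff t i x) z"
  unfolding B_mult_right by (rule pair_gen_left) (rule B_lin(2)[OF clinear_id])

lemma B_mult_gen_right: "B x (z * gen i) = B (rdiff t i x) z"
  unfolding B_mult_right by (rule pair_gen_right) (rule B_lin(2)[OF clinear_id])

text \<open>Rescaling is self-adjoint since the derivation adjoint to gen i removes one letter i,
  hence one factor \<open>s i\<close>.\<close>

lemma B_scale_word: "B (scale_word s x) z = B x (scale_word s z)"
proof -
  have *: "\<forall>x. B (scale_word s x) (word w) = B x (scale_word s (word w))" for w
  proof (induct w rule: word_induct)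
    case Nil
    show ?case by (simp add: B_scale_word_1)
  next
    case (Cons i w)
    then show ?case
      by (simp add: B_gen_mult_right ldiff_scale_word scale_word_mult scale_word_gen
          clin_scale[OF B_lin(1)[OF clinear_id]] clin_scale[OF B_lin(2)[OF clinear_id]])
  qed
  show ?thesis
    by (rule word_linear_eqI[of "B (scale_word s x)" "\<lambda>z. B x (scale_word s z)"],
        rule B_lin(1)[OF clinear_id], rule B_lin(1)[OF clinear_scale_word[OF clinear_id]], use * in blast)
qed

lemma B_word_orthogonal:
  assumes "B (word u) (word v) \<noteq> 0"
  shows "mset u = mset v"
proof (rule multiset_eq_iff[THEN iffD2, OF allI])
  fix i
  \<comment> \<open>Rescaling the letter i by 2 turns its number of occurrences into the exponent of
    a power of 2, and powers of 2 are distinct.\<close>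
  define s :: "'i \<Rightarrow> complex" where "s = (\<lambda>j. if j = i then 2 else 1)"
  have p: "prod_list (map s w) = of_nat (2 ^ count (mset w) i)" for w
    by (induct w) (simp_all add: s_def)
  have "prod_list (map s u) * B (word u) (word v) = prod_list (map s v) * B (word u) (word v)"
    using B_scale_word[of s "word u" "word v"]
    by (simp add: scale_word_word clin_scale[OF B_lin(1)[OF clinear_id]]
        clin_scale[OF B_lin(2)[OF clinear_id]] mult.commute)
  then have "(of_nat (2 ^ count (mset u) i) :: complex) = of_nat (2 ^ count (mset v) i)"
    using assms unfolding p by simp
  then show "count (mset u) i = count (mset v) i"
    by (simp only: of_nat_eq_iff) simp
qed

lemma radicalD: "x \<in> radical B \<Longrightarrow> B x y = 0"
  by (simp add: radical_def)

lemma radical_mult: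
  assumes "x \<in> radical B"
  shows "x * y \<in> radical B" "y * x \<in> radical B"
proof -
  have "B x = (\<lambda>_. 0)" using assms by (auto simp: radical_def)
  then show "x * y \<in> radical B" "y * x \<in> radical B"
    by (simp_all add: radical_def B_mult_left tensor_pair_0 tensor_pair_0_right B_lin[OF clinear_id])
qed

lemma radical_ldiff: "x \<in> radical B \<Longrightarrow> ldiff t i x \<in> radical B"
  by (simp add: radical_def flip: B_gen_mult_right)

lemma radical_rdiff: "x \<in> radical B \<Longrightarrow> rdiff t i x \<in> radical B"
  by (simp add: radical_def flip: B_mult_gen_right)

lemma radical_scale_word: "x \<in> radical B \<Longrightarrow> scale_word s x \<in> radical B"
  by (simp add: radical_def B_scale_word)

end

section \<open>Words acting on a vector space\<close>

definition word_act :: "('x \<Rightarrow> 'v \<Rightarrow> 'v::complex_vector) \<Rightarrow> 'x free_algebra \<Rightarrow> 'v \<Rightarrow> 'v" where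
  "word_act \<rho> p v = linext (\<lambda>w. foldr \<rho> w v) p"

lemma clinear_word_act_left [clinear_intros]: "clinear f \<Longrightarrow> clinear (\<lambda>p. word_act \<rho> (f p) v)"
  unfolding word_act_def by (intro clinear_intros)

lemma word_act_word: "word_act \<rho> (word w) v = foldr \<rho> w v"
  by (simp add: word_act_def)

lemma word_act_gen [simp]: "word_act \<rho> (gen i) v = \<rho> i v"
  by (simp add: word_act_word)

lemma word_act_1 [simp]: "word_act \<rho> 1 v = v"
  by (simp add: word_act_word flip: word_Nil)

lemma clinear_word_act_right:
  assumes "\<And>i. clinear (\<rho> i)"
  shows "clinear (word_act \<rho> p)"
proof -
  have l: "clinear (foldr \<rho> w)" for w
  proof (induct w)
    case (Cons i w)
    then show ?case using clinear_comp[OF assms, of "foldr \<rho> w" i] by (simp add: comp_def)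
  qed (simp add: clinear_id id_def)
  show ?thesis
    unfolding word_act_def linext_def
    by (rule clinear_sum, rule clinear_scaleC) (rule l)
qed

lemma word_act_mult:
  assumes "\<And>i. clinear (\<rho> i)"
  shows "word_act \<rho> (p * p') v = word_act \<rho> p (word_act \<rho> p' v)"
proof (rule word_linear_eqI[of "\<lambda>p. word_act \<rho> (p * p') v"], goal_cases)
  case (3 u)
  show ?case
    by (rule word_linear_eqI[of "\<lambda>p'. word_act \<rho> (word u * p') v"])
      (intro clinear_intros clinear_comp[OF clinear_word_act_right[OF assms]]
        | simp add: word_act_word flip: word_append)+
qed (intro clinear_intros)+

lemma word_act_eval_gen:
  "word_act \<rho> (eval (\<lambda>i. gen (g i)) x) v = word_act (\<lambda>i. \<rho> (g i)) x v"
proof (rule word_linear_eqI[of "\<lambda>x. word_act \<rho> (eval (\<lambda>i. gen (g i)) x) v"], goal_cases)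
  case 1
  show ?case unfolding eval_def by (intro clinear_intros)
next
  case (3 w)
  have "prod_list (map (\<lambda>i. gen (g i)) w) = word (map g w)"
    by (induct w) (simp_all add: word_Nil flip: word_append)
  then show ?case by (simp add: eval_def word_act_word foldr_map comp_def)
qed (intro clinear_intros)

section \<open>The triangular module\<close>

text \<open>The basis vector \<open>(m, u, v)\<close> stands for \<open>K\<^sub>m F\<^sub>u E\<^sub>v\<close>, and the operators below are left
  multiplications straightened by the relations.  The commutator of \<open>E\<^sub>i\<close> and \<open>F\<^sub>u\<close> is built into
  the recursion that defines \<open>E_straight\<close>.\<close>

type_synonym ('k, 'i) triangular = "('k \<times> 'i list \<times> 'i list) \<Rightarrow>\<^sub>0 complex"

definition tri :: "'k \<Rightarrow> 'i free_algebra \<Rightarrow> 'i free_algebra \<Rightarrow> ('k, 'i) triangular" where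
  "tri m x y = linext (\<lambda>u. linext (\<lambda>v. Poly_Mapping.single (m, u, v) 1) y) x"

lemma clinear_tri [clinear_intros]:
  "clinear f \<Longrightarrow> clinear (\<lambda>s. tri m (f s) y)" "clinear f \<Longrightarrow> clinear (\<lambda>s. tri m x (f s))"
proof -
  assume "clinear f"
  then show "clinear (\<lambda>s. tri m (f s) y)" unfolding tri_def by (intro clinear_intros)
  show "clinear (\<lambda>s. tri m x (f s))"
    unfolding tri_def linext_def[of _ x]
    by (rule clinear_sum, rule clinear_scaleC) (intro clinear_intros \<open>clinear f\<close>)
qed

lemma tri_word: "tri m (word u) (word v) = Poly_Mapping.single (m, u, v) 1"
  by (simp add: tri_def)

lemmas tri_lin = clin_add[OF clinear_tri(1)[OF clinear_id]] clin_add[OF clinear_tri(2)[OF clinear_id]]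
  clin_diff[OF clinear_tri(1)[OF clinear_id]] clin_diff[OF clinear_tri(2)[OF clinear_id]]
  clin_scale[OF clinear_tri(1)[OF clinear_id]] clin_scale[OF clinear_tri(2)[OF clinear_id]]
  clin_0[OF clinear_tri(1)[OF clinear_id]] clin_0[OF clinear_tri(2)[OF clinear_id]]

lemma triangular_linear_eqI:
  assumes "clinear f" "clinear g" "\<And>m u v. f (tri m (word u) (word v)) = g (tri m (word u) (word v))"
  shows "f s = g s"
  by (rule poly_mapping_linear_eqI[OF assms(1,2)]) (metis assms(3) tri_word prod_cases3)

lemma tri_linear_eqI:
  assumes "clinear f" "\<And>x. clinear (\<lambda>y. g x y)" "\<And>y. clinear (\<lambda>x. g x y)"
    and "\<And>u v. f (tri m (word u) (word v)) = g (word u) (word v)"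
  shows "f (tri m x y) = g x y"
proof (rule word_linear_eqI[of "\<lambda>x. f (tri m x y)"])
  show "clinear (\<lambda>x. f (tri m x y))" by (intro clinear_comp[OF assms(1)] clinear_intros)
  show "f (tri m (word u) y) = g (word u) y" for u
    by (rule word_linear_eqI[of "\<lambda>y. f (tri m (word u) y)"])
      (intro clinear_comp[OF assms(1)] clinear_intros assms)+
qed (rule assms)

text \<open>\<open>\<chi> m i\<close> plays q^(m, \<alpha>_i), \<open>a i\<close> the weight
  \<alpha>_i, \<open>c i\<close> the constant in the commutator of E_i and F_i, \<open>Z\<close> the
  lattice \<Lambda>' and \<open>I\<close> the radical. The index group consists of weights, not of
  classes modulo \<Lambda>': the K operators are then honest shifts, and periodicity is imposed
  later, together with \<open>I\<close>.\<close>

locale triangular_module =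
  fixes t :: "'i \<Rightarrow> 'i \<Rightarrow> complex" and \<chi> :: "'k::ab_group_add \<Rightarrow> 'i \<Rightarrow> complex" and a :: "'i \<Rightarrow> 'k"
    and c :: "'i \<Rightarrow> complex" and Z :: "'k set" and I :: "'i free_algebra set"
  assumes \<chi>_add: "\<chi> (m + n) i = \<chi> m i * \<chi> n i" and \<chi>_nz: "\<chi> m i \<noteq> 0" and \<chi>_a: "\<chi> (a i) j = t i j"
    and t_sym: "t i j = t j i" and \<chi>_Z: "z \<in> Z \<Longrightarrow> \<chi> z i = 1"
    and I_mult: "x \<in> I \<Longrightarrow> x * y \<in> I" "x \<in> I \<Longrightarrow> y * x \<in> I"
    and I_ldiff: "x \<in> I \<Longrightarrow> ldiff t i x \<in> I" and I_rdiff: "x \<in> I \<Longrightarrow> rdiff t i x \<in> I"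
    and I_scale: "x \<in> I \<Longrightarrow> scale_word s x \<in> I"
begin

lemma \<chi>_0 [simp]: "\<chi> 0 i = 1"
  using \<chi>_add[of 0 0 i] \<chi>_nz[of 0 i] by simp

lemma \<chi>_minus: "\<chi> (- m) i = inverse (\<chi> m i)"
  using \<chi>_add[of m "- m" i] by (metis \<chi>_0 add.right_inverse inverse_unique)

lemma t_nz: "t i j \<noteq> 0"
  using \<chi>_nz[of "a i" j] by (simp add: \<chi>_a)

definition K_op :: "'k \<Rightarrow> ('k, 'i) triangular \<Rightarrow> ('k, 'i) triangular" where
  "K_op n = linext (\<lambda>(m, u, v). tri (n + m) (word u) (word v))"

definition F_op :: "'i \<Rightarrow> ('k, 'i) triangular \<Rightarrow> ('k, 'i) triangular" where
  "F_op i = linext (\<lambda>(m, u, v). \<chi> m i *\<^sub>C tri m (gen i * word u) (word v))"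

primrec E_straight :: "'i \<Rightarrow> 'i list \<Rightarrow> 'i list \<Rightarrow> ('k, 'i) triangular" where
  "E_straight i [] v = tri 0 1 (gen i * word v)"
| "E_straight i (j # u) v = F_op j (E_straight i u v) +
    (if i = j then c i *\<^sub>C (tri (a i) (word u) (word v) - tri (- a i) (word u) (word v)) else 0)"

definition E_op :: "'i \<Rightarrow> ('k, 'i) triangular \<Rightarrow> ('k, 'i) triangular" where
  "E_op i = linext (\<lambda>(m, u, v). inverse (\<chi> m i) *\<^sub>C K_op m (E_straight i u v))"

lemma clinear_ops [clinear_intros]:
  "clinear f \<Longrightarrow> clinear (\<lambda>s. K_op n (f s))" "clinear f \<Longrightarrow> clinear (\<lambda>s. F_op i (f s))"
  "clinear f \<Longrightarrow> clinear (\<lambda>s. E_op i (f s))"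
  unfolding K_op_def F_op_def E_op_def by (intro clinear_intros; assumption)+

lemmas K_lin = clinear_ops(1)[OF clinear_id] and F_lin = clinear_ops(2)[OF clinear_id]
  and E_lin = clinear_ops(3)[OF clinear_id]

lemmas ops_lin = clin_add[OF K_lin] clin_diff[OF K_lin] clin_scale[OF K_lin] clin_0[OF K_lin]
  clin_add[OF F_lin] clin_diff[OF F_lin] clin_scale[OF F_lin] clin_0[OF F_lin]
  clin_add[OF E_lin] clin_diff[OF E_lin] clin_scale[OF E_lin] clin_0[OF E_lin]

lemma K_tri: "K_op n (tri m x y) = tri (n + m) x y"
  by (rule tri_linear_eqI[of "K_op n"], rule K_lin, intro clinear_intros, intro clinear_intros)
    (simp add: K_op_def tri_word)

lemma F_tri: "F_op i (tri m x y) = \<chi> m i *\<^sub>C tri m (gen i * x) y"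
  by (rule tri_linear_eqI[of "F_op i"], rule F_lin, intro clinear_intros, intro clinear_intros)
    (simp add: F_op_def tri_word[of m])

lemma E_tri_word: "E_op i (tri m (word u) (word v)) = inverse (\<chi> m i) *\<^sub>C K_op m (E_straight i u v)"
  by (simp add: E_op_def tri_word)

text \<open>Although built from the right derivation, this obeys the recursion of
  \<open>ldiff\<close> with \<open>t\<close> replaced by its inverse. Written through
  \<open>rdiff\<close> and a rescaling, it visibly preserves \<open>I\<close>.\<close>

definition bdiff :: "'i \<Rightarrow> 'i free_algebra \<Rightarrow> 'i free_algebra" where
  "bdiff i x = scale_word (\<lambda>j. inverse (t i j)) (rdiff t i x)"

lemma clinear_bdiff [clinear_intros]: "clinear f \<Longrightarrow> clinear (\<lambda>x. bdiff i (f x))"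
  unfolding bdiff_def by (intro clinear_intros)

lemma bdiff_gen_mult:
  "bdiff i (gen j * x) = (if i = j then x else 0) + inverse (t i j) *\<^sub>C (gen j * bdiff i x)"
  by (simp add: bdiff_def rdiff_gen_mult clin_add[OF clinear_scale_word[OF clinear_id]]
      clin_0[OF clinear_scale_word[OF clinear_id]] scale_word_mult scale_word_gen scale_word_scale_word t_nz)

lemma bdiff_1 [simp]: "bdiff i 1 = 0"
  by (simp add: bdiff_def clin_0[OF clinear_scale_word[OF clinear_id]])

lemma I_bdiff: "x \<in> I \<Longrightarrow> bdiff i x \<in> I"
  by (simp add: bdiff_def I_scale I_rdiff)

text \<open>The commutator leaves K(\<alpha>_i) and K(-\<alpha>_i) inside the F word. Moving them to
  the front collects the factors of the letters passed, which makes the two terms the derivations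
  for \<open>t\<close> and for its inverse.\<close>

lemma E_straight_eq:
  "E_straight i u v = tri 0 (word u) (gen i * word v) +
     c i *\<^sub>C (tri (a i) (ldiff t i (word u)) (word v) - tri (- a i) (bdiff i (word u)) (word v))"
proof (induct u)
  case (Cons j u)
  have *: "word (j # u) = gen j * word u" by (rule word_Cons)
  show ?case
    unfolding * E_straight.simps Cons ldiff_gen_mult bdiff_gen_mult
    by (simp add: ops_lin F_tri tri_lin \<chi>_a \<chi>_minus scaleC_add_right cvec.scale_right_diff_distrib
        mult.commute)
qed (simp add: word_Nil tri_lin)

lemma E_tri: "E_op i (tri m x y) = inverse (\<chi> m i) *\<^sub>C (tri m x (gen i * y) +
    c i *\<^sub>C (tri (a i + m) (ldiff t i x) y - tri (m - a i) (bdiff i x) y))"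
  by (rule tri_linear_eqI[of "E_op i"], rule E_lin, intro clinear_intros, intro clinear_intros)
    (simp add: E_tri_word E_straight_eq ops_lin K_tri algebra_simps)

section \<open>Relations that hold exactly for the operators\<close>

lemma K_K: "K_op n (K_op n' s) = K_op (n + n') s"
  by (rule triangular_linear_eqI[of "\<lambda>s. K_op n (K_op n' s)"]) (intro clinear_intros | simp add: K_tri add.assoc)+

lemma K_0: "K_op 0 s = s"
  by (rule triangular_linear_eqI[of "K_op 0"]) (rule K_lin clinear_id | simp add: K_tri)+

lemma K_E: "K_op n (E_op i s) = \<chi> n i *\<^sub>C E_op i (K_op n s)"
  by (rule triangular_linear_eqI[of "\<lambda>s. K_op n (E_op i s)"])
    (intro clinear_intros | simp add: K_tri E_tri_word ops_lin K_K \<chi>_add \<chi>_nz)+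

lemma K_F: "K_op n (F_op i s) = inverse (\<chi> n i) *\<^sub>C F_op i (K_op n s)"
  by (rule triangular_linear_eqI[of "\<lambda>s. K_op n (F_op i s)"])
    (intro clinear_intros | simp add: K_tri F_tri ops_lin \<chi>_add \<chi>_nz)+

text \<open>No null space is involved: the recursion of \<open>E_straight\<close> is this relation
  on words.\<close>

lemma E_F: "E_op i (F_op j s) = F_op j (E_op i s) +
    (if i = j then c i *\<^sub>C (K_op (a i) s - K_op (- a i) s) else 0)"
proof (rule triangular_linear_eqI[of "\<lambda>s. E_op i (F_op j s)"], goal_cases)
  case (3 m u v)
  have *: "gen j * word u = word (j # u)" by (rule word_Cons[symmetric])
  have FK: "F_op j (K_op m s) = \<chi> m j *\<^sub>C K_op m (F_op j s)" for s
    by (simp add: K_F \<chi>_nz)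
  show ?case
    by (simp add: F_tri ops_lin * E_tri_word FK K_tri scaleC_add_right add.commute \<chi>_nz)
qed (intro clinear_intros)+

text \<open>Everything that must become zero: radical elements in either word slot, and the
  difference of weights congruent modulo \<Lambda>'. The quotient module is never formed; statements
  are made modulo this span.\<close>

definition tri_rels :: "('k, 'i) triangular set" where
  "tri_rels = {tri m x y | m x y. x \<in> I \<or> y \<in> I} \<union> {tri (m + z) x y - tri m x y | m z x y. z \<in> Z}"

abbreviation tri_null :: "('k, 'i) triangular set" where
  "tri_null \<equiv> cvec.span tri_rels"

lemma null_tri: "x \<in> I \<or> y \<in> I \<Longrightarrow> tri m x y \<in> tri_null"
  by (rule cvec.span_base) (auto simp: tri_rels_def)

lemma null_diff: "z \<in> Z \<Longrightarrow> tri (m + z) x y - tri m x y \<in> tri_null"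
  unfolding tri_rels_def by (rule cvec.span_base, rule UnI2) blast

lemma null_stable:
  assumes "clinear f" "\<And>s. s \<in> tri_rels \<Longrightarrow> f s \<in> tri_null" "s \<in> tri_null"
  shows "f s \<in> tri_null"
  using assms(3)
  by (induct s rule: cvec.span_induct_alt)
    (simp_all add: clin_0[OF assms(1)] clin_add[OF assms(1)] clin_scale[OF assms(1)] cvec.span_zero
      cvec.span_add cvec.span_scale assms(2))

lemma tri_rels_cases:
  assumes "s \<in> tri_rels"
  obtains m x y where "s = tri m x y" "x \<in> I \<or> y \<in> I"
  | m z x y where "s = tri (m + z) x y - tri m x y" "z \<in> Z"
  using assms by (auto simp: tri_rels_def)

lemma null_K: "s \<in> tri_null \<Longrightarrow> K_op n s \<in> tri_null"
  by (rule null_stable[OF K_lin], erule tri_rels_cases)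
    (auto simp: K_tri ops_lin null_tri null_diff simp flip: add.assoc)

lemma null_F: "s \<in> tri_null \<Longrightarrow> F_op i s \<in> tri_null"
  by (rule null_stable[OF F_lin], erule tri_rels_cases)
    (auto simp: F_tri ops_lin \<chi>_add \<chi>_Z I_mult null_tri null_diff cvec.span_scale
      simp flip: cvec.scale_right_diff_distrib)

text \<open>The critical operator: E_i differentiates the F slot, so the null space is a submodule
  because \<open>I\<close> is stable under \<open>ldiff\<close> and \<open>bdiff\<close>.\<close>

lemma null_E: "s \<in> tri_null \<Longrightarrow> E_op i s \<in> tri_null"
proof (rule null_stable[OF E_lin], erule tri_rels_cases)
  fix s :: "('k, 'i) triangular" and m x y assume "s = tri m x y" "x \<in> I \<or> y \<in> I"
  then show "E_op i s \<in> tri_null"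
    by (auto simp: E_tri intro!: cvec.span_scale cvec.span_add cvec.span_diff null_tri I_mult I_ldiff I_bdiff)
next
  fix s :: "('k, 'i) triangular" and m z x y assume s: "s = tri (m + z) x y - tri m x y" and z: "z \<in> Z"
  have "E_op i s = inverse (\<chi> m i) *\<^sub>C (tri (m + z) x (gen i * y) - tri m x (gen i * y) +
    c i *\<^sub>C ((tri (a i + m + z) (ldiff t i x) y - tri (a i + m) (ldiff t i x) y) -
      (tri (m - a i + z) (bdiff i x) y - tri (m - a i) (bdiff i x) y)))"
    using z by (simp add: s ops_lin E_tri \<chi>_add \<chi>_Z algebra_simps cvec.scale_right_diff_distrib scaleC_add_right)
  then show "E_op i s \<in> tri_null"
    using z by (auto intro!: cvec.span_scale cvec.span_add cvec.span_diff null_diff)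
qed

lemma E_act_K: "word_act E_op x (K_op n s) = K_op n (word_act E_op (scale_word (\<chi> (- n)) x) s)"
proof (induction x rule: word_eqI_gen)
  case (4 i x)
  have "E_op i (K_op n s) = \<chi> (- n) i *\<^sub>C K_op n (E_op i s)" for s
    by (simp add: K_E \<chi>_minus \<chi>_nz)
  then show ?case
    by (simp add: word_act_mult[OF E_lin] 4 scale_word_mult scale_word_gen ops_lin
        clin_scale[OF clinear_word_act_left[OF clinear_id]])
qed (intro clinear_intros | simp)+

text \<open>A polynomial in the E's commutes with F_j up to its own skew derivatives, so commutators
  of an element of \<open>I\<close> come from \<open>I\<close> again.\<close>

lemma E_act_F: "word_act E_op x (F_op j s) = F_op j (word_act E_op x s) +
    c j *\<^sub>C (word_act E_op (rdiff t j x) (K_op (a j) s) - K_op (- a j) (word_act E_op (ldiff t j x) s))"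
proof (induction x rule: word_eqI_gen)
  case (4 i x)
  note [simp] = clin_add[OF clinear_word_act_left[OF clinear_id]] clin_0[OF clinear_word_act_left[OF clinear_id]]
    clin_scale[OF clinear_word_act_left[OF clinear_id]]
  have EK: "E_op i (K_op (- a j) s) = t j i *\<^sub>C K_op (- a j) (E_op i s)" for s
    by (simp add: K_E \<chi>_minus \<chi>_nz \<chi>_a t_nz)
  have sc: "\<chi> (a j) = t j" by (rule ext) (rule \<chi>_a)
  have KE: "word_act E_op (scale_word (t j) x) (K_op (a j) s) = K_op (a j) (word_act E_op x s)"
    by (simp add: E_act_K scale_word_scale_word \<chi>_minus t_nz \<chi>_a)
  show ?case
    by (simp add: word_act_mult[OF E_lin] 4 ops_lin E_F rdiff_gen_mult ldiff_gen_mult EK KE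
        scaleC_add_right cvec.scale_right_diff_distrib)
qed (intro clinear_intros | simp add: clin_0[OF clinear_word_act_left[OF clinear_id]] ops_lin)+

lemma E_act_tri: "word_act E_op y (tri 0 1 z) = tri 0 1 (y * z)"
  by (induction y rule: word_eqI_gen)
    (intro clinear_intros | simp add: word_act_mult[OF E_lin] E_tri tri_lin mult.assoc)+

text \<open>A radical element is moved to the right through the F word. The derivatives that split
  off remain in the radical, and at the end of the word the element enters the E slot, where the
  ideal property absorbs it. Both x and m change at each letter, hence the generalization.\<close>

lemma null_E_act_tri:
  assumes "x \<in> I"
  shows "word_act E_op x (tri m (word u) (word v)) \<in> tri_null"
  using assms
proof (induct u arbitrary: x m)
  case Nil
  have "word_act E_op x (K_op m (tri 0 1 (word v))) \<in> tri_null"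
    unfolding E_act_K E_act_tri using Nil by (intro null_K null_tri disjI2 I_mult I_scale)
  then show ?case by (simp add: K_tri word_Nil)
next
  case (Cons j u)
  have "word_act E_op x (F_op j (tri m (word u) (word v))) \<in> tri_null"
    unfolding E_act_F K_tri using Cons
    by (intro cvec.span_add null_F cvec.span_scale cvec.span_diff null_K) (auto intro: I_rdiff I_ldiff)
  moreover have "tri m (word (j # u)) (word v) = inverse (\<chi> m j) *\<^sub>C F_op j (tri m (word u) (word v))"
    by (simp add: F_tri \<chi>_nz word_Cons[of j u])
  ultimately show ?case
    by (simp only: clin_scale[OF clinear_word_act_right[OF E_lin]] cvec.span_scale)
qed

lemma triangular_induct [case_names tri add scale]:
  assumes "\<And>m u v. P (tri m (word u) (word v))" "\<And>s s'. P s \<Longrightarrow> P s' \<Longrightarrow> P (s + s')"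
    and "\<And>k s. P s \<Longrightarrow> P (k *\<^sub>C s)"
  shows "P s"
proof (induct s rule: poly_mapping_add_induct)
  case (single k v)
  obtain m u w where "k = (m, u, w)" by (cases k)
  then have "Poly_Mapping.single k v = v *\<^sub>C tri m (word u) (word w)" by (simp add: tri_word)
  then show ?case using assms by simp
qed (rule assms)

lemma null_E_act: "x \<in> I \<Longrightarrow> word_act E_op x s \<in> tri_null"
  by (induct s rule: triangular_induct)
    (simp_all add: null_E_act_tri clin_add[OF clinear_word_act_right[OF E_lin]]
      clin_scale[OF clinear_word_act_right[OF E_lin]] cvec.span_add cvec.span_scale)

lemma F_act_tri: "word_act F_op x (tri m y z) = tri m (scale_word (\<chi> m) x * y) z"
  by (induction x rule: word_eqI_gen)
    (intro clinear_intros | simp add: word_act_mult[OF F_lin] F_tri scale_word_mult scale_word_gen tri_lin mult.assoc)+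

lemma null_F_act: "x \<in> I \<Longrightarrow> word_act F_op x s \<in> tri_null"
  by (induct s rule: triangular_induct)
    (auto simp: F_act_tri clin_add[OF clinear_word_act_right[OF F_lin]]
      clin_scale[OF clinear_word_act_right[OF F_lin]] intro!: cvec.span_add cvec.span_scale null_tri disjI1[OF I_mult(1)[OF I_scale]])

lemma null_K_diff:
  assumes "z \<in> Z"
  shows "K_op (n + z) s - K_op n s \<in> tri_null"
proof (induct s rule: triangular_induct)
  case (tri m u v)
  show ?case using null_diff[OF assms, of "n + m"] by (simp add: K_tri algebra_simps)
next
  case (add s s')
  show ?case using cvec.span_add[OF add] by (simp add: ops_lin algebra_simps)
next
  case (scale k s)
  show ?case using cvec.span_scale[OF scale] by (simp add: ops_lin cvec.scale_right_diff_distrib)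
qed

text \<open>The module is built for the sake of these product functionals, which visibly kill both
  kinds of generators of the null space.\<close>

lemma null_functional:
  assumes g: "\<And>m z. z \<in> Z \<Longrightarrow> g (m + z) = g m"
    and \<phi>: "clinear \<phi>" "\<And>x. x \<in> I \<Longrightarrow> \<phi> x = 0" and \<psi>: "clinear \<psi>" "\<And>x. x \<in> I \<Longrightarrow> \<psi> x = 0"
  obtains G :: "('k, 'i) triangular \<Rightarrow> complex" where "clinear G"
    "\<And>m x y. G (tri m x y) = g m * \<phi> x * \<psi> y" "\<And>s. s \<in> tri_null \<Longrightarrow> G s = 0"
proof -
  define G where "G = linext (\<lambda>(m, u, v). g m * \<phi> (word u) * \<psi> (word v))"
  have lin: "clinear G" unfolding G_def by (rule clinear_linext)
  have tri: "G (tri m x y) = g m * \<phi> x * \<psi> y" for m x y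
    by (rule tri_linear_eqI[of G, OF lin]; (intro clinear_cmult \<phi> \<psi>)?) (simp add: G_def tri_word)
  have "G s = 0" if "s \<in> tri_null" for s
    using that by (induct s rule: cvec.span_induct_alt)
      (auto simp: clin_0[OF lin] clin_add[OF lin] clin_scale[OF lin] clin_diff[OF lin] tri g \<phi>(2) \<psi>(2)
        elim!: tri_rels_cases)
  with lin tri show thesis by (rule that)
qed

end

section \<open>The form of the quantum group\<close>

lemma clinear_linext_param: "(\<And>k. clinear (\<lambda>x. g x k)) \<Longrightarrow> clinear (\<lambda>x. linext (g x) p)"
  unfolding linext_def by (intro clinear_sum clinear_scaleC)

lemma clinear_tensor_lift_param: "(\<And>a b. clinear (\<lambda>x. C x a b)) \<Longrightarrow> clinear (\<lambda>x. tensor_lift (C x) s)"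
  unfolding tensor_lift_def by (rule clinear_linext_param) (auto split: prod.split)

text \<open>A lift has a meaning only for bilinear maps, so both nested lifts are checked for
  bilinearity before the formula on pure tensors may be used.\<close>

lemma twisted_mult_tensor:
  "twisted_mult q ip \<alpha> (x\<^sub>1 \<otimes>\<^sub>C x\<^sub>2) (y\<^sub>1 \<otimes>\<^sub>C y\<^sub>2) =
    linext (\<lambda>u. linext (\<lambda>v. q powi int_ip ip (weight \<alpha> u) (weight \<alpha> v) *\<^sub>C
      ((x\<^sub>1 * word v) \<otimes>\<^sub>C (word u * y\<^sub>2))) y\<^sub>1) x\<^sub>2"
  and clinear_twisted_mult: "clinear (\<lambda>s. twisted_mult q ip \<alpha> s s')" "clinear (twisted_mult q ip \<alpha> s)"
proof -
  define P where "P x\<^sub>1 x\<^sub>2 y\<^sub>1 y\<^sub>2 = linext (\<lambda>u. linext (\<lambda>v. q powi int_ip ip (weight \<alpha> u) (weight \<alpha> v) *\<^sub>C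
      ((x\<^sub>1 * word v) \<otimes>\<^sub>C (word u * y\<^sub>2))) y\<^sub>1) x\<^sub>2" for x\<^sub>1 x\<^sub>2 y\<^sub>1 y\<^sub>2
  have 1: "cbilinear (P x\<^sub>1 x\<^sub>2)" for x\<^sub>1 x\<^sub>2
    unfolding P_def by (intro cbilinearI' clinear_linext_param clinear_intros)
  have 2: "cbilinear (\<lambda>x\<^sub>1 x\<^sub>2. tensor_lift (P x\<^sub>1 x\<^sub>2) s)" for s
    unfolding P_def by (intro cbilinearI' clinear_tensor_lift_param) (intro clinear_linext_param clinear_intros)+
  have tm: "twisted_mult q ip \<alpha> s s' = tensor_lift (\<lambda>x\<^sub>1 x\<^sub>2. tensor_lift (P x\<^sub>1 x\<^sub>2) s') s" for s s'
    by (simp add: twisted_mult_def P_def[abs_def])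
  show "twisted_mult q ip \<alpha> (x\<^sub>1 \<otimes>\<^sub>C x\<^sub>2) (y\<^sub>1 \<otimes>\<^sub>C y\<^sub>2) =
    linext (\<lambda>u. linext (\<lambda>v. q powi int_ip ip (weight \<alpha> u) (weight \<alpha> v) *\<^sub>C
      ((x\<^sub>1 * word v) \<otimes>\<^sub>C (word u * y\<^sub>2))) y\<^sub>1) x\<^sub>2"
    unfolding tm by (subst tensor_lift_tensor[OF 2], subst tensor_lift_tensor[OF 1], simp add: P_def)
  show "clinear (\<lambda>s. twisted_mult q ip \<alpha> s s')"
    unfolding tm by (intro clinear_tensor_lift_comp 2 clinear_id)
  \<comment> \<open>The varying tensor sits inside the outer lift; linearity is read off from the
    fixed representative of s.\<close>
  show "clinear (twisted_mult q ip \<alpha> s)"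
  proof (rule clinearI)
    show "twisted_mult q ip \<alpha> s (x + y) = twisted_mult q ip \<alpha> s x + twisted_mult q ip \<alpha> s y" for x y
      unfolding tm clin_add[OF clinear_tensor_lift[OF 1]]
      by (simp add: tensor_lift_def linext_def scaleC_add_right sum.distrib split_def)
    show "twisted_mult q ip \<alpha> s (c *\<^sub>C x) = c *\<^sub>C twisted_mult q ip \<alpha> s x" for c x
      unfolding tm clin_scale[OF clinear_tensor_lift[OF 1]]
      by (simp add: tensor_lift_def linext_def split_def cvec.scale_sum_right ac_simps)
  qed
qed

lemma lusztig_pairing_of_form:
  fixes B :: "'i free_algebra \<Rightarrow> 'i free_algebra \<Rightarrow> complex"
  assumes form: "lusztig_form q ip \<alpha> B" and t_sym: "\<And>i j. t i j = t j i"
    and w0: "\<And>v. int_ip ip (weight \<alpha> []) (weight \<alpha> v) = 0"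
    and w1: "\<And>i v. q powi int_ip ip (weight \<alpha> [i]) (weight \<alpha> v) = prod_list (map (t i) v)"
  shows "lusztig_pairing t (lusztig_r q ip \<alpha>) B"
proof -
  have bil: "cbilinear B" using form by (simp add: lusztig_form_def)
  then have lin: "clinear (B x)" "clinear (\<lambda>u. B u x)" for x by (simp_all add: cbilinear_def)
  have r_lin: "clinear (lusztig_r q ip \<alpha>)"
    unfolding lusztig_r_def by (rule clinear_linext)
  \<comment> \<open>The left factor has only 1 and gen i in its second slot, so the twist is trivial
    (\<open>w0\<close>) or a rescaling by \<open>t i\<close> (\<open>w1\<close>).\<close>
  have tw: "twisted_mult q ip \<alpha> (gen i \<otimes>\<^sub>C 1 + 1 \<otimes>\<^sub>C gen i) s = twist_gen t i s" for i s
  proof (rule tensor_linear_eqI[of "twisted_mult q ip \<alpha> _"], rule clinear_twisted_mult(2), rule clinear_twist_gen[OF clinear_id])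
    fix x y :: "'i free_algebra"
    have "twisted_mult q ip \<alpha> (gen i \<otimes>\<^sub>C word []) (x \<otimes>\<^sub>C y) = linext (\<lambda>v. (gen i * word v) \<otimes>\<^sub>C y) x"
      unfolding twisted_mult_tensor linext_word by (simp add: w0 word_Nil)
    also have "\<dots> = (gen i * x) \<otimes>\<^sub>C y"
      by (rule linext_clinear) (intro clinear_intros)
    finally have 1: "twisted_mult q ip \<alpha> (gen i \<otimes>\<^sub>C 1) (x \<otimes>\<^sub>C y) = (gen i * x) \<otimes>\<^sub>C y"
      by (simp only: word_Nil)
    have "twisted_mult q ip \<alpha> (1 \<otimes>\<^sub>C gen i) (x \<otimes>\<^sub>C y) =
        linext (\<lambda>v. scale_word (t i) (word v) \<otimes>\<^sub>C (gen i * y)) x"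
      by (simp add: twisted_mult_tensor w1 scale_word_word cbilinearD[OF cbilinear_tensor])
    also have "\<dots> = scale_word (t i) x \<otimes>\<^sub>C (gen i * y)"
      by (rule linext_clinear) (intro clinear_intros)
    finally have "twisted_mult q ip \<alpha> (1 \<otimes>\<^sub>C gen i) (x \<otimes>\<^sub>C y) = scale_word (t i) x \<otimes>\<^sub>C (gen i * y)" .
    with 1 show "twisted_mult q ip \<alpha> (gen i \<otimes>\<^sub>C 1 + 1 \<otimes>\<^sub>C gen i) (x \<otimes>\<^sub>C y) = twist_gen t i (x \<otimes>\<^sub>C y)"
      by (simp add: clin_add[OF clinear_twisted_mult(1)] twist_gen_def tensor_lift_tensor[OF twist_gen_bilinear])
  qed
  show ?thesis
  proof (rule lusztig_pairing.intro)
    show "lusztig_r q ip \<alpha> (gen i * x) = twist_gen t i (lusztig_r q ip \<alpha> x)" for i x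
      by (rule word_linear_eqI[of "\<lambda>x. lusztig_r q ip \<alpha> (gen i * x)"],
          rule clinear_comp[OF r_lin], intro clinear_intros, intro clinear_intros r_lin)
        (simp add: lusztig_r_def tw flip: word_Cons)
    show "lusztig_r q ip \<alpha> 1 = 1 \<otimes>\<^sub>C 1"
      by (simp add: lusztig_r_def one_tensor_def flip: word_Nil)
    show "B (x * y) z = tensor_pair (B x) (B y) (lusztig_r q ip \<alpha> z)" for x y z
    proof -
      have "cbilinear (\<lambda>a b. tensor_lift (\<lambda>c d. B a c * B b d) s)" for s
        by (intro cbilinearI' clinear_tensor_lift_param clinear_cmult lin)
      then show ?thesis
        using form by (simp add: lusztig_form_def tensor_form_def tensor_lift_tensor tensor_pair_def)
    qed
    show "B x (y * z) = tensor_pair (\<lambda>u. B u y) (\<lambda>u. B u z) (lusztig_r q ip \<alpha> x)" for x y z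
    proof -
      have "cbilinear (\<lambda>c d. B a c * B b d)" for a b
        by (intro cbilinearI' clinear_cmult lin)
      then show ?thesis
        using form by (simp add: lusztig_form_def tensor_form_def tensor_lift_tensor tensor_pair_def)
    qed
  qed (use form t_sym r_lin in \<open>simp_all add: lusztig_form_def\<close>)
qed

section \<open>Lattices\<close>

lemma group_lattice_group:
  assumes "0 \<in> L" "\<And>x y. x \<in> L \<Longrightarrow> y \<in> L \<Longrightarrow> x + y \<in> L" "\<And>x. x \<in> L \<Longrightarrow> - x \<in> L"
  shows "comm_group (lattice_group L)"
  by (rule comm_groupI) (use assms in \<open>auto simp: lattice_group_def ac_simps intro: exI[of _ "- x" for x]
      bexI[of _ "- x" for x]\<close>)

lemma subgroup_lattice_group_closed:
  assumes M: "0 \<in> M" "\<And>x y. x \<in> M \<Longrightarrow> y \<in> M \<Longrightarrow> x + y \<in> M" "\<And>x. x \<in> M \<Longrightarrow> - x \<in> M"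
    and L: "subgroup L (lattice_group M)"
  shows "0 \<in> L" "\<And>x y. x \<in> L \<Longrightarrow> y \<in> L \<Longrightarrow> x + y \<in> L" "\<And>x. x \<in> L \<Longrightarrow> - x \<in> L" "L \<subseteq> M"
proof -
  interpret comm_group "lattice_group M" by (rule group_lattice_group) (use M in auto)
  show sub: "L \<subseteq> M" using subgroup.subset[OF L] by (simp add: lattice_group_def)
  show "0 \<in> L" using subgroup.one_closed[OF L] by (simp add: lattice_group_def)
  show "x + y \<in> L" if "x \<in> L" "y \<in> L" for x y
    using subgroup.m_closed[OF L that] by (simp add: lattice_group_def)
  show "- x \<in> L" if "x \<in> L" for x
  proof -
    have "inv\<^bsub>lattice_group M\<^esub> x = - x"
      by (rule inv_equality) (use that sub M in \<open>auto simp: lattice_group_def\<close>)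
    then show ?thesis using subgroup.m_inv_closed[OF L that] by simp
  qed
qed

section \<open>Integer coordinates for weights and roots\<close>

context quantum_group_data
begin

lemma dual_of_add: "\<phi> \<in> dual_of \<hh> \<Longrightarrow> \<psi> \<in> dual_of \<hh> \<Longrightarrow> \<phi> + \<psi> \<in> dual_of \<hh>"
  by (auto simp: dual_of_def algebra_simps)

lemma dual_of_scale: "\<phi> \<in> dual_of \<hh> \<Longrightarrow> (\<lambda>x. c * \<phi> x) \<in> dual_of \<hh>"
  by (auto simp: dual_of_def algebra_simps)

lemma dual_of_0: "(\<lambda>x. 0) \<in> dual_of \<hh>"
  by (auto simp: dual_of_def)

lemma \<alpha>_dual: "\<alpha> i \<in> dual_of \<hh>"
  using simple_roots by (auto simp: simple_roots_def roots_def)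

lemma ip_sym: "\<phi> \<in> dual_of \<hh> \<Longrightarrow> \<psi> \<in> dual_of \<hh> \<Longrightarrow> ip \<phi> \<psi> = ip \<psi> \<phi>"
  using induced_form by (auto simp: induced_form_def)

lemma ip_add: "\<phi> \<in> dual_of \<hh> \<Longrightarrow> \<psi> \<in> dual_of \<hh> \<Longrightarrow> \<theta> \<in> dual_of \<hh> \<Longrightarrow> ip (\<phi> + \<psi>) \<theta> = ip \<phi> \<theta> + ip \<psi> \<theta>"
  using induced_form by (auto simp: induced_form_def)

lemma ip_scale: "\<phi> \<in> dual_of \<hh> \<Longrightarrow> \<psi> \<in> dual_of \<hh> \<Longrightarrow> ip (\<lambda>x. c * \<phi> x) \<psi> = c * ip \<phi> \<psi>"
  using induced_form by (auto simp: induced_form_def)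

lemma ip_sum:
  assumes "\<And>i. v i \<in> dual_of \<hh>" "\<psi> \<in> dual_of \<hh>" "finite J"
  shows "(\<lambda>x. \<Sum>i\<in>J. c i * v i x) \<in> dual_of \<hh> \<and> ip (\<lambda>x. \<Sum>i\<in>J. c i * v i x) \<psi> = (\<Sum>i\<in>J. c i * ip (v i) \<psi>)"
  using assms(3)
proof (induct J)
  case empty
  have "ip (\<lambda>x. 0) \<psi> = 0"
    using ip_scale[of "\<lambda>x. 0" \<psi> 0] assms(2) dual_of_0 by simp
  then show ?case using dual_of_0 by simp
next
  case (insert j J)
  have eq: "(\<lambda>x. \<Sum>i\<in>insert j J. c i * v i x) = (\<lambda>x. c j * v j x) + (\<lambda>x. \<Sum>i\<in>J. c i * v i x)"
    using insert by (auto simp: fun_eq_iff)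
  have "ip (\<lambda>x. c j * v j x) \<psi> = c j * ip (v j) \<psi>"
    using assms(1,2) by (intro ip_scale)
  moreover have "ip ((\<lambda>x. c j * v j x) + (\<lambda>x. \<Sum>i\<in>J. c i * v i x)) \<psi> =
      ip (\<lambda>x. c j * v j x) \<psi> + ip (\<lambda>x. \<Sum>i\<in>J. c i * v i x) \<psi>"
    using assms(1,2) insert(3) by (intro ip_add dual_of_scale) blast+
  ultimately show ?case
    unfolding eq using insert assms(1) by (auto intro: dual_of_add dual_of_scale)
qed

text \<open>In coordinates the pairing of a weight with a root is an explicit integer, so the floor
  in \<open>int_ip\<close> loses nothing.\<close>

definition wt :: "('i \<Rightarrow> int) \<Rightarrow> 'g \<Rightarrow> complex" where
  "wt n = (\<lambda>x. \<Sum>i\<in>UNIV. of_int (n i) * \<omega> i x)"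

definition rt :: "('i \<Rightarrow> int) \<Rightarrow> 'g \<Rightarrow> complex" where
  "rt n = (\<lambda>x. \<Sum>i\<in>UNIV. of_int (n i) * \<alpha> i x)"

lemma int_span_wt: "int_span \<omega> = range wt" and int_span_rt: "int_span \<alpha> = range rt"
  by (auto simp: int_span_def wt_def rt_def)

lemma wt_add: "wt (m + n) = wt m + wt n" and rt_add: "rt (m + n) = rt m + rt n"
  by (auto simp: wt_def rt_def fun_eq_iff algebra_simps sum.distrib)

lemma wt_uminus: "wt (- m) = - wt m" and rt_uminus: "rt (- m) = - rt m"
  by (auto simp: wt_def rt_def fun_eq_iff sum_negf)

lemma wt_diff: "wt (m - n) = wt m - wt n"
  by (simp add: wt_add wt_uminus flip: add_uminus_conv_diff)

lemma wt_0: "wt 0 = 0" and rt_0: "rt 0 = 0"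
  by (auto simp: wt_def rt_def fun_eq_iff)

lemma wt_dual: "wt n \<in> dual_of \<hh>" and rt_dual: "rt n \<in> dual_of \<hh>"
  unfolding wt_def rt_def
  by (rule conjunct1[OF ip_sum[OF fundamental_weights(1) \<alpha>_dual finite]],
      rule conjunct1[OF ip_sum[OF \<alpha>_dual \<alpha>_dual finite]])

lemma ip_wt_\<alpha>: "ip (wt n) (\<alpha> j) = of_int (n j * int (d j))"
  unfolding wt_def conjunct2[OF ip_sum[OF fundamental_weights(1) \<alpha>_dual finite]]
  by (simp add: fundamental_weights(2) if_distrib[of "(*) _"] cong: if_cong)

lemma ip_wt_rt: "ip (wt n) (rt m) = of_int (\<Sum>j\<in>UNIV. m j * (n j * int (d j)))"
proof -
  have "ip (rt m) (wt n) = (\<Sum>j\<in>UNIV. of_int (m j) * ip (\<alpha> j) (wt n))"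
    unfolding rt_def by (rule conjunct2[OF ip_sum[where v = \<alpha>, OF \<alpha>_dual wt_dual finite]])
  then show ?thesis
    using ip_sym[OF wt_dual rt_dual] ip_sym[OF \<alpha>_dual wt_dual] by (simp add: ip_wt_\<alpha>)
qed

lemma int_ip_wt_rt: "int_ip ip (wt n) (rt m) = (\<Sum>j\<in>UNIV. m j * (n j * int (d j)))"
  by (simp only: int_ip_def ip_wt_rt complex_Re_of_int floor_of_int)

lemma q_nz: "q \<noteq> 0"
  using primitive_root(1,2) by (metis not_one_le_zero power_0_left zero_neq_one)

lemma L_closed: "0 \<in> L" "\<phi> \<in> L \<Longrightarrow> \<psi> \<in> L \<Longrightarrow> \<phi> + \<psi> \<in> L" "\<phi> \<in> L \<Longrightarrow> - \<phi> \<in> L" "L \<subseteq> range wt"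
proof -
  note * = subgroup_lattice_group_closed[OF _ _ _ lattice(1)]
  have c: "0 \<in> int_span \<omega>" "x \<in> int_span \<omega> \<Longrightarrow> y \<in> int_span \<omega> \<Longrightarrow> x + y \<in> int_span \<omega>"
    "x \<in> int_span \<omega> \<Longrightarrow> - x \<in> int_span \<omega>" for x y
    unfolding int_span_wt by (auto simp flip: wt_0 wt_add wt_uminus)
  show "0 \<in> L" "\<phi> \<in> L \<Longrightarrow> \<psi> \<in> L \<Longrightarrow> \<phi> + \<psi> \<in> L" "\<phi> \<in> L \<Longrightarrow> - \<phi> \<in> L" "L \<subseteq> range wt"
    using *[OF c] by (auto simp: int_span_wt)
qed

lemma rt_in_L: "rt n \<in> L"
  using lattice(2) by (auto simp: int_span_rt)

text \<open>The Cartan integers of \<alpha>_i. They exist because the root lattice lies in L and L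
  in the weight lattice.\<close>

definition \<alpha>_coords :: "'i \<Rightarrow> 'i \<Rightarrow> int" where
  "\<alpha>_coords i = (SOME n. \<alpha> i = wt n)"

lemma \<alpha>_rt: "\<alpha> i = rt (\<lambda>j. if j = i then 1 else 0)"
  by (auto simp: rt_def fun_eq_iff if_distrib[of of_int] if_distrib[of "\<lambda>x. x * _"] cong: if_cong)

lemma \<alpha>_wt: "\<alpha> i = wt (\<alpha>_coords i)"
proof -
  have "\<alpha> i \<in> range wt" using rt_in_L L_closed(4) \<alpha>_rt[of i] by auto
  then have "\<exists>n. \<alpha> i = wt n" by blast
  then show ?thesis unfolding \<alpha>_coords_def by (rule someI_ex)
qed

lemma L'_closed: "0 \<in> L'" "\<phi> \<in> L' \<Longrightarrow> \<psi> \<in> L' \<Longrightarrow> \<phi> + \<psi> \<in> L'" "\<phi> \<in> L' \<Longrightarrow> - \<phi> \<in> L'" "L' \<subseteq> L"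
  and L'_pairing: "\<phi> \<in> L' \<Longrightarrow> \<exists>k. ip \<phi> (rt m) = of_int (int l * k)"
proof -
  define M where "M = {\<nu> \<in> int_span \<alpha>. \<forall>\<mu>\<in>int_span \<alpha>. \<exists>k::int. ip \<nu> \<mu> = of_int (int l * k)}"
  have ipadd: "ip (rt m + rt n) (rt p) = ip (rt m) (rt p) + ip (rt n) (rt p)" for m n p
    by (rule ip_add[OF rt_dual rt_dual rt_dual])
  have ip0: "ip 0 (rt p) = 0" for p using ipadd[of 0 0 p] by (simp add: rt_0)
  have ipminus: "ip (- rt m) (rt p) = - ip (rt m) (rt p)" for m p
    using ipadd[of m "- m" p] ip0[of p] by (simp add: rt_uminus eq_neg_iff_add_eq_0 add.commute)
  have c: "0 \<in> M" "x \<in> M \<Longrightarrow> y \<in> M \<Longrightarrow> x + y \<in> M" "x \<in> M \<Longrightarrow> - x \<in> M" for x y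
  proof -
    show "0 \<in> M"
      using rt_0 by (auto simp: M_def int_span_rt ip0 intro: exI[of _ 0] rangeI[of rt 0, unfolded rt_0])
    show "x + y \<in> M" if x: "x \<in> M" and y: "y \<in> M"
    proof -
      obtain m n where mn: "x = rt m" "y = rt n" using x y by (auto simp: M_def int_span_rt)
      have "\<exists>k. ip (rt m + rt n) (rt p) = of_int (int l * k)" for p
      proof -
        obtain k k' where "ip (rt m) (rt p) = of_int (int l * k)" "ip (rt n) (rt p) = of_int (int l * k')"
          using x y by (force simp: M_def int_span_rt mn)
        then have "ip (rt m + rt n) (rt p) = of_int (int l * (k + k'))"
          by (simp add: ipadd algebra_simps)
        then show ?thesis ..
      qed
      then show ?thesis by (auto simp: M_def int_span_rt mn simp flip: rt_add)
    qed
    show "- x \<in> M" if x: "x \<in> M"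
    proof -
      obtain m where m: "x = rt m" using x by (auto simp: M_def int_span_rt)
      have "\<exists>k. ip (- rt m) (rt p) = of_int (int l * k)" for p
      proof -
        obtain k where "ip (rt m) (rt p) = of_int (int l * k)"
          using x by (force simp: M_def int_span_rt m)
        then have "ip (- rt m) (rt p) = of_int (int l * (- k))"
          by (simp add: ipminus)
        then show ?thesis ..
      qed
      then show ?thesis by (auto simp: M_def int_span_rt m simp flip: rt_uminus)
    qed
  qed
  note * = subgroup_lattice_group_closed[OF c sublattice(1)[folded M_def]]
  have "M \<subseteq> L" using lattice(2) by (auto simp: M_def)
  then show "0 \<in> L'" "\<phi> \<in> L' \<Longrightarrow> \<psi> \<in> L' \<Longrightarrow> \<phi> + \<psi> \<in> L'" "\<phi> \<in> L' \<Longrightarrow> - \<phi> \<in> L'" "L' \<subseteq> L"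
    using * by blast+
  show "\<exists>k. ip \<phi> (rt m) = of_int (int l * k)" if "\<phi> \<in> L'"
    using that *(4) by (auto simp: M_def int_span_rt)
qed

section \<open>The quotient group, representatives and powers of q\<close>

abbreviation "Q \<equiv> lattice_group L Mod L'"

lemma comm_group_L: "comm_group (lattice_group L)"
  by (rule group_lattice_group) (use L_closed in auto)

lemma subgroup_L': "subgroup L' (lattice_group L)"
proof -
  interpret comm_group "lattice_group L" by (rule comm_group_L)
  have "inv\<^bsub>lattice_group L\<^esub> x = - x" if "x \<in> L'" for x
    by (rule inv_equality) (use that L'_closed(4) L_closed in \<open>auto simp: lattice_group_def\<close>)
  then show ?thesis
    by (intro subgroupI) (use L'_closed in \<open>auto simp: lattice_group_def\<close>)
qed

lemma comm_group_Q: "comm_group Q"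
  by (rule comm_group.abelian_FactGroup[OF comm_group_L subgroup_L'])

lemma cls_eq: "cls L' \<phi> = {\<nu> + \<phi> | \<nu>. \<nu> \<in> L'}"
  by (auto simp: cls_def r_coset_def lattice_group_def)

lemma carrier_Q: "carrier Q = cls L' ` L"
  by (auto simp: FactGroup_def RCOSETS_def cls_def r_coset_def lattice_group_def)

lemma cls_mult: "\<phi> \<in> L \<Longrightarrow> \<psi> \<in> L \<Longrightarrow> cls L' \<phi> \<otimes>\<^bsub>Q\<^esub> cls L' \<psi> = cls L' (\<phi> + \<psi>)"
proof -
  assume *: "\<phi> \<in> L" "\<psi> \<in> L"
  have "normal L' (lattice_group L)"
    using comm_group.normal_iff_subgroup[OF comm_group_L] subgroup_L' by blast
  from normal.rcos_sum[OF this, of \<phi> \<psi>] * show ?thesis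
    by (simp add: FactGroup_def cls_def r_coset_def lattice_group_def set_mult_def)
qed

lemma cls_0: "cls L' 0 = \<one>\<^bsub>Q\<^esub>"
  by (auto simp: FactGroup_def cls_eq)

lemma cls_eq_iff: "cls L' \<phi> = cls L' \<psi> \<longleftrightarrow> \<phi> - \<psi> \<in> L'"
proof
  assume eq: "cls L' \<phi> = cls L' \<psi>"
  have "\<phi> \<in> cls L' \<phi>" using L'_closed(1) by (auto simp: cls_eq intro!: exI[of _ 0])
  then show "\<phi> - \<psi> \<in> L'" unfolding eq by (auto simp: cls_eq)
next
  assume *: "\<phi> - \<psi> \<in> L'"
  show "cls L' \<phi> = cls L' \<psi>"
  proof (intro equalityI subsetI)
    fix x assume "x \<in> cls L' \<phi>"
    then obtain \<nu> where "\<nu> \<in> L'" "x = \<nu> + \<phi>" by (auto simp: cls_eq)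
    then have "x = (\<nu> + (\<phi> - \<psi>)) + \<psi>" "\<nu> + (\<phi> - \<psi>) \<in> L'" using L'_closed(2) * by auto
    then show "x \<in> cls L' \<psi>" unfolding cls_eq by blast
  next
    fix x assume "x \<in> cls L' \<psi>"
    then obtain \<nu> where "\<nu> \<in> L'" "x = \<nu> + \<psi>" by (auto simp: cls_eq)
    then have "x = (\<nu> + - (\<phi> - \<psi>)) + \<phi>" "\<nu> + - (\<phi> - \<psi>) \<in> L'"
      using L'_closed(2)[OF _ L'_closed(3)[OF *]] by auto
    then show "x \<in> cls L' \<phi>" unfolding cls_eq by blast
  qed
qed

definition rep :: "('g \<Rightarrow> complex) set \<Rightarrow> 'i \<Rightarrow> int" where
  "rep c = (SOME n. wt n \<in> L \<and> cls L' (wt n) = c)"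

lemma rep:
  assumes "c \<in> carrier Q"
  shows "wt (rep c) \<in> L" "cls L' (wt (rep c)) = c"
proof -
  obtain \<phi> where "\<phi> \<in> L" "c = cls L' \<phi>" using assms by (auto simp: carrier_Q)
  moreover then obtain n where "\<phi> = wt n" using L_closed(4) by auto
  ultimately have "\<exists>n. wt n \<in> L \<and> cls L' (wt n) = c" by auto
  from someI_ex[OF this] show "wt (rep c) \<in> L" "cls L' (wt (rep c)) = c" by (auto simp: rep_def)
qed

definition \<chi> :: "('i \<Rightarrow> int) \<Rightarrow> 'i \<Rightarrow> complex" where
  "\<chi> n i = q powi (n i * int (d i))"

definition t :: "'i \<Rightarrow> 'i \<Rightarrow> complex" where
  "t i j = \<chi> (\<alpha>_coords i) j"

definition Z :: "('i \<Rightarrow> int) set" where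
  "Z = {n. wt n \<in> L'}"

text \<open>Pairings of \<Lambda>' with roots are multiples of the order l of q, which makes the
  characters below well defined on classes.\<close>

lemma q_powi_period:
  assumes "\<phi> \<in> L'" shows "ip \<phi> (rt m) = of_int k \<Longrightarrow> q powi k = 1"
proof -
  assume k: "ip \<phi> (rt m) = of_int k"
  obtain k' where "ip \<phi> (rt m) = of_int (int l * k')" using L'_pairing[OF assms] by blast
  with k have "k = int l * k'" by (simp flip: of_int_mult)
  then show ?thesis using primitive_root(2) by (simp add: power_int_mult)
qed

lemma \<chi>_Z: "z \<in> Z \<Longrightarrow> \<chi> z i = 1"
  using q_powi_period[of "wt z" _ "z i * int (d i)"] \<alpha>_rt[of i] ip_wt_\<alpha>[of z i]
  by (simp add: Z_def \<chi>_def)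

lemma t_sym: "t i j = t j i"
proof -
  have "ip (\<alpha> i) (\<alpha> j) = ip (\<alpha> j) (\<alpha> i)" by (rule ip_sym[OF \<alpha>_dual \<alpha>_dual])
  then have "(of_int (\<alpha>_coords i j * int (d j)) :: complex) = of_int (\<alpha>_coords j i * int (d i))"
    unfolding ip_wt_\<alpha>[symmetric] by (simp flip: \<alpha>_wt)
  then show ?thesis unfolding t_def \<chi>_def by (simp only: of_int_eq_iff)
qed

text \<open>The number that is assumed to differ from 1; this is what finally excludes 2\<alpha>_i
  \<in> \<Lambda>'.\<close>

lemma t_diag: "t i i = q ^ (2 * d i)"
proof -
  have "(of_int (\<alpha>_coords i i * int (d i)) :: complex) = of_int (2 * int (d i))"
    using d[of i] unfolding ip_wt_\<alpha>[symmetric] by (auto simp: mult.commute simp flip: \<alpha>_wt)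
  then have "\<alpha>_coords i i * int (d i) = int (2 * d i)" by (simp only: of_int_eq_iff)
  then show ?thesis unfolding t_def \<chi>_def by (simp only: power_int_of_nat)
qed

lemma \<chi>_add: "\<chi> (m + n) i = \<chi> m i * \<chi> n i"
  by (simp add: \<chi>_def distrib_right power_int_add q_nz)

lemma \<chi>_nz: "\<chi> m i \<noteq> 0"
  by (simp add: \<chi>_def q_nz)

lemma weight_rt: "weight \<alpha> w = rt (\<lambda>i. int (count_list w i))"
proof (induct w)
  case Nil
  show ?case by (simp add: weight_def fun_eq_iff rt_def)
next
  case (Cons j w)
  have "(\<lambda>i. int (count_list (j # w) i)) = (\<lambda>i. if i = j then 1 else 0) + (\<lambda>i. int (count_list w i))"
    by (auto simp: fun_eq_iff)
  with Cons show ?case by (simp add: rt_add weight_def flip: \<alpha>_rt)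
qed

lemma q_powi_weight: "q powi int_ip ip (wt n) (weight \<alpha> w) = prod_list (map (\<chi> n) w)"
proof (induct w)
  case Nil
  show ?case by (simp add: weight_rt int_ip_wt_rt)
next
  case (Cons j w)
  have "(\<Sum>i\<in>UNIV. int (count_list (j # w) i) * (n i * int (d i))) =
      (\<Sum>i\<in>UNIV. (if i = j then n i * int (d i) else 0) + int (count_list w i) * (n i * int (d i)))"
    by (rule sum.cong) (auto simp: algebra_simps)
  then show ?case
    using Cons by (simp add: weight_rt int_ip_wt_rt sum.distrib power_int_add q_nz \<chi>_def)
qed

end

section \<open>The triangular functionals\<close>

lemma clinear_eval: "clinear (eval g)"
  unfolding eval_def by (rule clinear_linext)

lemma eval_word: "eval g (word w) = prod_list (map g w)"
  by (simp add: eval_def)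

lemma eval_gen [simp]: "eval g (gen x) = g x"
  by (simp add: eval_word)

lemma eval_1 [simp]: "eval g 1 = 1"
  by (simp add: eval_word flip: word_Nil)

lemma eval_mult: "eval g (p * p') = eval g p * eval g p'"
proof (rule word_linear_eqI[of "\<lambda>p. eval g (p * p')"], goal_cases)
  case (3 u)
  show ?case
    by (rule word_linear_eqI[of "\<lambda>p'. eval g (word u * p')"])
      (intro clinear_intros clinear_comp[OF clinear_eval] clinear_eval | simp add: eval_word flip: word_append)+
qed (intro clinear_comp[OF clinear_eval] clinear_intros clinear_eval)+

lemma eval_eval_gen: "eval \<rho> (eval (\<lambda>i. gen (g i)) x) = eval (\<lambda>i. \<rho> (g i)) x"
  by (induction x rule: word_eqI_gen)
    (rule clinear_comp[OF clinear_eval clinear_eval] clinear_eval | simp add: eval_mult)+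

section \<open>Functionals on presented algebras\<close>

lemma free_on_diff: "p \<in> free_on X \<Longrightarrow> p' \<in> free_on X \<Longrightarrow> p - p' \<in> free_on X"
  unfolding free_on_def using keys_diff[of p p'] by blast

lemma free_on_add: "p \<in> free_on X \<Longrightarrow> p' \<in> free_on X \<Longrightarrow> p + p' \<in> free_on X"
  unfolding free_on_def using Poly_Mapping.keys_add[of p p'] by blast

lemma free_on_scale: "p \<in> free_on X \<Longrightarrow> c *\<^sub>C p \<in> free_on X"
  unfolding free_on_def by (auto simp: in_keys_iff)

lemma free_on_word: "set w \<subseteq> X \<Longrightarrow> word w \<in> free_on X"
  by (simp add: free_on_def word_def)

lemma free_on_1: "1 \<in> free_on X"
  using free_on_word[of "[]"] by (simp add: word_Nil)

lemma presented_by_rel: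
  assumes "presented_by X g Rels" "r \<in> Rels"
  shows "eval g r = 0"
proof -
  have "1 * r * 1 \<in> cvec.span {a * r * b | a r b. a \<in> free_on X \<and> r \<in> Rels \<and> b \<in> free_on X}"
    by (rule cvec.span_base) (use assms(2) free_on_1 in blast)
  then have "1 * r * 1 \<in> {p \<in> free_on X. eval g p = 0}"
    using assms(1) by (simp add: presented_by_def)
  then show ?thesis by simp
qed

text \<open>The functional is evaluated on chosen lifts. Two lifts of one element differ by an
  element of the ideal, which gives linearity and independence of the choice.\<close>

lemma presented_by_functional:
  fixes g :: "'x \<Rightarrow> 'h::complex_algebra_1" and G :: "'x free_algebra \<Rightarrow> complex"
  assumes pres: "presented_by X g Rels" and G: "clinear G"
    and null: "\<And>a r b. r \<in> Rels \<Longrightarrow> G (a * r * b) = 0"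
  obtains \<Phi> where "clinear \<Phi>" "\<And>p. p \<in> free_on X \<Longrightarrow> \<Phi> (eval g p) = G p"
proof -
  have ker: "G p = 0" if "p \<in> free_on X" "eval g p = 0" for p
  proof -
    have "p \<in> cvec.span {a * r * b | a r b. a \<in> free_on X \<and> r \<in> Rels \<and> b \<in> free_on X}"
      using pres that by (auto simp: presented_by_def)
    then show ?thesis
      by (induct p rule: cvec.span_induct_alt) (auto simp: clin_0[OF G] clin_add[OF G] clin_scale[OF G] null)
  qed
  have ex: "\<exists>p. p \<in> free_on X \<and> eval g p = h" for h
  proof -
    have "h \<in> eval g ` free_on X" using pres by (simp add: presented_by_def)
    then show ?thesis by auto
  qed
  define s where "s h = (SOME p. p \<in> free_on X \<and> eval g p = h)" for h
  have s: "s h \<in> free_on X" "eval g (s h) = h" for h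
    using someI_ex[OF ex[of h]] by (auto simp: s_def)
  have eq: "G (s (eval g p)) = G p" if "p \<in> free_on X" for p
    using ker[OF free_on_diff[OF s(1) that]] by (simp add: clin_diff[OF clinear_eval] clin_diff[OF G] s(2))
  have "clinear (\<lambda>h. G (s h))"
  proof (rule clinearI)
    show "G (s (x + y)) = G (s x) + G (s y)" for x y
      using eq[OF free_on_add[OF s(1) s(1)], of x y] by (simp add: clin_add[OF clinear_eval] s(2) clin_add[OF G])
    show "G (s (k *\<^sub>C x)) = k *\<^sub>C G (s x)" for k x
      using eq[OF free_on_scale[OF s(1)], of k x] by (simp add: clin_scale[OF clinear_eval] s(2) clin_scale[OF G])
  qed
  from that[OF this eq] show thesis .
qed

context small_quantum_group
begin

sublocale lusztig_pairing t "lusztig_r q ip \<alpha>" B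
proof (rule lusztig_pairing_of_form[OF lusztig_form t_sym])
  show "int_ip ip (weight \<alpha> []) (weight \<alpha> v) = 0" for v
    using int_ip_wt_rt[of 0] by (simp add: weight_rt[of v] weight_def[of _ "[]"] wt_0)
  show "q powi int_ip ip (weight \<alpha> [i]) (weight \<alpha> v) = prod_list (map (t i) v)" for i v
    using q_powi_weight[of "\<alpha>_coords i" v] by (simp add: weight_def t_def[abs_def] flip: \<alpha>_wt)
qed

definition cc :: "'i \<Rightarrow> complex" where
  "cc i = 1 / (q ^ d i - inverse (q ^ d i))"

sublocale triangular_module t \<chi> \<alpha>_coords cc Z "radical B"
  by unfold_locales (simp_all add: \<chi>_add \<chi>_nz t_def \<chi>_Z radical_mult radical_ldiff radical_rdiff radical_scale_word
      t_sym[unfolded t_def])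

text \<open>A class acts through a chosen representative; another choice changes the result by null
  vectors only.\<close>

definition gen_op :: "(('g \<Rightarrow> complex) set, 'i) generator \<Rightarrow> ('i \<Rightarrow> int, 'i) triangular \<Rightarrow> ('i \<Rightarrow> int, 'i) triangular" where
  "gen_op = case_generator (\<lambda>c. K_op (rep c)) E_op F_op"

lemma gen_op_simps [simp]:
  "gen_op (GenK c) = K_op (rep c)" "gen_op (GenE i) = E_op i" "gen_op (GenF i) = F_op i"
  by (simp_all add: gen_op_def)

lemma gen_op_lin: "clinear (gen_op x)"
  by (cases x) (simp_all add: K_lin E_lin F_lin)

lemma gen_act_null: "s \<in> tri_null \<Longrightarrow> word_act gen_op p s \<in> tri_null"
proof (induct p rule: poly_mapping_add_induct)
  case (single w k)
  have "gen_op x s \<in> tri_null" if "s \<in> tri_null" for x s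
    using that by (cases x) (simp_all add: null_K null_E null_F)
  then have "foldr gen_op w s \<in> tri_null"
    using single by (induct w) simp_all
  moreover have "Poly_Mapping.single w k = k *\<^sub>C word w" by (simp add: word_def)
  ultimately show ?case
    by (simp only: clin_scale[OF clinear_word_act_left[OF clinear_id]] word_act_word cvec.span_scale)
qed (simp add: clin_add[OF clinear_word_act_left[OF clinear_id]] cvec.span_add)

lemma rep_cls: "wt n \<in> L \<Longrightarrow> rep (cls L' (wt n)) - n \<in> Z"
proof -
  assume "wt n \<in> L"
  then have "cls L' (wt n) \<in> carrier Q" by (simp add: carrier_Q)
  then have "wt (rep (cls L' (wt n))) - wt n \<in> L'"
    using rep(2) by (simp flip: cls_eq_iff)
  then show ?thesis
    by (simp add: Z_def wt_diff)
qed

lemma K_rep_null: "wt n \<in> L \<Longrightarrow> K_op (rep (cls L' (wt n))) s - K_op n s \<in> tri_null"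
  using null_K_diff[OF rep_cls, of n n s] by simp

lemma rep_power: "\<phi> \<in> L \<Longrightarrow> q powi int_ip ip \<phi> (\<alpha> i) = \<chi> (rep (cls L' \<phi>)) i"
proof -
  assume \<phi>: "\<phi> \<in> L"
  then obtain n where n: "\<phi> = wt n" using L_closed(4) by blast
  have "rep (cls L' (wt n)) - n \<in> Z" using rep_cls \<phi> n by simp
  then have "\<chi> (rep (cls L' (wt n))) i = \<chi> n i"
    using \<chi>_add[of "rep (cls L' (wt n)) - n" n i] \<chi>_Z by simp
  then show ?thesis using q_powi_weight[of n "[i]"] by (simp add: n weight_def)
qed

lemma K_rep_inverse_null:
  assumes "\<phi> \<in> L"
  shows "K_op (rep (cls L' \<phi>) + rep (cls L' (- \<phi>))) s - s \<in> tri_null"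
proof -
  obtain m where m: "\<phi> = wt m" using assms L_closed(4) by blast
  have "rep (cls L' (wt m)) - m \<in> Z" "rep (cls L' (wt (- m))) - - m \<in> Z"
    using assms L_closed(3)[OF assms] by (intro rep_cls; simp add: m wt_uminus)+
  then have "rep (cls L' (wt m)) + rep (cls L' (wt (- m))) \<in> Z"
    using L'_closed(2)[of "wt (rep (cls L' (wt m)) - m)" "wt (rep (cls L' (wt (- m))) - - m)"]
    by (simp add: Z_def flip: wt_add)
  from null_K_diff[OF this, of 0 s] show ?thesis by (simp add: m K_0 wt_uminus)
qed

text \<open>The commutation rules hold exactly for the operators. The error terms come from the
  representatives of the classes, and the radical relations are null by \<open>null_E_act\<close>
  and \<open>null_F_act\<close>.\<close>

lemma relation_null:
  assumes "r \<in> qg_relations ip \<alpha> d q L L' B"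
  shows "word_act gen_op r s \<in> tri_null"
proof -
  note [simp] = clin_diff[OF clinear_word_act_left[OF clinear_id]] word_act_mult[OF gen_op_lin]
    clin_scale[OF clinear_word_act_left[OF clinear_id]] clin_0[OF clinear_word_act_left[OF clinear_id]]
  let ?K = "\<lambda>\<phi>. gen (GenK (cls L' \<phi>)) :: (('g \<Rightarrow> complex) set, 'i) generator free_algebra"
  consider (KK) \<phi> \<psi> where "\<phi> \<in> L" "\<psi> \<in> L" "r = ?K \<phi> * ?K \<psi> - ?K (\<phi> + \<psi>)"
    | (K1) "r = ?K 0 - 1"
    | (KE) \<phi> i where "\<phi> \<in> L" "r = ?K \<phi> * gen (GenE i) * ?K (- \<phi>) - q powi int_ip ip \<phi> (\<alpha> i) *\<^sub>C gen (GenE i)"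
    | (KF) \<phi> i where "\<phi> \<in> L" "r = ?K \<phi> * gen (GenF i) * ?K (- \<phi>) - q powi (- int_ip ip \<phi> (\<alpha> i)) *\<^sub>C gen (GenF i)"
    | (EF) i j where "r = gen (GenE i) * gen (GenF j) - gen (GenF j) * gen (GenE i) -
        (if i = j then (1 / (q ^ d i - inverse (q ^ d i))) *\<^sub>C (?K (\<alpha> i) - ?K (- \<alpha> i)) else 0)"
    | (E) x where "x \<in> radical B" "r = eval (\<lambda>i. gen (GenE i)) x"
    | (F) x where "x \<in> radical B" "r = eval (\<lambda>i. gen (GenF i)) x"
    using assms unfolding qg_relations_def Let_def by blast
  then show ?thesis
  proof cases
    case KK
    obtain m n where mn: "\<phi> = wt m" "\<psi> = wt n" using KK L_closed(4) by blast
    let ?r = "\<lambda>\<phi>. rep (cls L' \<phi>)"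
    have "(?r (wt m) - m) + (?r (wt n) - n) \<in> Z"
      using rep_cls[of m] rep_cls[of n] KK by (simp add: mn Z_def wt_add L'_closed del: add_diff_eq)
    from null_K_diff[OF this, of "m + n" s]
    have "K_op (?r (wt m) + ?r (wt n)) s - K_op (m + n) s \<in> tri_null"
      by (simp add: algebra_simps)
    from cvec.span_diff[OF this K_rep_null[of "m + n" s]] show ?thesis
      using KK(1,2) L_closed(2)[OF KK(1,2)] by (simp add: KK(3) mn K_K wt_add)
  next
    case K1
    show ?thesis using K_rep_null[of 0 s] by (simp add: K1 wt_0 K_0 L_closed)
  next
    case KE
    have "\<chi> (rep (cls L' \<phi>)) i *\<^sub>C (E_op i (K_op (rep (cls L' \<phi>) + rep (cls L' (- \<phi>))) s) - E_op i s) \<in> tri_null"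
      using null_E[OF K_rep_inverse_null[OF KE(1)], of i s] by (intro cvec.span_scale) (simp add: ops_lin)
    then show ?thesis
      by (simp add: KE(2) K_E K_K cvec.scale_right_diff_distrib rep_power[OF KE(1)])
  next
    case KF
    have "inverse (\<chi> (rep (cls L' \<phi>)) i) *\<^sub>C (F_op i (K_op (rep (cls L' \<phi>) + rep (cls L' (- \<phi>))) s) - F_op i s) \<in> tri_null"
      using null_F[OF K_rep_inverse_null[OF KF(1)], of i s] by (intro cvec.span_scale) (simp add: ops_lin)
    then show ?thesis
      by (simp add: KF(2) K_F K_K cvec.scale_right_diff_distrib power_int_minus rep_power[OF KF(1)])
  next
    case EF
    have "cc i *\<^sub>C ((K_op (rep (cls L' (wt (- \<alpha>_coords i)))) s - K_op (- \<alpha>_coords i) s) -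
        (K_op (rep (cls L' (wt (\<alpha>_coords i)))) s - K_op (\<alpha>_coords i) s)) \<in> tri_null"
      using rt_in_L[of "\<lambda>j. if j = i then 1 else 0"] L_closed(3)
      by (intro cvec.span_scale cvec.span_diff K_rep_null) (auto simp: wt_uminus simp flip: \<alpha>_wt \<alpha>_rt)
    moreover have "word_act gen_op r s = cc i *\<^sub>C ((K_op (rep (cls L' (wt (- \<alpha>_coords i)))) s - K_op (- \<alpha>_coords i) s) -
        (K_op (rep (cls L' (wt (\<alpha>_coords i)))) s - K_op (\<alpha>_coords i) s))" if "i = j"
      using that by (simp add: EF E_F wt_uminus cvec.scale_right_diff_distrib flip: \<alpha>_wt cc_def)
    ultimately show ?thesis
      by (cases "i = j") (simp_all add: EF E_F cvec.span_zero)
  next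
    case E
    then show ?thesis using null_E_act[OF E(1), of s] by (simp add: word_act_eval_gen)
  next
    case F
    then show ?thesis using null_F_act[OF F(1), of s] by (simp add: word_act_eval_gen)
  qed
qed

text \<open>The independence half of the triangular decomposition. Acting on the vector
  \<open>tri 0 1 1\<close>, the element K_c F_x E_y creates the basis vector of the same name, and
  the functional is read off there. As a and b are arbitrary, x and y are seen exactly up to the
  radical.\<close>

lemma triangular_functional:
  fixes g :: "('g \<Rightarrow> complex) set \<Rightarrow> complex"
  obtains \<Phi> where "clinear \<Phi>"
    "\<And>c x y. c \<in> carrier Q \<Longrightarrow> \<Phi> (K c * eval F x * eval E y) = g c * B x a * B y b"
proof -
  have per: "g (cls L' (wt (m + z))) = g (cls L' (wt m))" if "z \<in> Z" for m z
  proof -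
    have "cls L' (wt (m + z)) = cls L' (wt m)" using that by (simp add: Z_def wt_add cls_eq_iff)
    then show ?thesis by simp
  qed
  obtain G where G: "clinear G" "\<And>m x y. G (tri m x y) = g (cls L' (wt m)) * B x a * B y b"
      "\<And>s. s \<in> tri_null \<Longrightarrow> G s = 0"
    by (rule null_functional[of "\<lambda>m. g (cls L' (wt m))" "\<lambda>x. B x a" "\<lambda>y. B y b"])
      (auto simp: per radicalD intro!: B_lin(2)[OF clinear_id])
  have lin: "clinear (\<lambda>p. G (word_act gen_op p (tri 0 1 1)))"
    by (intro clinear_comp[OF G(1)] clinear_word_act_left clinear_id)
  obtain \<Phi> where \<Phi>: "clinear \<Phi>" "\<And>p. p \<in> free_on (qg_generators Q) \<Longrightarrow>
      \<Phi> (eval (case_generator K E F) p) = G (word_act gen_op p (tri 0 1 1))"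
  proof (rule presented_by_functional[OF presentation lin])
    show "G (word_act gen_op (a * r * b) (tri 0 1 1)) = 0" if "r \<in> qg_relations ip \<alpha> d q L L' B" for a r b
      unfolding word_act_mult[OF gen_op_lin] by (intro G(3) gen_act_null[of _ a] relation_null that)
  qed blast
  have "\<Phi> (K c * eval F x * eval E y) = g c * B x a * B y b" if c: "c \<in> carrier Q" for c x y
  proof -
    have w: "\<Phi> (K c * eval F (word u) * eval E (word v)) = g c * B (word u) a * B (word v) b" for u v
    proof -
      define p where "p = gen (GenK c) * word (map GenF u) * word (map GenE v)"
      have "p = word (GenK c # map GenF u @ map GenE v)"
        by (simp add: p_def flip: word_append)
      then have "p \<in> free_on (qg_generators Q)"
        using c by (auto intro!: free_on_word simp: qg_generators_def)
      moreover have "eval (case_generator K E F) p = K c * eval F (word u) * eval E (word v)"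
        by (simp add: p_def eval_mult eval_word comp_def)
      moreover have "word_act gen_op p (tri 0 1 1) = tri (rep c) (word u) (word v)"
      proof -
        have E: "word_act gen_op (word (map GenE v)) s = word_act E_op (word v) s"
          and F: "word_act gen_op (word (map GenF u)) s = word_act F_op (word u) s" for s
          by (simp_all add: word_act_word foldr_map comp_def)
        show ?thesis
          by (simp add: p_def word_act_mult[OF gen_op_lin] E F E_act_tri F_act_tri K_tri \<chi>_0[abs_def])
      qed
      ultimately show ?thesis using \<Phi>(2)[of p] by (simp add: G(2) rep(2)[OF c])
    qed
    have w': "\<Phi> (K c * eval F (word u) * eval E y) = g c * B (word u) a * B y b" for u
      by (rule word_linear_eqI[of "\<lambda>y. \<Phi> (K c * eval F (word u) * eval E y)"],
          rule clinear_comp[OF \<Phi>(1)], rule clinear_mult_right[OF clinear_eval],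
          rule clinear_cmult(1)[OF B_lin(2)[OF clinear_id]], rule w)
    show ?thesis
      by (rule word_linear_eqI[of "\<lambda>x. \<Phi> (K c * eval F x * eval E y)"],
          rule clinear_comp[OF \<Phi>(1)], intro clinear_mult_right clinear_mult_left clinear_eval,
          intro clinear_cmult B_lin(2)[OF clinear_id], rule w')
  qed
  with \<Phi>(1) show thesis by (rule that)
qed

end

section \<open>Slices of tensors\<close>

definition right_slice :: "('b::complex_vector \<Rightarrow> complex) \<Rightarrow> ('a::complex_vector, 'b) tensor \<Rightarrow> 'a" where
  "right_slice \<phi> = tensor_lift (\<lambda>a b. \<phi> b *\<^sub>C a)"

definition left_slice :: "('a::complex_vector \<Rightarrow> complex) \<Rightarrow> ('a, 'b::complex_vector) tensor \<Rightarrow> 'b" where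
  "left_slice \<phi> = tensor_lift (\<lambda>a b. \<phi> a *\<^sub>C b)"

lemma right_slice_bilinear: "clinear \<phi> \<Longrightarrow> cbilinear (\<lambda>a b. \<phi> b *\<^sub>C a)"
  and left_slice_bilinear: "clinear \<psi> \<Longrightarrow> cbilinear (\<lambda>a b. \<psi> a *\<^sub>C b)"
  by (intro cbilinearI' clinear_intros; assumption)+

lemma right_slice_tensor: "clinear \<phi> \<Longrightarrow> right_slice \<phi> (a \<otimes>\<^sub>C b) = \<phi> b *\<^sub>C a"
  unfolding right_slice_def by (rule tensor_lift_tensor[OF right_slice_bilinear])

lemma left_slice_tensor: "clinear \<phi> \<Longrightarrow> left_slice \<phi> (a \<otimes>\<^sub>C b) = \<phi> a *\<^sub>C b"
  unfolding left_slice_def by (rule tensor_lift_tensor[OF left_slice_bilinear])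

lemma clinear_right_slice: "clinear \<phi> \<Longrightarrow> clinear (right_slice \<phi>)"
  and clinear_left_slice: "clinear \<psi> \<Longrightarrow> clinear (left_slice \<psi>)"
  unfolding right_slice_def left_slice_def
  by (intro clinear_tensor_lift right_slice_bilinear left_slice_bilinear; assumption)+

lemma right_slice_mult:
  fixes h :: "'a::complex_algebra_1" and k :: "'b::complex_algebra_1"
  assumes \<phi>: "clinear \<phi>"
  shows "right_slice \<phi> ((h \<otimes>\<^sub>C k) * s) = h * right_slice (\<lambda>z. \<phi> (k * z)) s"
    and "right_slice \<phi> (s * (h \<otimes>\<^sub>C k)) = right_slice (\<lambda>z. \<phi> (z * k)) s * h"
proof -
  have l: "clinear (\<lambda>z. \<phi> (k * z))" "clinear (\<lambda>z. \<phi> (z * k))"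
    by (rule clinear_comp[OF \<phi>], intro clinear_intros)+
  show "right_slice \<phi> ((h \<otimes>\<^sub>C k) * s) = h * right_slice (\<lambda>z. \<phi> (k * z)) s"
    by (induct s rule: tensor_induct)
      (simp_all add: times_tensor_tensor right_slice_tensor \<phi> l clin_add[OF clinear_right_slice] distrib_left)
  show "right_slice \<phi> (s * (h \<otimes>\<^sub>C k)) = right_slice (\<lambda>z. \<phi> (z * k)) s * h"
    by (induct s rule: tensor_induct)
      (simp_all add: times_tensor_tensor right_slice_tensor \<phi> l clin_add[OF clinear_right_slice] distrib_right)
qed

lemma left_slice_mult:
  fixes h :: "'a::complex_algebra_1" and k :: "'b::complex_algebra_1"
  assumes \<phi>: "clinear \<phi>"
  shows "left_slice \<phi> ((h \<otimes>\<^sub>C k) * s) = k * left_slice (\<lambda>z. \<phi> (h * z)) s"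
    and "left_slice \<phi> (s * (h \<otimes>\<^sub>C k)) = left_slice (\<lambda>z. \<phi> (z * h)) s * k"
proof -
  have l: "clinear (\<lambda>z. \<phi> (h * z))" "clinear (\<lambda>z. \<phi> (z * h))"
    by (rule clinear_comp[OF \<phi>], intro clinear_intros)+
  show "left_slice \<phi> ((h \<otimes>\<^sub>C k) * s) = k * left_slice (\<lambda>z. \<phi> (h * z)) s"
    by (induct s rule: tensor_induct)
      (simp_all add: times_tensor_tensor left_slice_tensor \<phi> l clin_add[OF clinear_left_slice] distrib_left)
  show "left_slice \<phi> (s * (h \<otimes>\<^sub>C k)) = left_slice (\<lambda>z. \<phi> (z * h)) s * k"
    by (induct s rule: tensor_induct)
      (simp_all add: times_tensor_tensor left_slice_tensor \<phi> l clin_add[OF clinear_left_slice] distrib_right)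
qed

lemma right_slice_in_subspace:
  assumes "clinear \<phi>" "s \<in> tensor_of U V" "cvec.subspace U"
  shows "right_slice \<phi> s \<in> U"
proof -
  note lin = clinear_right_slice[OF assms(1)]
  show ?thesis
    using assms(2) unfolding tensor_of_def
    by (induct s rule: cvec.span_induct_alt)
      (auto simp: clin_0[OF lin] clin_add[OF lin] clin_scale[OF lin] right_slice_tensor[OF assms(1)]
        cvec.subspace_0 cvec.subspace_add cvec.subspace_scale assms(3))
qed

lemma left_slice_in_subspace:
  assumes "clinear \<phi>" "s \<in> tensor_of U V" "cvec.subspace V"
  shows "left_slice \<phi> s \<in> V"
proof -
  note lin = clinear_left_slice[OF assms(1)]
  show ?thesis
    using assms(2) unfolding tensor_of_def
    by (induct s rule: cvec.span_induct_alt)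
      (auto simp: clin_0[OF lin] clin_add[OF lin] clin_scale[OF lin] left_slice_tensor[OF assms(1)]
        cvec.subspace_0 cvec.subspace_add cvec.subspace_scale assms(3))
qed

lemma tensor_sum_right: "x \<otimes>\<^sub>C (\<Sum>i\<in>A. g i) = (\<Sum>i\<in>A. x \<otimes>\<^sub>C g i)"
  by (rule clin_sum[OF clinear_tensor_right[OF clinear_id]])

lemma tensor_of_basis:
  fixes U :: "'a::complex_vector set" and V :: "'b::complex_vector set"
  assumes U: "cvec.subspace U" and W: "W \<subseteq> V" "V \<subseteq> cvec.span W" and s: "s \<in> tensor_of U V"
  obtains D u where "finite D" "D \<subseteq> W" "\<And>w. w \<in> D \<Longrightarrow> u w \<in> U" "s = (\<Sum>w\<in>D. u w \<otimes>\<^sub>C w)"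
proof -
  \<comment> \<open>The coefficients form a finitely supported function on all vectors, so two
    expansions can be added without a common index set.\<close>
  have "\<exists>u. (\<forall>w. u w \<in> U) \<and> finite {w. u w \<noteq> 0} \<and> {w. u w \<noteq> 0} \<subseteq> W \<and> s = (\<Sum>w\<in>{w. u w \<noteq> 0}. u w \<otimes>\<^sub>C w)"
    using s unfolding tensor_of_def
  proof (induct s rule: cvec.span_induct_alt)
    case base
    show ?case by (rule exI[of _ "\<lambda>_. 0"]) (simp add: cvec.subspace_0[OF U])
  next
    case (step c x y)
    then obtain a b where x: "x = a \<otimes>\<^sub>C b" "a \<in> U" "b \<in> V" by blast
    from step obtain u where u: "\<And>w. u w \<in> U" "finite {w. u w \<noteq> 0}" "{w. u w \<noteq> 0} \<subseteq> W"
      "y = (\<Sum>w\<in>{w. u w \<noteq> 0}. u w \<otimes>\<^sub>C w)" by blast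
    have "b \<in> cvec.span W" using W x(3) by blast
    then obtain D r where D: "finite D" "D \<subseteq> W" "b = (\<Sum>w\<in>D. r w *\<^sub>C w)"
      unfolding cvec.span_explicit by auto
    define u' where "u' w = (if w \<in> D then (c * r w) *\<^sub>C a else 0) + u w" for w
    let ?A = "D \<union> {w. u w \<noteq> 0}"
    have A: "finite ?A" "{w. u' w \<noteq> 0} \<subseteq> ?A" using D u by (auto simp: u'_def)
    have "c *\<^sub>C x = (\<Sum>w\<in>D. ((c * r w) *\<^sub>C a) \<otimes>\<^sub>C w)"
      by (simp add: x D(3) tensor_sum_right cbilinearD[OF cbilinear_tensor] cvec.scale_sum_right)
    also have "\<dots> = (\<Sum>w\<in>?A. (if w \<in> D then (c * r w) *\<^sub>C a else 0) \<otimes>\<^sub>C w)"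
      using A(1) by (intro sum.mono_neutral_cong_left)
        (auto simp: clin_0[OF clinear_tensor_left[OF clinear_id]])
    finally have cx: "c *\<^sub>C x = (\<Sum>w\<in>?A. (if w \<in> D then (c * r w) *\<^sub>C a else 0) \<otimes>\<^sub>C w)" .
    have y: "y = (\<Sum>w\<in>?A. u w \<otimes>\<^sub>C w)"
      unfolding u(4) using A(1) by (intro sum.mono_neutral_left)
        (auto simp: clin_0[OF clinear_tensor_left[OF clinear_id]])
    have "c *\<^sub>C x + y = (\<Sum>w\<in>?A. u' w \<otimes>\<^sub>C w)"
      unfolding cx y by (simp add: u'_def cbilinearD[OF cbilinear_tensor] sum.distrib)
    also have "\<dots> = (\<Sum>w\<in>{w. u' w \<noteq> 0}. u' w \<otimes>\<^sub>C w)"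
      using A by (intro sum.mono_neutral_right) (auto simp: clin_0[OF clinear_tensor_left[OF clinear_id]])
    finally have "c *\<^sub>C x + y = (\<Sum>w\<in>{w. u' w \<noteq> 0}. u' w \<otimes>\<^sub>C w)" .
    moreover have "u' w \<in> U" for w
      using u(1) x(2) by (simp add: u'_def cvec.subspace_add[OF U] cvec.subspace_scale[OF U])
    moreover have "finite {w. u' w \<noteq> 0}" "{w. u' w \<noteq> 0} \<subseteq> W"
      using finite_subset[OF A(2,1)] A(2) D(2) u(3) by auto
    ultimately show ?case by (intro exI[of _ u'] conjI allI)
  qed
  then obtain u where "\<forall>w. u w \<in> U" "finite {w. u w \<noteq> 0}" "{w. u w \<noteq> 0} \<subseteq> W"
    "s = (\<Sum>w\<in>{w. u w \<noteq> 0}. u w \<otimes>\<^sub>C w)" by (elim exE conjE)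
  then show thesis by (intro that[of "{w. u w \<noteq> 0}" u]) simp_all
qed

section \<open>The quantum group\<close>

text \<open>\<open>A\<close> and \<open>B\<close> are the generators \<open>E\<close> and \<open>F\<close> in either order.\<close>

lemma triangular_span_closed:
  fixes KK :: "'c \<Rightarrow> 'h::complex_algebra_1" and A B :: "'i \<Rightarrow> 'h"
  assumes one: "1 \<in> KK ` C" and KK: "\<And>c c'. c \<in> C \<Longrightarrow> c' \<in> C \<Longrightarrow> KK c * KK c' \<in> KK ` C"
    and AK: "\<And>c i. c \<in> C \<Longrightarrow> \<exists>k. A i * KK c = k *\<^sub>C (KK c * A i)"
    and BK: "\<And>c i. c \<in> C \<Longrightarrow> \<exists>k. B i * KK c = k *\<^sub>C (KK c * B i)"
    and BA: "\<And>i j. B i * A j - A j * B i \<in> cvec.span (KK ` C)"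
  defines "S \<equiv> cvec.span {KK c * prod_list (map A u) * prod_list (map B v) | c u v. c \<in> C}"
  shows "1 \<in> S" "\<And>c x. c \<in> C \<Longrightarrow> x \<in> S \<Longrightarrow> KK c * x \<in> S" "\<And>i x. x \<in> S \<Longrightarrow> A i * x \<in> S"
    "\<And>i x. x \<in> S \<Longrightarrow> B i * x \<in> S"
proof -
  have base: "KK c * prod_list (map A u) * prod_list (map B v) \<in> S" if "c \<in> C" for c u v
    unfolding S_def using that by (intro cvec.span_base) blast
  have ext: "f x \<in> S" if x: "x \<in> S" and lin: "clinear f"
    and f: "\<And>c u v. c \<in> C \<Longrightarrow> f (KK c * prod_list (map A u) * prod_list (map B v)) \<in> S" for f x
    using x unfolding S_def
  proof (induct x rule: cvec.span_induct_alt)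
    case base
    show ?case by (simp add: clin_0[OF lin] cvec.span_zero)
  next
    case (step k x y)
    then have "f x \<in> S" using f by blast
    with step show ?case
      by (simp add: clin_add[OF lin] clin_scale[OF lin] S_def cvec.span_add cvec.span_scale)
  qed
  show K: "KK c * x \<in> S" if c: "c \<in> C" and x: "x \<in> S" for c x
  proof (rule ext[OF x clinear_mult_right[OF clinear_id]])
    fix c' u v assume "c' \<in> C"
    with KK[OF c this] obtain c'' where "KK c * KK c' = KK c''" "c'' \<in> C" by blast
    then show "KK c * (KK c' * prod_list (map A u) * prod_list (map B v)) \<in> S"
      using base by (simp flip: mult.assoc)
  qed
  obtain c1 where c1: "c1 \<in> C" "KK c1 = 1" using one by auto
  show "1 \<in> S" using base[OF c1(1), of "[]" "[]"] c1(2) by simp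
  show A: "A i * x \<in> S" if x: "x \<in> S" for i x
  proof (rule ext[OF x clinear_mult_right[OF clinear_id]])
    fix c u v assume c: "c \<in> C"
    obtain k where "A i * KK c = k *\<^sub>C (KK c * A i)" using AK[OF c] by blast
    then have "A i * (KK c * prod_list (map A u) * prod_list (map B v)) =
        k *\<^sub>C (KK c * prod_list (map A (i # u)) * prod_list (map B v))"
      by (simp flip: mult.assoc)
    then show "A i * (KK c * prod_list (map A u) * prod_list (map B v)) \<in> S"
      using base[OF c, of "i # u" v] by (simp add: S_def cvec.span_scale)
  qed
  have KS: "y * x \<in> S" if "y \<in> cvec.span (KK ` C)" "x \<in> S" for x y
    using that(1)
  proof (induct y rule: cvec.span_induct_alt)
    case (step k z y)
    then have "z * x \<in> S" using K that(2) by blast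
    with step show ?case by (simp add: distrib_right S_def cvec.span_add cvec.span_scale)
  qed (simp add: S_def cvec.span_zero)
  \<comment> \<open>Moving B_i to the right through the A's leaves commutators in the span of the
    K's; they act on shorter products, which are already in the required order.\<close>
  have AB: "prod_list (map A u) * prod_list (map B v) \<in> S" for u v
    using base[OF c1(1), of u v] c1(2) by simp
  have B0: "B i * (prod_list (map A u) * prod_list (map B v)) \<in> S" for i u v
  proof (induct u)
    case Nil
    show ?case using AB[of "[]" "i # v"] by simp
  next
    case (Cons j u)
    have "B i * (prod_list (map A (j # u)) * prod_list (map B v)) =
        A j * (B i * (prod_list (map A u) * prod_list (map B v))) +
        (B i * A j - A j * B i) * (prod_list (map A u) * prod_list (map B v))"
      by (simp add: algebra_simps)
    also have "\<dots> \<in> S"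
      using A[OF Cons] KS[OF BA AB] by (simp add: S_def cvec.span_add)
    finally show ?case .
  qed
  show "B i * x \<in> S" if x: "x \<in> S" for i x
  proof (rule ext[OF x clinear_mult_right[OF clinear_id]])
    fix c u v assume c: "c \<in> C"
    obtain k where "B i * KK c = k *\<^sub>C (KK c * B i)" using BK[OF c] by blast
    then have "B i * (KK c * prod_list (map A u) * prod_list (map B v)) =
        k *\<^sub>C (KK c * (B i * (prod_list (map A u) * prod_list (map B v))))"
      by (simp add: mult.assoc[symmetric])
    then show "B i * (KK c * prod_list (map A u) * prod_list (map B v)) \<in> S"
      using K[OF c B0] by (simp add: S_def cvec.span_scale)
  qed
qed

section \<open>Commutation rules in the algebra and the triangular decomposition\<close>

context small_quantum_group
begin

lemma rel0: "r \<in> qg_relations ip \<alpha> d q L L' B \<Longrightarrow> eval (case_generator K E F) r = 0"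
  by (rule presented_by_rel[OF presentation])

lemmas eval_simps = clin_diff[OF clinear_eval] clin_scale[OF clinear_eval] eval_mult

lemma \<alpha>_in_L: "\<alpha> i \<in> L"
  using rt_in_L \<alpha>_rt by metis

lemma K_cls_mult: "\<phi> \<in> L \<Longrightarrow> \<psi> \<in> L \<Longrightarrow> K (cls L' \<phi>) * K (cls L' \<psi>) = K (cls L' (\<phi> + \<psi>))"
proof -
  assume *: "\<phi> \<in> L" "\<psi> \<in> L"
  have "gen (GenK (cls L' \<phi>)) * gen (GenK (cls L' \<psi>)) - gen (GenK (cls L' (\<phi> + \<psi>))) \<in> qg_relations ip \<alpha> d q L L' B"
    unfolding qg_relations_def Let_def using * by blast
  from rel0[OF this] show ?thesis by (simp add: eval_simps)
qed

lemma K_cls_0: "K (cls L' 0) = 1"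
proof -
  have "gen (GenK (cls L' 0)) - 1 \<in> qg_relations ip \<alpha> d q L L' B"
    unfolding qg_relations_def Let_def by blast
  from rel0[OF this] show ?thesis by (simp add: eval_simps)
qed

lemma K_mult: "c \<in> carrier Q \<Longrightarrow> c' \<in> carrier Q \<Longrightarrow> K c * K c' = K (c \<otimes>\<^bsub>Q\<^esub> c')"
  by (auto simp: carrier_Q K_cls_mult cls_mult simp del: mult_FactGroup)

lemma K_one: "K \<one>\<^bsub>Q\<^esub> = 1"
  using K_cls_0 by (simp add: cls_0 del: one_FactGroup)

lemma K_E': "c \<in> carrier Q \<Longrightarrow> K c * E i = \<chi> (rep c) i *\<^sub>C (E i * K c)"
  and K_F': "c \<in> carrier Q \<Longrightarrow> K c * F i = inverse (\<chi> (rep c) i) *\<^sub>C (F i * K c)"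
proof -
  assume "c \<in> carrier Q"
  then obtain \<phi> where \<phi>: "\<phi> \<in> L" "c = cls L' \<phi>" by (auto simp: carrier_Q)
  have inv: "K (cls L' (- \<phi>)) * K c = 1"
    using K_cls_mult[OF L_closed(3)[OF \<phi>(1)] \<phi>(1)] by (simp add: \<phi> K_cls_0)
  have "gen (GenK (cls L' \<phi>)) * gen (GenE i) * gen (GenK (cls L' (- \<phi>))) - q powi int_ip ip \<phi> (\<alpha> i) *\<^sub>C gen (GenE i)
      \<in> qg_relations ip \<alpha> d q L L' B"
    unfolding qg_relations_def Let_def using \<phi>(1) by blast
  from rel0[OF this] have "K c * E i * K (cls L' (- \<phi>)) = \<chi> (rep c) i *\<^sub>C E i"
    by (simp add: eval_simps \<phi> rep_power)
  then have "K c * E i * K (cls L' (- \<phi>)) * K c = \<chi> (rep c) i *\<^sub>C E i * K c" by simp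
  then show "K c * E i = \<chi> (rep c) i *\<^sub>C (E i * K c)" by (simp add: mult.assoc inv)
  have "gen (GenK (cls L' \<phi>)) * gen (GenF i) * gen (GenK (cls L' (- \<phi>))) - q powi (- int_ip ip \<phi> (\<alpha> i)) *\<^sub>C gen (GenF i)
      \<in> qg_relations ip \<alpha> d q L L' B"
    unfolding qg_relations_def Let_def using \<phi>(1) by blast
  from rel0[OF this] have "K c * F i * K (cls L' (- \<phi>)) = inverse (\<chi> (rep c) i) *\<^sub>C F i"
    by (simp add: eval_simps \<phi> rep_power power_int_minus)
  then have "K c * F i * K (cls L' (- \<phi>)) * K c = inverse (\<chi> (rep c) i) *\<^sub>C F i * K c" by simp
  then show "K c * F i = inverse (\<chi> (rep c) i) *\<^sub>C (F i * K c)" by (simp add: mult.assoc inv)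
qed

lemma K_eval_E:
  assumes "c \<in> carrier Q"
  shows "K c * eval E x = eval E (scale_word (\<chi> (rep c)) x) * K c"
proof (induction x rule: word_eqI_gen)
  case (4 i x)
  have "K c * (E i * eval E x) = \<chi> (rep c) i *\<^sub>C (E i * (K c * eval E x))"
    using K_E'[OF assms] by (simp flip: mult.assoc)
  with 4 show ?case by (simp add: eval_simps scale_word_mult scale_word_gen mult.assoc)
qed (intro clinear_intros clinear_comp[OF clinear_eval] clinear_eval | simp)+

lemma K_eval_F:
  assumes "c \<in> carrier Q"
  shows "K c * eval F x = eval F (scale_word (\<lambda>i. inverse (\<chi> (rep c) i)) x) * K c"
proof (induction x rule: word_eqI_gen)
  case (4 i x)
  have "K c * (F i * eval F x) = inverse (\<chi> (rep c) i) *\<^sub>C (F i * (K c * eval F x))"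
    using K_F'[OF assms] by (simp flip: mult.assoc)
  with 4 show ?case by (simp add: eval_simps scale_word_mult scale_word_gen mult.assoc)
qed (intro clinear_intros clinear_comp[OF clinear_eval] clinear_eval | simp)+

lemma E_F_commute: "E i * F j - F j * E i = (if i = j then cc i *\<^sub>C (K (cls L' (\<alpha> i)) - K (cls L' (- \<alpha> i))) else 0)"
proof -
  have "gen (GenE i) * gen (GenF j) - gen (GenF j) * gen (GenE i) -
      (if i = j then (1 / (q ^ d i - inverse (q ^ d i))) *\<^sub>C
        (gen (GenK (cls L' (\<alpha> i))) - gen (GenK (cls L' (- \<alpha> i)))) else 0) \<in> qg_relations ip \<alpha> d q L L' B"
    unfolding qg_relations_def Let_def by blast
  from rel0[OF this] show ?thesis by (cases "i = j") (simp_all add: eval_simps cc_def)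
qed

text \<open>The spanning half, in both orders: a subspace that contains 1 and is stable under left
  multiplication by the generators is everything.\<close>

lemma span_E_F_aux: "cvec.span {K c * prod_list (map F u) * prod_list (map E v) | c u v. c \<in> carrier Q} = UNIV"
    "cvec.span {K c * prod_list (map E u) * prod_list (map F v) | c u v. c \<in> carrier Q} = UNIV"
proof -
  interpret comm_group Q by (rule comm_group_Q)
  have one: "1 \<in> K ` carrier Q" using K_one one_closed by (metis imageI)
  have KK: "K c * K c' \<in> K ` carrier Q" if "c \<in> carrier Q" "c' \<in> carrier Q" for c c'
    unfolding K_mult[OF that] using that by (intro imageI m_closed)
  have EK: "\<exists>k. E i * K c = k *\<^sub>C (K c * E i)" if "c \<in> carrier Q" for c i
    by (rule exI[of _ "inverse (\<chi> (rep c) i)"]) (simp add: K_E'[OF that] \<chi>_nz)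
  have FK: "\<exists>k. F i * K c = k *\<^sub>C (K c * F i)" if "c \<in> carrier Q" for c i
    by (rule exI[of _ "\<chi> (rep c) i"]) (simp add: K_F'[OF that] \<chi>_nz)
  have sp: "cc i *\<^sub>C (K (cls L' (\<alpha> i)) - K (cls L' (- \<alpha> i))) \<in> cvec.span (K ` carrier Q)" for i
    using \<alpha>_in_L L_closed(3) by (intro cvec.span_scale cvec.span_diff cvec.span_base) (auto simp: carrier_Q)
  have EF: "E i * F j - F j * E i \<in> cvec.span (K ` carrier Q)" for i j
    unfolding E_F_commute using sp by (simp add: cvec.span_zero)
  have FE: "F i * E j - E j * F i \<in> cvec.span (K ` carrier Q)" for i j
    using cvec.span_neg[OF EF[of j i]] by simp
  have univ: "S = UNIV" if S: "cvec.subspace S" "1 \<in> S" "\<And>c x. c \<in> carrier Q \<Longrightarrow> x \<in> S \<Longrightarrow> K c * x \<in> S"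
    "\<And>i x. x \<in> S \<Longrightarrow> E i * x \<in> S" "\<And>i x. x \<in> S \<Longrightarrow> F i * x \<in> S" for S
  proof -
    have w: "prod_list (map (case_generator K E F) w) \<in> S" if "set w \<subseteq> qg_generators Q" for w
      using that
    proof (induct w)
      case (Cons x w)
      then show ?case using S(3-5) by (cases x) (auto simp: qg_generators_def)
    qed (simp add: S(2))
    have e: "eval (case_generator K E F) p \<in> S" if "p \<in> free_on (qg_generators Q)" for p
      unfolding eval_def linext_def using that
      by (intro cvec.subspace_sum S cvec.subspace_scale w) (auto simp: free_on_def)
    have "h \<in> S" for h
    proof -
      have "h \<in> eval (case_generator K E F) ` free_on (qg_generators Q)"
        using presentation by (simp add: presented_by_def)
      then show ?thesis by (rule imageE) (simp add: e)
    qed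
    then show ?thesis by (intro equalityI subsetI UNIV_I)
  qed
  note 1 = triangular_span_closed[of K "carrier Q" F E, OF one KK FK EK EF]
  show "cvec.span {K c * prod_list (map F u) * prod_list (map E v) | c u v. c \<in> carrier Q} = UNIV"
    by (rule univ[OF cvec.subspace_span 1(1,2,4,3)])
  note 2 = triangular_span_closed[of K "carrier Q" E F, OF one KK EK FK FE]
  show "cvec.span {K c * prod_list (map E u) * prod_list (map F v) | c u v. c \<in> carrier Q} = UNIV"
    by (rule univ[OF cvec.subspace_span 2(1,2,3,4)])
qed

lemma radical_eval:
  assumes "x \<in> radical B" shows "eval E x = 0" "eval F x = 0"
proof -
  have "eval (\<lambda>i. gen (GenE i)) x \<in> qg_relations ip \<alpha> d q L L' B"
    "eval (\<lambda>i. gen (GenF i)) x \<in> qg_relations ip \<alpha> d q L L' B"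
    unfolding qg_relations_def Let_def using assms by blast+
  from this[THEN rel0] show "eval E x = 0" "eval F x = 0" by (simp_all add: eval_eval_gen)
qed

lemma functional_F:
  obtains \<Phi> where "clinear \<Phi>" "\<And>c x. c \<in> carrier Q \<Longrightarrow> \<Phi> (K c * eval F x) = g c * B x a"
proof -
  obtain \<Phi> where \<Phi>: "clinear \<Phi>" "\<And>c x y. c \<in> carrier Q \<Longrightarrow> \<Phi> (K c * eval F x * eval E y) = g c * B x a * B y 1"
    by (rule triangular_functional[of g a 1]) (rule that; assumption)
  show thesis by (rule that[OF \<Phi>(1)]) (use \<Phi>(2)[of _ _ 1] in \<open>simp add: B_1\<close>)
qed

lemma functional_E:
  obtains \<Phi> where "clinear \<Phi>" "\<And>c x. c \<in> carrier Q \<Longrightarrow> \<Phi> (K c * eval E x) = g c * B x a"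
proof -
  obtain \<Phi> where \<Phi>: "clinear \<Phi>" "\<And>c x y. c \<in> carrier Q \<Longrightarrow> \<Phi> (K c * eval F x * eval E y) = g c * B x 1 * B y a"
    by (rule triangular_functional[of g 1 a]) (rule that; assumption)
  show thesis by (rule that[OF \<Phi>(1)]) (use \<Phi>(2)[of _ 1] in \<open>simp add: B_1\<close>)
qed

text \<open>The subspaces K_c u^- for different c meet only in 0, as functionals that vanish on one
  class show.\<close>

lemma K_eval_F_distinct:
  assumes c: "c \<in> carrier Q" "c' \<in> carrier Q" "c \<noteq> c'" and eq: "K c * eval F x = K c' * eval F y"
  shows "eval F x = 0"
proof -
  have "B x a = 0" for a
  proof -
    obtain \<Phi> where "clinear \<Phi>" "\<And>c x. c \<in> carrier Q \<Longrightarrow> \<Phi> (K c * eval F x) = (if c = c' then 0 else 1) * B x a"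
      by (rule functional_F) (rule that; assumption)
    from this(2)[OF c(1), of x] this(2)[OF c(2), of y] show ?thesis by (simp add: c eq)
  qed
  then show ?thesis by (intro radical_eval) (simp add: radical_def)
qed

lemma K_eval_E_distinct:
  assumes c: "c \<in> carrier Q" "c' \<in> carrier Q" "c \<noteq> c'" and eq: "K c * eval E x = K c' * eval E y"
  shows "eval E x = 0"
proof -
  have "B x a = 0" for a
  proof -
    obtain \<Phi> where "clinear \<Phi>" "\<And>c x. c \<in> carrier Q \<Longrightarrow> \<Phi> (K c * eval E x) = (if c = c' then 0 else 1) * B x a"
      by (rule functional_E) (rule that; assumption)
    from this(2)[OF c(1), of x] this(2)[OF c(2), of y] show ?thesis by (simp add: c eq)
  qed
  then show ?thesis by (intro radical_eval) (simp add: radical_def)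
qed

text \<open>Together with the functionals, the radical relations identify u^+ with the free algebra
  modulo the radical.\<close>

lemma eval_E_eq_0_iff: "eval E x = 0 \<longleftrightarrow> x \<in> radical B"
proof
  assume 0: "eval E x = 0"
  have "B x a = 0" for a
  proof -
    obtain \<Phi> where \<Phi>: "clinear \<Phi>" "\<And>c x. c \<in> carrier Q \<Longrightarrow> \<Phi> (K c * eval E x) = 1 * B x a"
      by (rule functional_E) (rule that; assumption)
    have "cls L' 0 \<in> carrier Q" using L_closed(1) by (simp add: carrier_Q)
    from \<Phi>(2)[OF this, of x] show ?thesis by (simp add: 0 clin_0[OF \<Phi>(1)])
  qed
  then show "x \<in> radical B" by (simp add: radical_def)
qed (rule radical_eval)

end

section \<open>Finite families of vectors\<close>

text \<open>Stated for families, so that a repeated vector counts as a dependency; the image set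
  alone would not notice it.\<close>

definition indep_family :: "'p set \<Rightarrow> ('p \<Rightarrow> 'v::complex_vector) \<Rightarrow> bool" where
  "indep_family P e \<longleftrightarrow> (\<forall>a. (\<Sum>p\<in>P. a p *\<^sub>C e p) = 0 \<longrightarrow> (\<forall>p\<in>P. a p = 0))"

lemma indep_familyD: "indep_family P e \<Longrightarrow> (\<Sum>p\<in>P. a p *\<^sub>C e p) = 0 \<Longrightarrow> p \<in> P \<Longrightarrow> a p = 0"
  by (simp add: indep_family_def)

lemma indep_family_iff:
  assumes fin: "finite P"
  shows "indep_family P e \<longleftrightarrow> inj_on e P \<and> cvec.independent (e ` P)"
proof
  assume ind: "indep_family P e"
  have inj: "inj_on e P"
  proof (rule inj_onI, rule ccontr)
    fix p p' assume p: "p \<in> P" "p' \<in> P" "e p = e p'" "p \<noteq> p'"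
    define a :: "'a \<Rightarrow> complex" where "a x = (if x = p then 1 else 0) - (if x = p' then 1 else 0)" for x
    have "(\<Sum>x\<in>P. a x *\<^sub>C e x) = (\<Sum>x\<in>P. (if x = p then e p else 0)) - (\<Sum>x\<in>P. (if x = p' then e p' else 0))"
      unfolding sum_subtractf[symmetric] by (rule sum.cong) (auto simp: a_def cvec.scale_left_diff_distrib)
    also have "\<dots> = 0" using p fin by simp
    finally have "a p = 0" using ind p(1) by (auto simp: indep_family_def)
    then show False using p(4) by (simp add: a_def)
  qed
  moreover have "cvec.independent (e ` P)"
  proof (rule cvec.independent_if_scalars_zero)
    fix f x assume 0: "(\<Sum>x\<in>e ` P. f x *\<^sub>C x) = 0" and x: "x \<in> e ` P"
    have "(\<Sum>p\<in>P. f (e p) *\<^sub>C e p) = 0" using 0 by (simp add: sum.reindex[OF inj])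
    with ind x show "f x = 0" by (auto simp: indep_family_def)
  qed (use fin in simp)
  ultimately show "inj_on e P \<and> cvec.independent (e ` P)" ..
next
  assume *: "inj_on e P \<and> cvec.independent (e ` P)"
  show "indep_family P e"
    unfolding indep_family_def
  proof (intro allI impI ballI)
    fix a p assume 0: "(\<Sum>p\<in>P. a p *\<^sub>C e p) = 0" and p: "p \<in> P"
    have "(\<Sum>x\<in>e ` P. a (inv_into P e x) *\<^sub>C x) = 0"
      using 0 * by (simp add: sum.reindex)
    then have "a (inv_into P e (e p)) = 0"
      using cvec.independentD[of "e ` P" "e ` P" "\<lambda>x. a (inv_into P e x)" "e p"] * p fin by auto
    then show "a p = 0" using * p by simp
  qed
qed

lemma indep_family_functional:
  assumes "finite P" "indep_family P e"
  obtains \<phi> :: "'v::complex_vector \<Rightarrow> complex" where "clinear \<phi>" "\<And>p. p \<in> P \<Longrightarrow> \<phi> (e p) = a p"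
proof -
  from assms have inj: "inj_on e P" and ind: "cvec.independent (e ` P)"
    by (simp_all add: indep_family_iff)
  obtain \<phi> where "clinear \<phi>" "\<forall>x\<in>e ` P. \<phi> x = a (inv_into P e x)"
    using cvec_pair.linear_independent_extend[OF ind, of "\<lambda>x. a (inv_into P e x)"] by blast
  then show thesis using inj by (intro that[of \<phi>]) simp_all
qed

lemma functional_separates:
  assumes "h \<notin> cvec.span S"
  obtains \<phi> :: "'v::complex_vector \<Rightarrow> complex" where "clinear \<phi>" "\<And>x. x \<in> S \<Longrightarrow> \<phi> x = 0" "\<phi> h = 1"
proof -
  obtain W where W: "W \<subseteq> S" "cvec.independent W" "S \<subseteq> cvec.span W"
    by (rule cvec.maximal_independent_subset)
  have h: "h \<notin> cvec.span W" using assms cvec.span_mono[OF W(1)] by blast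
  then have "cvec.independent (insert h W)" using W(2) by (simp add: cvec.independent_insert)
  from cvec_pair.linear_independent_extend[OF this, of "\<lambda>x. if x = h then 1 else 0"]
  obtain \<phi> :: "'v \<Rightarrow> complex" where \<phi>: "clinear \<phi>" "\<forall>x\<in>insert h W. \<phi> x = (if x = h then 1 else 0)" by blast
  have *: "\<phi> x = 0" if "x \<in> W" for x using \<phi>(2) that h cvec.span_base[of x W] by auto
  have "\<phi> x = 0" if "x \<in> cvec.span W" for x
    using that by (induct x rule: cvec.span_induct_alt) (simp_all add: * clin_0[OF \<phi>(1)] clin_add[OF \<phi>(1)] clin_scale[OF \<phi>(1)])
  with \<phi> W(3) show thesis by (intro that[of \<phi>]) auto
qed

lemma span_image_finite:
  assumes "finite P" "h \<in> cvec.span (e ` P)"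
  obtains a where "h = (\<Sum>p\<in>P. a p *\<^sub>C e p)"
proof -
  have "\<exists>a. h = (\<Sum>p\<in>P. a p *\<^sub>C e p)"
    using assms(2)
  proof (induct h rule: cvec.span_induct_alt)
    case base
    show ?case by (rule exI[of _ "\<lambda>_. 0"]) simp
  next
    case (step c x y)
    then obtain p a where p: "p \<in> P" "x = e p" and a: "y = (\<Sum>p\<in>P. a p *\<^sub>C e p)" by blast
    have "c *\<^sub>C x = (\<Sum>p'\<in>P. (if p' = p then c else 0) *\<^sub>C e p')"
      using p assms(1) by (simp add: if_distrib[of "\<lambda>c. c *\<^sub>C _"] cong: if_cong)
    with a have "c *\<^sub>C x + y = (\<Sum>p'\<in>P. ((if p' = p then c else 0) + a p') *\<^sub>C e p')"
      by (simp add: scaleC_add_left sum.distrib)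
    then show ?case by (rule exI[of _ "\<lambda>p'. (if p' = p then c else 0) + a p'"])
  qed
  then show thesis using that by (elim exE)
qed

lemma sum_in_span: "(\<Sum>p\<in>P. a p *\<^sub>C e p) \<in> cvec.span (e ` P)"
  by (intro cvec.span_sum cvec.span_scale cvec.span_base imageI)

text \<open>Dimension count: a spanning family with as many members as an independent one can afford
  neither a repetition nor a dependency.\<close>

lemma spanning_family_indep:
  fixes X Y :: "'p \<Rightarrow> 'v::complex_vector"
  assumes fin: "finite P" and Y: "indep_family P Y" and X: "cvec.span (X ` P) = UNIV"
  shows "indep_family P X"
proof -
  have Y': "inj_on Y P" "cvec.independent (Y ` P)" using Y fin by (simp_all add: indep_family_iff)
  obtain W where W: "W \<subseteq> X ` P" "cvec.independent W" "X ` P \<subseteq> cvec.span W"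
    by (rule cvec.maximal_independent_subset)
  have "cvec.span (X ` P) \<subseteq> cvec.span W"
    using cvec.span_minimal[OF W(3) cvec.subspace_span] .
  then have W_span: "cvec.span W = UNIV" using X by auto
  have fW: "finite W" using W(1) fin by (rule finite_subset[OF _ finite_imageI])
  have "card P = card (Y ` P)" using Y'(1) by (simp add: card_image)
  also have "\<dots> \<le> card W"
    using cvec.independent_span_bound[OF fW Y'(2)] W_span by simp
  finally have le: "card P \<le> card W" .
  have "card W \<le> card (X ` P)" using W(1) fin by (intro card_mono) auto
  with le card_image_le[OF fin, of X] have eq: "card (X ` P) = card P" "card W = card (X ` P)" by linarith+
  then have "W = X ` P" using W(1) fin by (intro card_subset_eq) auto
  with W(2) eq_card_imp_inj_on[OF fin eq(1)] show ?thesis using fin by (simp add: indep_family_iff)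
qed

text \<open>For the converse, the columns are realized in the free vector space on the index type. A
  trivial kernel makes them independent, hence spanning by dimension, and the coordinates of the
  unit vectors form a right inverse.\<close>

lemma invertible_on_iff:
  assumes fin: "finite I"
  shows "invertible_on I m \<longleftrightarrow>
    (\<forall>v. (\<forall>i\<in>I. (\<Sum>j\<in>I. m i j * v j) = 0) \<longrightarrow> (\<forall>j\<in>I. v j = 0))" (is "_ \<longleftrightarrow> ?inj")
proof
  assume "invertible_on I m"
  then obtain m' where m': "\<And>i j. i \<in> I \<Longrightarrow> j \<in> I \<Longrightarrow> (\<Sum>k\<in>I. m' i k * m k j) = (if i = j then 1 else 0)"
    unfolding invertible_on_def by blast
  show ?inj
  proof (intro allI impI ballI)
    fix v j assume v: "\<forall>i\<in>I. (\<Sum>j\<in>I. m i j * v j) = 0" and j: "j \<in> I"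
    have "0 = (\<Sum>k\<in>I. m' j k * (\<Sum>i\<in>I. m k i * v i))" using v by simp
    also have "\<dots> = (\<Sum>i\<in>I. (\<Sum>k\<in>I. m' j k * m k i) * v i)"
      unfolding sum_distrib_left sum_distrib_right by (subst sum.swap) (simp add: mult.assoc)
    also have "\<dots> = (\<Sum>i\<in>I. (if j = i then v i else 0))"
      by (intro sum.cong refl) (use m' j in auto)
    also have "\<dots> = v j" using j fin by simp
    finally show "v j = 0" by simp
  qed
next
  assume inj: ?inj
  let ?s = "\<lambda>i. Poly_Mapping.single i (1::complex)"
  define col where "col j = (\<Sum>i\<in>I. m i j *\<^sub>C ?s i)" for j
  have lookup: "Poly_Mapping.lookup (\<Sum>i\<in>I. a i *\<^sub>C ?s i) k = a k" if "k \<in> I" for a k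
    using that fin
    by (simp add: clin_sum[OF clinear_lookup] lookup_single when_def
        if_distrib[of "\<lambda>x. x * _"] if_distrib[of "\<lambda>x. _ * x"] cong: if_cong)
  have comb: "(\<Sum>j\<in>I. v j *\<^sub>C col j) = (\<Sum>i\<in>I. (\<Sum>j\<in>I. m i j * v j) *\<^sub>C ?s i)" for v
    unfolding col_def cvec.scale_sum_right
    by (subst sum.swap) (simp del: scaleC_single add: cvec.scale_sum_left mult.commute)
  have indep: "indep_family I col"
    unfolding indep_family_def
  proof (intro allI impI)
    fix v assume 0: "(\<Sum>j\<in>I. v j *\<^sub>C col j) = 0"
    have "(\<Sum>j\<in>I. m i j * v j) = 0" if "i \<in> I" for i
      using lookup[OF that, of "\<lambda>i. \<Sum>j\<in>I. m i j * v j"] by (simp only: 0[unfolded comb] lookup_zero)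
    then show "\<forall>j\<in>I. v j = 0" using inj by blast
  qed
  then have col: "inj_on col I" "cvec.independent (col ` I)" using fin by (simp_all add: indep_family_iff)
  have sp: "?s j \<in> cvec.span (col ` I)" if j: "j \<in> I" for j
  proof (rule ccontr)
    assume n: "?s j \<notin> cvec.span (col ` I)"
    then have ind: "cvec.independent (insert (?s j) (col ` I))"
      using col(2) by (simp add: cvec.independent_insert)
    have "insert (?s j) (col ` I) \<subseteq> cvec.span (?s ` I)"
      using j cvec.span_base[OF imageI[OF j, of ?s]] sum_in_span[of _ ?s I]
      unfolding col_def by (simp only: insert_subset image_subset_iff simp_thms ball_simps) simp
    with cvec.independent_span_bound[OF _ ind, of "?s ` I"] fin
    have "card (insert (?s j) (col ` I)) \<le> card (?s ` I)" by auto
    also have "\<dots> \<le> card I" by (rule card_image_le[OF fin])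
    finally have "card (insert (?s j) (col ` I)) \<le> card (col ` I)" using col(1) by (simp add: card_image)
    moreover have "?s j \<notin> col ` I" using n cvec.span_base by blast
    ultimately show False using fin by simp
  qed
  define m' where "m' k j = (SOME a. ?s j = (\<Sum>k\<in>I. a k *\<^sub>C col k)) k" for k j
  have m': "?s j = (\<Sum>k\<in>I. m' k j *\<^sub>C col k)" if j: "j \<in> I" for j
  proof -
    obtain a where "?s j = (\<Sum>k\<in>I. a k *\<^sub>C col k)" by (rule span_image_finite[OF fin sp[OF j]])
    then show ?thesis unfolding m'_def by (rule someI[where P = "\<lambda>a. ?s j = (\<Sum>k\<in>I. a k *\<^sub>C col k)"])
  qed
  have right: "(\<Sum>k\<in>I. m i k * m' k j) = (if i = j then 1 else 0)" if "i \<in> I" "j \<in> I" for i j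
  proof -
    have "Poly_Mapping.lookup (?s j) i = (\<Sum>k\<in>I. m i k * m' k j)"
      unfolding m'[OF that(2)] comb by (rule lookup[OF that(1)])
    then show ?thesis by (cases "i = j") (simp_all add: lookup_single_not_eq)
  qed
  \<comment> \<open>Since m m' = 1, the columns of m' m - 1 are killed by m, so they vanish.\<close>
  have left: "(\<Sum>k\<in>I. m' i k * m k j) = (if i = j then 1 else 0)" if i: "i \<in> I" and j: "j \<in> I" for i j
  proof -
    define v where "v i = (\<Sum>k\<in>I. m' i k * m k j) - (if i = j then 1 else 0)" for i
    have "(\<Sum>k\<in>I. m i k * v k) = 0" if i: "i \<in> I" for i
    proof -
      have "(\<Sum>k\<in>I. m i k * v k) = (\<Sum>k\<in>I. m i k * (\<Sum>k'\<in>I. m' k k' * m k' j)) - (\<Sum>k\<in>I. if k = j then m i j else 0)"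
        unfolding sum_subtractf[symmetric] by (rule sum.cong) (auto simp: v_def algebra_simps)
      also have "(\<Sum>k\<in>I. m i k * (\<Sum>k'\<in>I. m' k k' * m k' j)) = (\<Sum>k'\<in>I. (\<Sum>k\<in>I. m i k * m' k k') * m k' j)"
        unfolding sum_distrib_left sum_distrib_right by (subst sum.swap) (simp add: mult.assoc)
      also have "\<dots> = (\<Sum>k'\<in>I. if k' = i then m i j else 0)"
        by (intro sum.cong refl) (use right i in auto)
      finally show ?thesis using i j fin by simp
    qed
    then have "v i = 0" using inj[THEN spec, of v] i by simp
    then show ?thesis by (simp add: v_def)
  qed
  show "invertible_on I m"
    unfolding invertible_on_def using left right by (intro exI[of _ m']) simp
qed

lemma right_slice_bijective:
  fixes X Y :: "'k \<times> 'r \<Rightarrow> 'h::complex_algebra_1"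
  assumes fin: "finite A" "finite S" and X: "indep_family (A \<times> S) X" "cvec.span (X ` (A \<times> S)) = UNIV"
    and Y: "indep_family (A \<times> S) Y" "cvec.span (Y ` (A \<times> S)) = UNIV"
    and M: "M = (\<Sum>r\<in>S. \<Sum>\<mu>\<in>A. \<Sum>\<nu>\<in>A. m \<mu> \<nu> *\<^sub>C (X (\<mu>, r) \<otimes>\<^sub>C Y (\<nu>, r)))"
    and inv: "invertible_on A m"
  shows "bij_betw (\<lambda>\<phi>. right_slice \<phi> M) {\<phi> :: 'h \<Rightarrow> complex. clinear \<phi>} UNIV"
proof -
  have slice: "right_slice \<phi> M = (\<Sum>(\<mu>, r)\<in>A \<times> S. (\<Sum>\<nu>\<in>A. m \<mu> \<nu> * \<phi> (Y (\<nu>, r))) *\<^sub>C X (\<mu>, r))"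
    if \<phi>: "clinear \<phi>" for \<phi>
  proof -
    have "right_slice \<phi> M = (\<Sum>r\<in>S. \<Sum>\<mu>\<in>A. (\<Sum>\<nu>\<in>A. m \<mu> \<nu> * \<phi> (Y (\<nu>, r))) *\<^sub>C X (\<mu>, r))"
      unfolding M by (simp add: clin_sum[OF clinear_right_slice[OF \<phi>]] clin_scale[OF clinear_right_slice[OF \<phi>]]
          right_slice_tensor[OF \<phi>] cvec.scale_sum_left)
    also have "\<dots> = (\<Sum>(\<mu>, r)\<in>A \<times> S. (\<Sum>\<nu>\<in>A. m \<mu> \<nu> * \<phi> (Y (\<nu>, r))) *\<^sub>C X (\<mu>, r))"
      by (subst sum.swap) (simp add: sum.cartesian_product)
    finally show ?thesis .
  qed
  have finS: "finite (A \<times> S)" using fin by simp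
  obtain m' where m': "\<And>i j. i \<in> A \<Longrightarrow> j \<in> A \<Longrightarrow> (\<Sum>k\<in>A. m i k * m' k j) = (if i = j then 1 else 0)"
    using inv unfolding invertible_on_def by blast
  show ?thesis
    unfolding bij_betw_def
  proof
    show "inj_on (\<lambda>\<phi>. right_slice \<phi> M) {\<phi> :: 'h \<Rightarrow> complex. clinear \<phi>}"
    proof (rule inj_onI, unfold mem_Collect_eq)
      fix \<phi> \<phi>' :: "'h \<Rightarrow> complex"
      assume \<phi>: "clinear \<phi>" "clinear \<phi>'" and eq: "right_slice \<phi> M = right_slice \<phi>' M"
      define \<psi> where "\<psi> x = \<phi> x - \<phi>' x" for x
      have lin: "clinear \<psi>" unfolding \<psi>_def by (intro clinear_minus \<phi>)
      have "right_slice \<phi> M - right_slice \<phi>' M = 0" using eq by simp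
      then have "(\<Sum>p\<in>A \<times> S. (\<Sum>\<nu>\<in>A. m (fst p) \<nu> * \<psi> (Y (\<nu>, snd p))) *\<^sub>C X p) = 0"
        unfolding slice[OF \<phi>(1)] slice[OF \<phi>(2)] sum_subtractf[symmetric]
        by (simp add: \<psi>_def split_def right_diff_distrib sum_subtractf cvec.scale_left_diff_distrib)
      from indep_familyD[OF X(1) this]
      have "\<forall>p\<in>A \<times> S. (\<Sum>\<nu>\<in>A. m (fst p) \<nu> * \<psi> (Y (\<nu>, snd p))) = 0" by blast
      then have "\<forall>\<mu>\<in>A. (\<Sum>\<nu>\<in>A. m \<mu> \<nu> * \<psi> (Y (\<nu>, r))) = 0" if "r \<in> S" for r
        using that by auto
      then have 0: "\<forall>\<nu>\<in>A. \<psi> (Y (\<nu>, r)) = 0" if "r \<in> S" for r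
        using that inv[unfolded invertible_on_iff[OF fin(1)], THEN spec, of "\<lambda>\<nu>. \<psi> (Y (\<nu>, r))"] by simp
      have "\<psi> x = 0" for x
      proof -
        have "x \<in> cvec.span (Y ` (A \<times> S))" using Y(2) by simp
        then show ?thesis
          by (induct x rule: cvec.span_induct_alt)
            (use 0 in \<open>auto simp: clin_0[OF lin] clin_add[OF lin] clin_scale[OF lin]\<close>)
      qed
      then show "\<phi> = \<phi>'" by (auto simp: \<psi>_def)
    qed
    have ex: "\<exists>\<phi>. clinear \<phi> \<and> right_slice \<phi> M = h" for h
    proof -
      obtain a where h: "h = (\<Sum>p\<in>A \<times> S. a p *\<^sub>C X p)"
        using span_image_finite[OF finS, of h X] X(2) by auto
      \<comment> \<open>On the basis Y the functional takes the values that the inverse matrix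
        assigns to the coordinates of h in the basis X, block by block.\<close>
      obtain \<phi> :: "'h \<Rightarrow> complex" where \<phi>: "clinear \<phi>"
        "\<And>p. p \<in> A \<times> S \<Longrightarrow> \<phi> (Y p) = (\<Sum>\<mu>\<in>A. m' (fst p) \<mu> * a (\<mu>, snd p))"
        by (rule indep_family_functional[OF finS Y(1), of "\<lambda>p. \<Sum>\<mu>\<in>A. m' (fst p) \<mu> * a (\<mu>, snd p)"]) (rule that; assumption)
      have "(\<Sum>\<nu>\<in>A. m \<mu> \<nu> * \<phi> (Y (\<nu>, r))) = a (\<mu>, r)" if "\<mu> \<in> A" "r \<in> S" for \<mu> r
      proof -
        have "(\<Sum>\<nu>\<in>A. m \<mu> \<nu> * \<phi> (Y (\<nu>, r))) = (\<Sum>\<nu>\<in>A. m \<mu> \<nu> * (\<Sum>\<mu>'\<in>A. m' \<nu> \<mu>' * a (\<mu>', r)))"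
          using that \<phi>(2) by (intro sum.cong) auto
        also have "\<dots> = (\<Sum>\<mu>'\<in>A. (\<Sum>\<nu>\<in>A. m \<mu> \<nu> * m' \<nu> \<mu>') * a (\<mu>', r))"
          unfolding sum_distrib_left sum_distrib_right by (subst sum.swap) (simp add: mult.assoc)
        also have "\<dots> = (\<Sum>\<mu>'\<in>A. if \<mu>' = \<mu> then a (\<mu>, r) else 0)"
          by (intro sum.cong refl) (use m' that in auto)
        finally show ?thesis using that fin by simp
      qed
      then have "right_slice \<phi> M = h"
        unfolding slice[OF \<phi>(1)] h by (intro sum.cong) auto
      with \<phi>(1) show ?thesis by blast
    qed
    show "(\<lambda>\<phi>. right_slice \<phi> M) ` {\<phi> :: 'h \<Rightarrow> complex. clinear \<phi>} = UNIV"
    proof (intro equalityI subsetI UNIV_I)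
      fix h
      obtain \<phi> where "clinear \<phi>" "right_slice \<phi> M = h" using ex[of h] by (elim exE conjE)
      then show "h \<in> (\<lambda>\<phi>. right_slice \<phi> M) ` {\<phi> :: 'h \<Rightarrow> complex. clinear \<phi>}"
        by (intro image_eqI[of _ _ \<phi>]) simp_all
    qed
  qed
qed

section \<open>The quasi R-matrix\<close>

lemma tensor_of_mono: "U \<subseteq> U' \<Longrightarrow> V \<subseteq> V' \<Longrightarrow> tensor_of U V \<subseteq> tensor_of U' V'"
  unfolding tensor_of_def by (rule cvec.span_mono) blast

lemma subspace_range:
  assumes "clinear f" shows "cvec.subspace (range f)"
  using clin_0[OF assms, symmetric] clin_add[OF assms, symmetric] clin_scale[OF assms, symmetric]
  by (intro cvec.subspaceI) auto

lemma graded_piece_eval: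
  "graded_piece \<alpha> X \<beta> = eval X ` cvec.span {word w | w. weight \<alpha> w = \<beta>}"
proof -
  have "eval X ` {word w | w. weight \<alpha> w = \<beta>} = {prod_list (map X w) | w. weight \<alpha> w = \<beta>}"
    by (auto simp: eval_word[symmetric])
  with cvec_pair.linear_span_image[OF clinear_eval, of X "{word w | w. weight \<alpha> w = \<beta>}"]
  show ?thesis by (simp add: graded_piece_def)
qed

lemma graded_piece_subset: "graded_piece \<alpha> X \<beta> \<subseteq> range (eval X)"
  by (auto simp: graded_piece_eval)

lemma subspace_graded_piece: "cvec.subspace (graded_piece \<alpha> X \<beta>)"
  unfolding graded_piece_def by (rule cvec.subspace_span)

context small_quantum_group
begin

lemma B_span_word:
  assumes "x \<in> cvec.span {word w | w. weight \<alpha> w = \<beta>}" "weight \<alpha> z \<noteq> \<beta>"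
  shows "B x (word z) = 0"
  using assms(1)
proof (induct x rule: cvec.span_induct_alt)
  case base
  show ?case by (rule clin_0[OF B_lin(2)[OF clinear_id]])
next
  case (step c x y)
  then obtain w where w: "x = word w" "weight \<alpha> w = \<beta>" by blast
  have "B (word w) (word z) = 0"
  proof (rule ccontr)
    assume "B (word w) (word z) \<noteq> 0"
    then have "mset w = mset z" by (rule B_word_orthogonal)
    then have "mset (map \<alpha> w) = mset (map \<alpha> z)" by simp
    then have "weight \<alpha> w = weight \<alpha> z"
      unfolding weight_def by (metis sum_mset_sum_list)
    with w assms(2) show False by simp
  qed
  with step w show ?case
    by (simp add: clin_add[OF B_lin(2)[OF clinear_id]] clin_scale[OF B_lin(2)[OF clinear_id]])
qed

lemma B_span_word_1:
  "x \<in> cvec.span {word w | w. weight \<alpha> w = \<beta>} \<Longrightarrow> \<beta> \<noteq> 0 \<Longrightarrow> B x 1 = 0"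
  using B_span_word[of x \<beta> "[]"] by (simp add: word_Nil weight_def)

text \<open>The sum of the weight spaces of u^+ is direct: distinct weights are orthogonal for
  \<open>B\<close>, so pairing with a word isolates one summand, and \<open>B\<close> is
  nondegenerate on u^+.\<close>

lemma graded_pieces_independent:
  assumes D: "finite D" and v: "\<And>\<beta>. \<beta> \<in> D \<Longrightarrow> v \<beta> \<in> graded_piece \<alpha> E \<beta>"
    and 0: "(\<Sum>\<beta>\<in>D. v \<beta>) = 0" and \<beta>: "\<beta> \<in> D"
  shows "v \<beta> = 0"
proof -
  have "\<forall>\<beta>\<in>D. \<exists>x. v \<beta> = eval E x \<and> x \<in> cvec.span {word w | w. weight \<alpha> w = \<beta>}"
    using v by (auto simp: graded_piece_eval)
  from bchoice[OF this] obtain x where x: "\<forall>\<beta>\<in>D. v \<beta> = eval E (x \<beta>) \<and> x \<beta> \<in> cvec.span {word w | w. weight \<alpha> w = \<beta>}" ..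
  have "eval E (\<Sum>\<beta>\<in>D. x \<beta>) = (\<Sum>\<beta>\<in>D. v \<beta>)"
    using x by (simp add: clin_sum[OF clinear_eval])
  then have "(\<Sum>\<beta>\<in>D. x \<beta>) \<in> radical B" using 0 eval_E_eq_0_iff by simp
  then have sum: "(\<Sum>\<beta>\<in>D. B (x \<beta>) z) = 0" for z
    using radicalD clin_sum[OF B_lin(2)[OF clinear_id]] by metis
  have "B (x \<beta>) (word z) = 0" for z
  proof (cases "weight \<alpha> z = \<beta>")
    case True
    have "(\<Sum>\<beta>'\<in>D. B (x \<beta>') (word z)) = (\<Sum>\<beta>'\<in>D. if \<beta>' = \<beta> then B (x \<beta>) (word z) else 0)"
      using True x B_span_word by (intro sum.cong) auto
    with sum show ?thesis using D \<beta> by simp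
  next
    case False
    then show ?thesis using x \<beta> B_span_word by blast
  qed
  then have "B (x \<beta>) z = 0" for z
    by (intro word_linear_eqI[of "B (x \<beta>)" "\<lambda>_. 0" z]) (auto intro: B_lin(1)[OF clinear_id] clinear_const_0)
  then have "x \<beta> \<in> radical B" by (simp add: radical_def)
  then show ?thesis using x \<beta> radical_eval by simp
qed

text \<open>A single functional that reads off the degree-zero part on u^- and on u^+.\<close>

lemma augmentation:
  obtains \<Phi> :: "'h \<Rightarrow> complex" where "clinear \<Phi>" "\<And>x. \<Phi> (eval F x) = B x 1" "\<And>x. \<Phi> (eval E x) = B x 1"
proof -
  interpret comm_group Q by (rule comm_group_Q)
  obtain \<Phi> where \<Phi>: "clinear \<Phi>" "\<And>c x y. c \<in> carrier Q \<Longrightarrow> \<Phi> (K c * eval F x * eval E y) = 1 * B x 1 * B y 1"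
    by (rule triangular_functional[of "\<lambda>_. 1" 1 1]) (rule that; assumption)
  show thesis
    by (rule that[OF \<Phi>(1)])
      (use \<Phi>(2)[OF one_closed, of _ 1] \<Phi>(2)[OF one_closed, of 1] in \<open>simp_all add: K_one B_1 del: one_FactGroup\<close>)
qed

end

locale quasi_R_setting = small_quantum_group br \<hh> \<kappa> ip \<alpha> \<omega> d l q L L' B K E F \<Delta> \<epsilon> S
  for br :: "'g::complex_vector \<Rightarrow> 'g \<Rightarrow> 'g" and \<hh> \<kappa> ip
    and \<alpha> :: "'i::finite \<Rightarrow> 'g \<Rightarrow> complex" and \<omega> d l q L L' B
    and K :: "('g \<Rightarrow> complex) set \<Rightarrow> 'h::complex_algebra_1" and E F \<Delta> \<epsilon> S +
  fixes \<Delta>b :: "'h \<Rightarrow> ('h, 'h) tensor" and \<Theta> :: "('h, 'h) tensor"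
  assumes bar: "bar_coproduct \<alpha> L L' K E F \<Delta>b" and quasi: "quasi_R_matrix \<alpha> E F \<Delta> \<Delta>b \<Theta>"
begin

lemma intertwine: "\<Delta>b x * \<Theta> = \<Theta> * \<Delta> x"
  using quasi by (simp add: quasi_R_matrix_def)

lemma \<Theta>_decomposition:
  obtains T where "finite {\<beta> \<in> nat_span \<alpha>. T \<beta> \<noteq> 0}"
    "\<And>\<beta>. \<beta> \<in> nat_span \<alpha> \<Longrightarrow> T \<beta> \<in> tensor_of (graded_piece \<alpha> F \<beta>) (graded_piece \<alpha> E \<beta>)"
    "T 0 = 1 \<otimes>\<^sub>C 1" "\<Theta> = (\<Sum>\<beta>\<in>{\<beta> \<in> nat_span \<alpha>. T \<beta> \<noteq> 0}. T \<beta>)"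
  using quasi unfolding quasi_R_matrix_def by blast

lemma nat_span_0: "0 \<in> nat_span \<alpha>"
  unfolding nat_span_def by (auto intro!: exI[of _ "\<lambda>_. 0"])

lemma \<Theta>_in: "\<Theta> \<in> tensor_of (range (eval F)) (range (eval E))"
proof -
  obtain T where T: "\<And>\<beta>. \<beta> \<in> nat_span \<alpha> \<Longrightarrow> T \<beta> \<in> tensor_of (graded_piece \<alpha> F \<beta>) (graded_piece \<alpha> E \<beta>)"
    "\<Theta> = (\<Sum>\<beta>\<in>{\<beta> \<in> nat_span \<alpha>. T \<beta> \<noteq> 0}. T \<beta>)" by (rule \<Theta>_decomposition) (rule that; assumption)
  have "T \<beta> \<in> tensor_of (range (eval F)) (range (eval E))" if "\<beta> \<in> nat_span \<alpha>" for \<beta>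
    using T(1)[OF that] tensor_of_mono[OF graded_piece_subset graded_piece_subset] by blast
  then show ?thesis unfolding T(2) tensor_of_def by (intro cvec.span_sum) auto
qed

lemma slices_\<Theta>:
  assumes "clinear \<phi>"
  obtains x y where "right_slice \<phi> \<Theta> = eval F x" "left_slice \<phi> \<Theta> = eval E y"
  using right_slice_in_subspace[OF assms \<Theta>_in subspace_range[OF clinear_eval]]
    left_slice_in_subspace[OF assms \<Theta>_in subspace_range[OF clinear_eval]] by blast

text \<open>The degree-zero part of either slice of \<Theta> is \<phi> 1, since T 0 = 1 \<otimes> 1
  and the augmentation kills the slices of all other pieces.\<close>

lemma slice_\<Theta>_1:
  assumes \<phi>: "clinear \<phi>"
  shows "right_slice \<phi> \<Theta> = 0 \<Longrightarrow> \<phi> 1 = 0" "left_slice \<phi> \<Theta> = 0 \<Longrightarrow> \<phi> 1 = 0"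
proof -
  obtain T where T: "finite {\<beta> \<in> nat_span \<alpha>. T \<beta> \<noteq> 0}"
    "\<And>\<beta>. \<beta> \<in> nat_span \<alpha> \<Longrightarrow> T \<beta> \<in> tensor_of (graded_piece \<alpha> F \<beta>) (graded_piece \<alpha> E \<beta>)"
    "T 0 = 1 \<otimes>\<^sub>C 1" "\<Theta> = (\<Sum>\<beta>\<in>{\<beta> \<in> nat_span \<alpha>. T \<beta> \<noteq> 0}. T \<beta>)" by (rule \<Theta>_decomposition) (rule that; assumption)
  have T0: "T 0 \<noteq> 0" unfolding T(3) one_tensor_def[symmetric] by (rule one_neq_zero)
  obtain \<Phi> :: "'h \<Rightarrow> complex" where \<Phi>: "clinear \<Phi>" "\<And>x. \<Phi> (eval F x) = B x 1" "\<And>x. \<Phi> (eval E x) = B x 1"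
    by (rule augmentation) (rule that; assumption)
  have \<Phi>1: "\<Phi> 1 = 1" using \<Phi>(2)[of 1] by (simp add: B_1)
  have gr: "\<Phi> z = 0" if "z \<in> graded_piece \<alpha> F \<beta> \<or> z \<in> graded_piece \<alpha> E \<beta>" "\<beta> \<noteq> 0" for z \<beta>
    using that by (auto simp: graded_piece_eval \<Phi> B_span_word_1)
  have *: "(\<Sum>\<beta>\<in>{\<beta> \<in> nat_span \<alpha>. T \<beta> \<noteq> 0}. g \<beta>) = g 0"
    if "\<And>\<beta>. \<beta> \<in> nat_span \<alpha> \<Longrightarrow> \<beta> \<noteq> 0 \<Longrightarrow> g \<beta> = 0" for g :: "('g \<Rightarrow> complex) \<Rightarrow> complex"
  proof -
    have "(\<Sum>\<beta>\<in>{\<beta> \<in> nat_span \<alpha>. T \<beta> \<noteq> 0}. g \<beta>) = (\<Sum>\<beta>\<in>{\<beta> \<in> nat_span \<alpha>. T \<beta> \<noteq> 0}. if \<beta> = 0 then g 0 else 0)"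
      using that by (intro sum.cong) auto
    then show ?thesis using T(1) T0 nat_span_0 by simp
  qed
  show "\<phi> 1 = 0" if "right_slice \<phi> \<Theta> = 0"
  proof -
    have "0 = \<Phi> (right_slice \<phi> \<Theta>)" using that by (simp add: clin_0[OF \<Phi>(1)])
    also have "\<dots> = (\<Sum>\<beta>\<in>{\<beta> \<in> nat_span \<alpha>. T \<beta> \<noteq> 0}. \<Phi> (right_slice \<phi> (T \<beta>)))"
      by (simp add: T(4) clin_sum[OF clinear_right_slice[OF \<phi>]] clin_sum[OF \<Phi>(1)])
    also have "\<dots> = \<Phi> (right_slice \<phi> (T 0))"
      by (rule *) (use T(2) gr right_slice_in_subspace[OF \<phi> _ subspace_graded_piece] in blast)
    finally show ?thesis by (simp add: T(3) right_slice_tensor[OF \<phi>] clin_scale[OF \<Phi>(1)] \<Phi>1)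
  qed
  show "\<phi> 1 = 0" if "left_slice \<phi> \<Theta> = 0"
  proof -
    have "0 = \<Phi> (left_slice \<phi> \<Theta>)" using that by (simp add: clin_0[OF \<Phi>(1)])
    also have "\<dots> = (\<Sum>\<beta>\<in>{\<beta> \<in> nat_span \<alpha>. T \<beta> \<noteq> 0}. \<Phi> (left_slice \<phi> (T \<beta>)))"
      by (simp add: T(4) clin_sum[OF clinear_left_slice[OF \<phi>]] clin_sum[OF \<Phi>(1)])
    also have "\<dots> = \<Phi> (left_slice \<phi> (T 0))"
      by (rule *) (use T(2) gr left_slice_in_subspace[OF \<phi> _ subspace_graded_piece] in blast)
    finally show ?thesis by (simp add: T(3) left_slice_tensor[OF \<phi>] clin_scale[OF \<Phi>(1)] \<Phi>1)
  qed
qed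

lemma clinear_mult_left_comp: "clinear \<phi> \<Longrightarrow> clinear (\<lambda>z. \<phi> (h * z :: 'h))"
  by (rule clinear_comp[of \<phi>]) (assumption, rule clinear_mult_right[OF clinear_id])

lemma clinear_mult_right_comp: "clinear \<phi> \<Longrightarrow> clinear (\<lambda>z. \<phi> (z * h :: 'h))"
  by (rule clinear_comp[of \<phi>]) (assumption, rule clinear_mult_left[OF clinear_id])

lemma \<alpha>_cls: "cls L' (\<alpha> i) \<in> carrier Q" "cls L' (- \<alpha> i) \<in> carrier Q"
  using \<alpha>_in_L L_closed(3) by (auto simp: carrier_Q)

lemma eval_F_K: "c \<in> carrier Q \<Longrightarrow> eval F x * K c = K c * eval F (scale_word (\<chi> (rep c)) x)"
  by (simp add: K_eval_F scale_word_scale_word \<chi>_nz)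

lemma eval_E_K: "c \<in> carrier Q \<Longrightarrow> eval E x * K c = K c * eval E (scale_word (\<lambda>i. inverse (\<chi> (rep c) i)) x)"
  by (simp add: K_eval_E scale_word_scale_word \<chi>_nz)

text \<open>\<open>N\<close> will be the vanishing of a slice of \<Theta>; it is kept abstract to
  serve u^+ and u^- alike. The letters of a word move into the functional one by one until only 1 is
  left.\<close>

lemma vanishing_on_words:
  assumes step: "\<And>\<phi> i. clinear \<phi> \<Longrightarrow> N \<phi> \<Longrightarrow> N (\<lambda>z. \<phi> (X i * z))"
    and 1: "\<And>\<phi>. clinear \<phi> \<Longrightarrow> N \<phi> \<Longrightarrow> \<phi> 1 = 0" and \<phi>: "clinear \<phi>" "N \<phi>"
  shows "\<phi> (eval X x :: 'h) = (0 :: complex)"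
proof -
  have "\<forall>\<phi>. clinear \<phi> \<longrightarrow> N \<phi> \<longrightarrow> \<phi> (eval X (word w)) = 0" for w
  proof (induct w rule: word_induct)
    case Nil
    show ?case using 1 by simp
  next
    case (Cons i w)
    show ?case
    proof (intro allI impI)
      fix \<phi> assume \<phi>: "clinear \<phi>" "N \<phi>"
      from Cons[THEN spec, of "\<lambda>z. \<phi> (X i * z)"] step[OF \<phi>, of i] clinear_mult_left_comp[OF \<phi>(1), of "X i"]
      show "\<phi> (eval X (gen i * word w)) = 0" by (simp add: eval_mult)
    qed
  qed
  with \<phi> have w: "\<phi> (eval X (word w)) = 0" for w by blast
  show ?thesis
    by (rule word_linear_eqI[of "\<lambda>x. \<phi> (eval X x)" "\<lambda>_. 0"])
      (rule clinear_comp[OF \<phi>(1) clinear_eval] clinear_const_0 w)+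
qed

text \<open>Intertwining with \<open>E\<^sub>i\<close> shows that the vanishing of the slice passes from \<open>\<phi>\<close> to
  \<open>z \<mapsto> \<phi> (E\<^sub>i z)\<close>; iterating and comparing degree zero shows that \<open>\<phi>\<close> vanishes on \<open>u\<^sup>+\<close>.\<close>

lemma right_slice_\<Theta>_nondegenerate:
  assumes dist: "\<And>i. cls L' (\<alpha> i) \<noteq> cls L' (- \<alpha> i)" and \<phi>: "clinear \<phi>" "right_slice \<phi> \<Theta> = 0"
  shows "\<phi> (eval E x) = 0"
proof -
  have step: "right_slice (\<lambda>z. \<phi> (E i * z)) \<Theta> = 0" if \<phi>: "clinear \<phi>" "right_slice \<phi> \<Theta> = 0" for \<phi> i
  proof -
    have lin: "clinear (\<lambda>z. \<phi> (E i * z))" "clinear (\<lambda>z. \<phi> (z * E i))"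
      by (rule clinear_mult_left_comp[OF \<phi>(1)], rule clinear_mult_right_comp[OF \<phi>(1)])
    obtain x y x' y' where x: "right_slice (\<lambda>z. \<phi> (E i * z)) \<Theta> = eval F x" "right_slice (\<lambda>z. \<phi> (z * E i)) \<Theta> = eval F x'"
      by (rule slices_\<Theta>[OF lin(1)], rule slices_\<Theta>[OF lin(2)]) (rule that; assumption)
    have "right_slice \<phi> (\<Delta>b (E i) * \<Theta>) = right_slice \<phi> (\<Theta> * \<Delta> (E i))" by (simp add: intertwine)
    \<comment> \<open>The summand E_i \<otimes> 1 contributes a multiple of the slice by \<phi>,
      which is zero. What remains equates elements of K(-\<alpha>_i) u^- and K(\<alpha>_i)
      u^-.\<close>
    then have "K (cls L' (- \<alpha> i)) * eval F x = eval F x' * K (cls L' (\<alpha> i))"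
      using bar \<phi>(2) by (simp add: bar_coproduct_def coproduct_E distrib_left distrib_right
          clin_add[OF clinear_right_slice[OF \<phi>(1)]] right_slice_mult[OF \<phi>(1)] x)
    then have "eval F x = 0"
      using eval_F_K[OF \<alpha>_cls(1)] K_eval_F_distinct[OF \<alpha>_cls(2,1) dist[symmetric]] by metis
    with x show ?thesis by simp
  qed
  show ?thesis
    using vanishing_on_words[where N = "\<lambda>\<phi>. right_slice \<phi> \<Theta> = 0" and X = E and \<phi> = \<phi>] step slice_\<Theta>_1(1) \<phi> by blast
qed

text \<open>The mirror image: F_i carries its group-like factor in the second tensor position, where
  the left slice takes its values.\<close>

lemma left_slice_\<Theta>_nondegenerate:
  assumes dist: "\<And>i. cls L' (\<alpha> i) \<noteq> cls L' (- \<alpha> i)" and \<phi>: "clinear \<phi>" "left_slice \<phi> \<Theta> = 0"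
  shows "\<phi> (eval F x) = 0"
proof -
  have step: "left_slice (\<lambda>z. \<phi> (F i * z)) \<Theta> = 0" if \<phi>: "clinear \<phi>" "left_slice \<phi> \<Theta> = 0" for \<phi> i
  proof -
    have lin: "clinear (\<lambda>z. \<phi> (F i * z))" "clinear (\<lambda>z. \<phi> (z * F i))"
      by (rule clinear_mult_left_comp[OF \<phi>(1)], rule clinear_mult_right_comp[OF \<phi>(1)])
    obtain x y x' y' where x: "left_slice (\<lambda>z. \<phi> (F i * z)) \<Theta> = eval E x" "left_slice (\<lambda>z. \<phi> (z * F i)) \<Theta> = eval E x'"
      by (rule slices_\<Theta>[OF lin(1)], rule slices_\<Theta>[OF lin(2)]) (rule that; assumption)
    have "left_slice \<phi> (\<Delta>b (F i) * \<Theta>) = left_slice \<phi> (\<Theta> * \<Delta> (F i))" by (simp add: intertwine)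
    then have "K (cls L' (\<alpha> i)) * eval E x = eval E x' * K (cls L' (- \<alpha> i))"
      using bar \<phi>(2) by (simp add: bar_coproduct_def coproduct_F distrib_left distrib_right
          clin_add[OF clinear_left_slice[OF \<phi>(1)]] left_slice_mult[OF \<phi>(1)] x)
    then have "eval E x = 0"
      using eval_E_K[OF \<alpha>_cls(2)] K_eval_E_distinct[OF \<alpha>_cls(1,2) dist] by metis
    with x show ?thesis by simp
  qed
  show ?thesis
    using vanishing_on_words[where N = "\<lambda>\<phi>. left_slice \<phi> \<Theta> = 0" and X = F and \<phi> = \<phi>] step slice_\<Theta>_1(2) \<phi> by blast
qed

text \<open>The index stores the weight next to the vector, so that later shifts by the weight can
  be read off from it. Independence within a weight is the choice of D, across weights the
  directness of the sum of graded pieces.\<close>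

lemma \<Theta>_homogeneous:
  obtains P :: "(('g \<Rightarrow> complex) \<times> 'h) set" and f where "finite P"
    "\<And>p. p \<in> P \<Longrightarrow> fst p \<in> nat_span \<alpha> \<and> f p \<in> graded_piece \<alpha> F (fst p) \<and> snd p \<in> graded_piece \<alpha> E (fst p)"
    "indep_family P snd" "\<Theta> = (\<Sum>p\<in>P. f p \<otimes>\<^sub>C snd p)"
proof -
  obtain T where T: "finite {\<beta> \<in> nat_span \<alpha>. T \<beta> \<noteq> 0}"
    "\<And>\<beta>. \<beta> \<in> nat_span \<alpha> \<Longrightarrow> T \<beta> \<in> tensor_of (graded_piece \<alpha> F \<beta>) (graded_piece \<alpha> E \<beta>)"
    "T 0 = 1 \<otimes>\<^sub>C 1" "\<Theta> = (\<Sum>\<beta>\<in>{\<beta> \<in> nat_span \<alpha>. T \<beta> \<noteq> 0}. T \<beta>)" by (rule \<Theta>_decomposition) (rule that; assumption)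
  define N where "N = {\<beta> \<in> nat_span \<alpha>. T \<beta> \<noteq> 0}"
  have ex: "\<exists>D u. finite D \<and> D \<subseteq> graded_piece \<alpha> E \<beta> \<and> cvec.independent D \<and>
      (\<forall>w\<in>D. u w \<in> graded_piece \<alpha> F \<beta>) \<and> T \<beta> = (\<Sum>w\<in>D. u w \<otimes>\<^sub>C w)" if "\<beta> \<in> N" for \<beta>
  proof -
    have \<beta>: "\<beta> \<in> nat_span \<alpha>" using that by (simp add: N_def)
    obtain W where W: "W \<subseteq> graded_piece \<alpha> E \<beta>" "cvec.independent W" "graded_piece \<alpha> E \<beta> \<subseteq> cvec.span W"
      by (rule cvec.maximal_independent_subset)
    obtain D u where "finite D" "D \<subseteq> W" "\<And>w. w \<in> D \<Longrightarrow> u w \<in> graded_piece \<alpha> F \<beta>" "T \<beta> = (\<Sum>w\<in>D. u w \<otimes>\<^sub>C w)"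
      by (rule tensor_of_basis[OF subspace_graded_piece W(1,3) T(2)[OF \<beta>]]) (rule that; assumption)
    with W cvec.independent_mono[of W D] show ?thesis by (intro exI[of _ D] exI[of _ u]) auto
  qed
  have "\<forall>\<beta>\<in>N. \<exists>Du. finite (fst Du) \<and> fst Du \<subseteq> graded_piece \<alpha> E \<beta> \<and> cvec.independent (fst Du) \<and>
      (\<forall>w\<in>fst Du. snd Du w \<in> graded_piece \<alpha> F \<beta>) \<and> T \<beta> = (\<Sum>w\<in>fst Du. snd Du w \<otimes>\<^sub>C w)"
    using ex by (simp only: split_paired_Ex fst_conv snd_conv) blast
  from bchoice[OF this] obtain Du where Du: "\<forall>\<beta>\<in>N. finite (fst (Du \<beta>)) \<and> fst (Du \<beta>) \<subseteq> graded_piece \<alpha> E \<beta> \<and>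
      cvec.independent (fst (Du \<beta>)) \<and> (\<forall>w\<in>fst (Du \<beta>). snd (Du \<beta>) w \<in> graded_piece \<alpha> F \<beta>) \<and>
      T \<beta> = (\<Sum>w\<in>fst (Du \<beta>). snd (Du \<beta>) w \<otimes>\<^sub>C w)" ..
  have Du1: "finite (fst (Du \<beta>))" and Du2: "fst (Du \<beta>) \<subseteq> graded_piece \<alpha> E \<beta>"
    and Du3: "cvec.independent (fst (Du \<beta>))" and Du4: "\<forall>w\<in>fst (Du \<beta>). snd (Du \<beta>) w \<in> graded_piece \<alpha> F \<beta>"
    and Du5: "T \<beta> = (\<Sum>w\<in>fst (Du \<beta>). snd (Du \<beta>) w \<otimes>\<^sub>C w)" if "\<beta> \<in> N" for \<beta>
    using bspec[OF Du that] by - (elim conjE, assumption)+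
  have fN: "finite N" using T(1) by (simp add: N_def)
  define P where "P = Sigma N (\<lambda>\<beta>. fst (Du \<beta>))"
  show thesis
  proof (rule that[of P "\<lambda>p. snd (Du (fst p)) (snd p)"])
    show "finite P" unfolding P_def by (intro finite_SigmaI fN Du1)
    show "fst p \<in> nat_span \<alpha> \<and> snd (Du (fst p)) (snd p) \<in> graded_piece \<alpha> F (fst p) \<and> snd p \<in> graded_piece \<alpha> E (fst p)"
      if P: "p \<in> P" for p
    proof -
      obtain \<beta> w where p: "p = (\<beta>, w)" "\<beta> \<in> N" "w \<in> fst (Du \<beta>)"
        using P unfolding P_def by (elim SigmaE) auto
      then have "\<beta> \<in> nat_span \<alpha>" by (simp add: N_def)
      then show ?thesis using Du2[OF p(2)] Du4[OF p(2)] p by auto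
    qed
    show "\<Theta> = (\<Sum>p\<in>P. snd (Du (fst p)) (snd p) \<otimes>\<^sub>C snd p)"
    proof -
      have "\<Theta> = (\<Sum>\<beta>\<in>N. \<Sum>w\<in>fst (Du \<beta>). snd (Du \<beta>) w \<otimes>\<^sub>C w)"
        unfolding T(4) N_def[symmetric] by (rule sum.cong[OF refl Du5])
      also have "\<dots> = (\<Sum>(\<beta>, w)\<in>P. snd (Du \<beta>) w \<otimes>\<^sub>C w)"
        unfolding P_def by (rule sum.Sigma) (use fN Du1 in blast)+
      finally show ?thesis by (simp add: split_def)
    qed
    show "indep_family P snd"
      unfolding indep_family_def
    proof (intro allI impI ballI)
      fix a p assume 0: "(\<Sum>p\<in>P. a p *\<^sub>C snd p) = 0" and p: "p \<in> P"
      let ?v = "\<lambda>\<beta>. \<Sum>w\<in>fst (Du \<beta>). a (\<beta>, w) *\<^sub>C w"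
      have sum: "(\<Sum>\<beta>\<in>N. ?v \<beta>) = 0"
      proof -
        have "(\<Sum>\<beta>\<in>N. ?v \<beta>) = (\<Sum>(\<beta>, w)\<in>P. a (\<beta>, w) *\<^sub>C w)"
          unfolding P_def by (rule sum.Sigma) (use fN Du1 in blast)+
        then show ?thesis using 0 by (simp add: split_def)
      qed
      have v: "?v \<beta> \<in> graded_piece \<alpha> E \<beta>" if "\<beta> \<in> N" for \<beta>
        using Du2[OF that] by (intro cvec.subspace_sum[OF subspace_graded_piece] cvec.subspace_scale[OF subspace_graded_piece]) blast
      have "?v (fst p) = 0"
        by (rule graded_pieces_independent[OF fN v sum]) (use p in \<open>auto simp: P_def\<close>)
      moreover have "fst p \<in> N" "snd p \<in> fst (Du (fst p))" using p by (auto simp: P_def)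
      ultimately have "a (fst p, snd p) = 0"
        using cvec.independentD[OF Du3[of "fst p"] Du1[of "fst p"] subset_refl,
            where u = "\<lambda>w. a (fst p, w)" and v = "snd p"] by simp
      then show "a p = 0" by simp
    qed
  qed
qed

end

section \<open>The monodromy element\<close>

lemma clinear_tensor_swap: "clinear tensor_swap"
  unfolding tensor_swap_def by (intro clinear_tensor_lift cbilinearI' clinear_intros)

lemma tensor_swap_tensor: "tensor_swap (a \<otimes>\<^sub>C b) = b \<otimes>\<^sub>C a"
  unfolding tensor_swap_def by (rule tensor_lift_tensor) (intro cbilinearI' clinear_intros)

lemma tensor_swap_mult: "tensor_swap (s * s') = tensor_swap s * tensor_swap s'"
proof (induct s rule: tensor_induct)
  case (tensor a b)
  show ?case
    by (induct s' rule: tensor_induct)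
      (simp_all add: times_tensor_tensor tensor_swap_tensor distrib_left clin_add[OF clinear_tensor_swap])
qed (simp add: distrib_right clin_add[OF clinear_tensor_swap])

lemma (in group) sum_shift:
  "b \<in> carrier G \<Longrightarrow> (\<Sum>x\<in>carrier G. h (x \<otimes> b)) = (\<Sum>x\<in>carrier G. h x)"
  by (rule sum.reindex_bij_witness[of _ "\<lambda>x. x \<otimes> inv b" "\<lambda>x. x \<otimes> b"]) (auto simp: m_assoc)

lemma (in group) sum_shift2:
  assumes "b \<in> carrier G" "b' \<in> carrier G"
  shows "(\<Sum>x\<in>carrier G. \<Sum>y\<in>carrier G. h (x \<otimes> b) (y \<otimes> b')) = (\<Sum>x\<in>carrier G. \<Sum>y\<in>carrier G. h x y)"
  unfolding sum_shift[OF assms(2)] by (rule sum_shift[OF assms(1)])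

locale R_matrix_setting = quasi_R_setting br \<hh> \<kappa> ip \<alpha> \<omega> d l q L L' B K E F \<Delta> \<epsilon> S \<Delta>b \<Theta>
  for br :: "'g::complex_vector \<Rightarrow> 'g \<Rightarrow> 'g" and \<hh> \<kappa> ip
    and \<alpha> :: "'i::finite \<Rightarrow> 'g \<Rightarrow> complex" and \<omega> d l q L L' B
    and K :: "('g \<Rightarrow> complex) set \<Rightarrow> 'h::complex_algebra_1" and E F \<Delta> \<epsilon> S \<Delta>b \<Theta> +
  fixes R\<^sub>0 R :: "('h, 'h) tensor" and G\<^sub>1 G\<^sub>2 :: "('g \<Rightarrow> complex) set set"
    and f :: "('g \<Rightarrow> complex) set \<Rightarrow> ('g \<Rightarrow> complex) set \<Rightarrow> complex"
  assumes G\<^sub>1: "subgroup G\<^sub>1 Q" "cls L' ` int_span \<alpha> \<subseteq> G\<^sub>1"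
    and G\<^sub>2: "subgroup G\<^sub>2 Q" "cls L' ` int_span \<alpha> \<subseteq> G\<^sub>2"
    and f_outside: "\<And>\<mu> \<nu>. \<mu> \<in> carrier Q \<Longrightarrow> \<nu> \<in> carrier Q \<Longrightarrow> (\<mu>, \<nu>) \<notin> G\<^sub>1 \<times> G\<^sub>2 \<Longrightarrow> f \<mu> \<nu> = 0"
    and sysE: "system_E ip \<alpha> q L L' G\<^sub>1 G\<^sub>2 f"
    and R\<^sub>0: "R\<^sub>0 = (\<Sum>\<mu>\<in>carrier Q. \<Sum>\<nu>\<in>carrier Q. f \<mu> \<nu> *\<^sub>C (K \<mu> \<otimes>\<^sub>C K \<nu>))"
    and R: "R = R\<^sub>0 * \<Theta>" and R_matrix: "R_matrix \<Delta> R"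
begin

sublocale Q: comm_group Q
  by (rule comm_group_Q)

declare mult_FactGroup [simp del] one_FactGroup [simp del]

abbreviation Q_mult (infixl "\<cdot>" 70) where "x \<cdot> y \<equiv> x \<otimes>\<^bsub>Q\<^esub> y"
abbreviation Q_inv ("inv\<^sub>Q _" [81] 80) where "inv\<^sub>Q x \<equiv> inv\<^bsub>Q\<^esub> x"
abbreviation Q_one ("\<one>\<^sub>Q") where "\<one>\<^sub>Q \<equiv> \<one>\<^bsub>Q\<^esub>"

lemma finite_Q: "finite (carrier Q)"
proof (rule ccontr)
  assume "infinite (carrier Q)"
  \<comment> \<open>A sum over an infinite set is 0 by convention, and the zero tensor has no
    inverse.\<close>
  then have "R = 0" by (simp add: R R\<^sub>0)
  then show False using R_matrix by (simp add: R_matrix_def)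
qed

section \<open>Characters of the quotient group and shift laws for f\<close>

definition qchar :: "('g \<Rightarrow> complex) set \<Rightarrow> ('g \<Rightarrow> complex) \<Rightarrow> complex" where
  "qchar c \<beta> = q powi int_ip ip (wt (rep c)) \<beta>"

lemma qchar_nz: "qchar c \<beta> \<noteq> 0"
  by (simp add: qchar_def q_nz)

text \<open>The representative of a product and the sum of the representatives differ by an element
  of \<Lambda>', which pairs to exponents divisible by l.\<close>

lemma qchar_mult:
  assumes "c \<in> carrier Q" "c' \<in> carrier Q"
  shows "qchar (c \<cdot> c') (rt m) = qchar c (rt m) * qchar c' (rt m)"
proof -
  define z where "z = rep (c \<cdot> c') - (rep c + rep c')"
  have eq: "c \<cdot> c' = cls L' (wt (rep c + rep c'))"
    using cls_mult[OF rep(1)[OF assms(1)] rep(1)[OF assms(2)]] rep(2)[OF assms(1)] rep(2)[OF assms(2)]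
    by (simp add: wt_add)
  have "wt (rep c + rep c') \<in> L" using rep(1) assms by (simp add: wt_add L_closed)
  from rep_cls[OF this] have "z \<in> Z" by (simp add: z_def eq)
  then have z: "q powi int_ip ip (wt z) (rt m) = 1"
    using q_powi_period[of "wt z" m "int_ip ip (wt z) (rt m)"] unfolding int_ip_wt_rt ip_wt_rt Z_def by simp
  have add: "int_ip ip (wt (x + y)) (rt m) = int_ip ip (wt x) (rt m) + int_ip ip (wt y) (rt m)" for x y
    by (simp add: int_ip_wt_rt algebra_simps sum.distrib)
  have "rep (c \<cdot> c') = z + (rep c + rep c')" by (simp add: z_def)
  then show ?thesis
    unfolding qchar_def by (simp only: add power_int_add[OF disjI1[OF q_nz]] z mult_1_left)
qed

lemma qchar_one: "qchar \<one>\<^sub>Q (rt m) = 1"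
  using qchar_mult[OF Q.one_closed Q.one_closed, of m] qchar_nz[of "\<one>\<^sub>Q" "rt m"] by simp

lemma qchar_inv: "c \<in> carrier Q \<Longrightarrow> qchar (inv\<^sub>Q c) (rt m) = inverse (qchar c (rt m))"
  using qchar_mult[of c "inv\<^sub>Q c" m] qchar_one[of m] by (simp add: inverse_unique)

lemma nat_span_rt: "\<beta> \<in> nat_span \<alpha> \<Longrightarrow> \<exists>m. \<beta> = rt m"
  by (auto simp: nat_span_def rt_def intro: exI[of _ "\<lambda>i. int (n i)" for n])

lemma cls_rt: "cls L' (rt m) \<in> carrier Q" "cls L' (rt m) \<in> G\<^sub>1" "cls L' (rt m) \<in> G\<^sub>2"
  using rt_in_L G\<^sub>1(2) G\<^sub>2(2) by (auto simp: carrier_Q int_span_rt)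

lemma K_graded_E:
  assumes c: "c \<in> carrier Q" and "e \<in> graded_piece \<alpha> E \<beta>"
  shows "e * K c = inverse (qchar c \<beta>) *\<^sub>C (K c * e)"
  using assms(2) unfolding graded_piece_def
proof (induct e rule: cvec.span_induct_alt)
  case (step k x y)
  then obtain w where w: "x = eval E (word w)" "weight \<alpha> w = \<beta>" by (auto simp: eval_word)
  have "K c * x = qchar c \<beta> *\<^sub>C (x * K c)"
    using K_eval_E[OF c, of "word w"] w
    by (simp add: scale_word_word q_powi_weight clin_scale[OF clinear_eval] qchar_def flip: q_powi_weight)
  then have "x * K c = inverse (qchar c \<beta>) *\<^sub>C (K c * x)" by (simp add: qchar_nz)
  with step show ?case by (simp add: distrib_left distrib_right scaleC_add_right mult.commute)
qed simp

lemma K_graded_F: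
  assumes c: "c \<in> carrier Q" and "e \<in> graded_piece \<alpha> F \<beta>"
  shows "e * K c = qchar c \<beta> *\<^sub>C (K c * e)"
  using assms(2) unfolding graded_piece_def
proof (induct e rule: cvec.span_induct_alt)
  case (step k x y)
  then obtain w where w: "x = eval F (word w)" "weight \<alpha> w = \<beta>" by (auto simp: eval_word)
  have "x * K c = qchar c \<beta> *\<^sub>C (K c * x)"
    using eval_F_K[OF c, of "word w"] w
    by (simp add: scale_word_word clin_scale[OF clinear_eval] qchar_def flip: q_powi_weight)
  with step show ?case by (simp add: distrib_left distrib_right scaleC_add_right mult.commute)
qed simp

lemma rep_mem: "c \<in> carrier Q \<Longrightarrow> wt (rep c) \<in> c"
proof -
  assume "c \<in> carrier Q"
  moreover have "wt (rep c) \<in> cls L' (wt (rep c))"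
    using L'_closed(1) by (auto simp: cls_eq intro!: exI[of _ 0])
  ultimately show ?thesis using rep(2) by simp
qed

lemma f_shift_left: "\<mu> \<in> G\<^sub>1 \<Longrightarrow> \<nu> \<in> G\<^sub>2 \<Longrightarrow>
    f (\<mu> \<cdot> cls L' (rt m)) \<nu> = inverse (qchar \<nu> (rt m)) * f \<mu> \<nu>"
  and f_shift_right: "\<mu> \<in> G\<^sub>1 \<Longrightarrow> \<nu> \<in> G\<^sub>2 \<Longrightarrow>
    f \<mu> (\<nu> \<cdot> cls L' (rt m)) = inverse (qchar \<mu> (rt m)) * f \<mu> \<nu>"
proof -
  assume *: "\<mu> \<in> G\<^sub>1" "\<nu> \<in> G\<^sub>2"
  have r: "wt (rep \<mu>) \<in> \<mu>" "wt (rep \<nu>) \<in> \<nu>"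
    using * rep_mem subgroup.mem_carrier[OF G\<^sub>1(1)] subgroup.mem_carrier[OF G\<^sub>2(1)] by auto
  have m: "rt m \<in> int_span \<alpha>" by (simp add: int_span_rt)
  note E = sysE[unfolded system_E_def Let_def]
  show "f (\<mu> \<cdot> cls L' (rt m)) \<nu> = inverse (qchar \<nu> (rt m)) * f \<mu> \<nu>"
    using E[THEN conjunct1, THEN bspec, OF m, THEN bspec, OF *(1), THEN bspec, OF *(2), THEN bspec, OF r(2)]
    by (simp add: qchar_def power_int_minus)
  show "f \<mu> (\<nu> \<cdot> cls L' (rt m)) = inverse (qchar \<mu> (rt m)) * f \<mu> \<nu>"
    using E[THEN conjunct2, THEN conjunct1, THEN bspec, OF m, THEN bspec, OF *(1), THEN bspec, OF *(2), THEN bspec, OF r(1)]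
    by (simp add: qchar_def power_int_minus)
qed

text \<open>Part (3) of the system, extended by zero to all classes; outside the subgroup the sum is
  empty of nonzero terms and the class is not the unit.\<close>

lemma f_sum_left: "\<nu> \<in> carrier Q \<Longrightarrow> (\<Sum>\<mu>\<in>carrier Q. f \<mu> \<nu>) = (if \<nu> = \<one>\<^sub>Q then 1 else 0)"
  and f_sum_right: "\<mu> \<in> carrier Q \<Longrightarrow> (\<Sum>\<nu>\<in>carrier Q. f \<mu> \<nu>) = (if \<mu> = \<one>\<^sub>Q then 1 else 0)"
proof -
  note E = sysE[unfolded system_E_def Let_def, THEN conjunct2, THEN conjunct2, THEN conjunct2, THEN conjunct2]
  have s: "(\<Sum>\<mu>\<in>carrier Q. f \<mu> \<nu>) = (\<Sum>\<mu>\<in>G\<^sub>1. f \<mu> \<nu>)" if "\<nu> \<in> carrier Q" for \<nu>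
    using finite_Q subgroup.subset[OF G\<^sub>1(1)] f_outside that by (intro sum.mono_neutral_right) auto
  have s': "(\<Sum>\<nu>\<in>carrier Q. f \<mu> \<nu>) = (\<Sum>\<nu>\<in>G\<^sub>2. f \<mu> \<nu>)" if "\<mu> \<in> carrier Q" for \<mu>
    using finite_Q subgroup.subset[OF G\<^sub>2(1)] f_outside that by (intro sum.mono_neutral_right) auto
  show "(\<Sum>\<mu>\<in>carrier Q. f \<mu> \<nu>) = (if \<nu> = \<one>\<^sub>Q then 1 else 0)" if \<nu>: "\<nu> \<in> carrier Q"
  proof (cases "\<nu> \<in> G\<^sub>2")
    case True
    then show ?thesis using E[THEN conjunct1] s[OF \<nu>] by simp
  next
    case False
    then have "\<nu> \<noteq> \<one>\<^sub>Q" using subgroup.one_closed[OF G\<^sub>2(1)] by auto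
    with False show ?thesis using f_outside \<nu> by (auto intro!: sum.neutral)
  qed
  show "(\<Sum>\<nu>\<in>carrier Q. f \<mu> \<nu>) = (if \<mu> = \<one>\<^sub>Q then 1 else 0)" if \<mu>: "\<mu> \<in> carrier Q"
  proof (cases "\<mu> \<in> G\<^sub>1")
    case True
    then show ?thesis using E[THEN conjunct2] s'[OF \<mu>] by simp
  next
    case False
    then have "\<mu> \<noteq> \<one>\<^sub>Q" using subgroup.one_closed[OF G\<^sub>1(1)] by auto
    with False show ?thesis using f_outside \<mu> by (auto intro!: sum.neutral)
  qed
qed

lemma coset_subgroup:
  assumes "subgroup G Q" "b \<in> G" "\<mu> \<in> carrier Q"
  shows "\<mu> \<cdot> b \<in> G \<longleftrightarrow> \<mu> \<in> G"
proof
  have b: "b \<in> carrier Q" using subgroup.mem_carrier[OF assms(1,2)] .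
  assume "\<mu> \<cdot> b \<in> G"
  then have "\<mu> \<cdot> b \<cdot> inv\<^sub>Q b \<in> G"
    by (rule subgroup.m_closed[OF assms(1)]) (rule subgroup.m_inv_closed[OF assms(1,2)])
  then show "\<mu> \<in> G" using b assms(3) by (simp add: Q.m_assoc)
next
  assume "\<mu> \<in> G"
  then show "\<mu> \<cdot> b \<in> G" using assms(2) by (rule subgroup.m_closed[OF assms(1)])
qed

text \<open>Quasi-periodicity extends from the two subgroups to all classes: a shift by a root
  preserves membership in both, so outside them each side is 0.\<close>

lemma f_unshift:
  assumes \<mu>: "\<mu> \<in> carrier Q" and \<nu>: "\<nu> \<in> carrier Q"
  shows "f (\<mu> \<cdot> inv\<^sub>Q cls L' (rt m)) \<nu> = qchar \<nu> (rt m) * f \<mu> \<nu>"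
    and "f \<mu> (\<nu> \<cdot> inv\<^sub>Q cls L' (rt m)) = qchar \<mu> (rt m) * f \<mu> \<nu>"
    and "f \<mu> (\<nu> \<cdot> cls L' (rt m)) = inverse (qchar \<mu> (rt m)) * f \<mu> \<nu>"
proof -
  let ?b = "cls L' (rt m)"
  have i: "inv\<^sub>Q ?b \<in> G\<^sub>1" "inv\<^sub>Q ?b \<in> G\<^sub>2" "inv\<^sub>Q ?b \<in> carrier Q"
    using cls_rt[of m] G\<^sub>1 G\<^sub>2 by (auto intro: subgroup.m_inv_closed)
  have c: "x \<cdot> inv\<^sub>Q ?b \<cdot> ?b = x" if "x \<in> carrier Q" for x
    using that cls_rt(1)[of m] by (simp add: Q.m_assoc)
  note sub = coset_subgroup[OF G\<^sub>1(1) i(1)] coset_subgroup[OF G\<^sub>2(1) i(2)] coset_subgroup[OF G\<^sub>2(1) cls_rt(3)]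
  have "f (\<mu> \<cdot> inv\<^sub>Q ?b) \<nu> = qchar \<nu> (rt m) * f \<mu> \<nu> \<and>
      f \<mu> (\<nu> \<cdot> inv\<^sub>Q ?b) = qchar \<mu> (rt m) * f \<mu> \<nu> \<and>
      f \<mu> (\<nu> \<cdot> ?b) = inverse (qchar \<mu> (rt m)) * f \<mu> \<nu>"
  proof (cases "\<mu> \<in> G\<^sub>1 \<and> \<nu> \<in> G\<^sub>2")
    case True
    then show ?thesis
      using f_shift_left[of "\<mu> \<cdot> inv\<^sub>Q ?b" \<nu> m] f_shift_right[of \<mu> "\<nu> \<cdot> inv\<^sub>Q ?b" m] f_shift_right[of \<mu> \<nu> m]
      by (simp add: sub \<mu> \<nu> c qchar_nz field_simps)
  next
    case False
    then show ?thesis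
      using \<mu> \<nu> i cls_rt[of m] by (auto simp: f_outside sub)
  qed
  then show "f (\<mu> \<cdot> inv\<^sub>Q ?b) \<nu> = qchar \<nu> (rt m) * f \<mu> \<nu>"
    "f \<mu> (\<nu> \<cdot> inv\<^sub>Q ?b) = qchar \<mu> (rt m) * f \<mu> \<nu>"
    "f \<mu> (\<nu> \<cdot> ?b) = inverse (qchar \<mu> (rt m)) * f \<mu> \<nu>" by blast+
qed

definition m :: "('g \<Rightarrow> complex) set \<Rightarrow> ('g \<Rightarrow> complex) set \<Rightarrow> complex" where
  "m \<mu> \<nu> = (\<Sum>\<mu>'\<in>carrier Q. \<Sum>\<nu>'\<in>carrier Q.
      f (\<mu> \<cdot> inv\<^sub>Q \<mu>') (\<nu> \<cdot> inv\<^sub>Q \<nu>') * f \<nu>' \<mu>')"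

text \<open>If \<open>2\<alpha>\<^sub>i \<in> \<Lambda>'\<close>, the difference of the characters \<open>q\<^bsup>(\<cdot>, \<alpha>\<^sub>i)\<^esup>\<close> and \<open>1\<close> is a nonzero kernel vector
  of \<open>m\<close>.\<close>

lemma m_invertible_distinct:
  assumes inv: "invertible_on (carrier Q) m"
  shows "cls L' (\<alpha> i) \<noteq> cls L' (- \<alpha> i)"
proof
  assume eq: "cls L' (\<alpha> i) = cls L' (- \<alpha> i)"
  define a :: "'i \<Rightarrow> int" where "a = (\<lambda>j. if j = i then 1 else 0)"
  have a: "\<alpha> i = rt a" unfolding a_def by (rule \<alpha>_rt)
  let ?b = "cls L' (rt a)"
  have bb: "?b \<cdot> ?b = \<one>\<^sub>Q"
    using cls_mult[OF rt_in_L[of a] L_closed(3)[OF rt_in_L[of a]]] eq by (simp add: a cls_0)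
  \<comment> \<open>m is the convolution of f and its transpose, so it maps a multiplicative w to
    the convolution of the transforms of w under these two.\<close>
  have conv: "(\<Sum>\<nu>\<in>carrier Q. m \<mu> \<nu> * w \<nu>) =
      (\<Sum>\<mu>'\<in>carrier Q. (\<Sum>\<nu>\<in>carrier Q. f (\<mu> \<cdot> inv\<^sub>Q \<mu>') \<nu> * w \<nu>) * (\<Sum>\<nu>'\<in>carrier Q. f \<nu>' \<mu>' * w \<nu>'))"
    if w: "\<And>c c'. c \<in> carrier Q \<Longrightarrow> c' \<in> carrier Q \<Longrightarrow> w (c \<cdot> c') = w c * w c'" for w \<mu>
  proof -
    have "(\<Sum>\<nu>\<in>carrier Q. m \<mu> \<nu> * w \<nu>) = (\<Sum>\<nu>\<in>carrier Q. \<Sum>\<mu>'\<in>carrier Q. \<Sum>\<nu>'\<in>carrier Q.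
        f (\<mu> \<cdot> inv\<^sub>Q \<mu>') (\<nu> \<cdot> inv\<^sub>Q \<nu>') * f \<nu>' \<mu>' * w \<nu>)"
      by (simp add: m_def sum_distrib_right)
    also have "\<dots> = (\<Sum>\<mu>'\<in>carrier Q. \<Sum>\<nu>'\<in>carrier Q. \<Sum>\<nu>\<in>carrier Q.
        f (\<mu> \<cdot> inv\<^sub>Q \<mu>') (\<nu> \<cdot> inv\<^sub>Q \<nu>') * f \<nu>' \<mu>' * w \<nu>)"
      by (subst sum.swap) (intro sum.cong refl sum.swap)
    also have "\<dots> = (\<Sum>\<mu>'\<in>carrier Q. \<Sum>\<nu>'\<in>carrier Q. \<Sum>\<nu>\<in>carrier Q.
        (f (\<mu> \<cdot> inv\<^sub>Q \<mu>') \<nu> * w \<nu>) * (f \<nu>' \<mu>' * w \<nu>'))"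
    proof (rule sum.cong[OF refl], rule sum.cong[OF refl])
      fix \<mu>' \<nu>' assume \<nu>': "\<nu>' \<in> carrier Q"
      have "(\<Sum>\<nu>\<in>carrier Q. f (\<mu> \<cdot> inv\<^sub>Q \<mu>') (\<nu> \<cdot> inv\<^sub>Q \<nu>') * f \<nu>' \<mu>' * w \<nu>) =
          (\<Sum>\<nu>\<in>carrier Q. f (\<mu> \<cdot> inv\<^sub>Q \<mu>') (\<nu> \<cdot> \<nu>' \<cdot> inv\<^sub>Q \<nu>') * f \<nu>' \<mu>' * w (\<nu> \<cdot> \<nu>'))"
        by (rule Q.sum_shift[OF \<nu>', symmetric])
      also have "\<dots> = (\<Sum>\<nu>\<in>carrier Q. (f (\<mu> \<cdot> inv\<^sub>Q \<mu>') \<nu> * w \<nu>) * (f \<nu>' \<mu>' * w \<nu>'))"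
        using \<nu>' by (intro sum.cong refl) (simp add: Q.m_assoc w)
      finally show "(\<Sum>\<nu>\<in>carrier Q. f (\<mu> \<cdot> inv\<^sub>Q \<mu>') (\<nu> \<cdot> inv\<^sub>Q \<nu>') * f \<nu>' \<mu>' * w \<nu>) = \<dots>" .
    qed
    finally show ?thesis
      by (simp add: sum_product) (intro sum.cong refl sum.swap)
  qed
  \<comment> \<open>By quasi-periodicity the character turns f into a shifted f, whose row sums form
    the delta function at \<alpha>_i instead of 0.\<close>
  have row: "(\<Sum>\<nu>\<in>carrier Q. f \<mu> \<nu> * qchar \<nu> (rt a)) = (if \<mu> = ?b then 1 else 0)" if \<mu>: "\<mu> \<in> carrier Q" for \<mu>
  proof -
    have "(\<Sum>\<nu>\<in>carrier Q. f \<mu> \<nu> * qchar \<nu> (rt a)) = (\<Sum>\<nu>\<in>carrier Q. f (\<mu> \<cdot> inv\<^sub>Q ?b) \<nu>)"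
      using f_unshift(1)[OF \<mu>] by (intro sum.cong) (simp_all add: mult.commute)
    also have "\<dots> = (if \<mu> \<cdot> inv\<^sub>Q ?b = \<one>\<^sub>Q then 1 else 0)"
      using \<mu> cls_rt(1) by (intro f_sum_right) simp
    also have "\<mu> \<cdot> inv\<^sub>Q ?b = \<one>\<^sub>Q \<longleftrightarrow> \<mu> = ?b"
      using \<mu> cls_rt(1)[of a] Q.inv_solve_right'[of "\<one>\<^sub>Q" \<mu> ?b] by auto
    finally show ?thesis .
  qed
  have col: "(\<Sum>\<mu>\<in>carrier Q. f \<mu> \<nu> * qchar \<mu> (rt a)) = (if \<nu> = ?b then 1 else 0)" if \<nu>: "\<nu> \<in> carrier Q" for \<nu>
  proof -
    have "(\<Sum>\<mu>\<in>carrier Q. f \<mu> \<nu> * qchar \<mu> (rt a)) = (\<Sum>\<mu>\<in>carrier Q. f \<mu> (\<nu> \<cdot> inv\<^sub>Q ?b))"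
      using f_unshift(2)[OF _ \<nu>] by (intro sum.cong) (simp_all add: mult.commute)
    also have "\<dots> = (if \<nu> \<cdot> inv\<^sub>Q ?b = \<one>\<^sub>Q then 1 else 0)"
      using \<nu> cls_rt(1) by (intro f_sum_left) simp
    also have "\<nu> \<cdot> inv\<^sub>Q ?b = \<one>\<^sub>Q \<longleftrightarrow> \<nu> = ?b"
      using \<nu> cls_rt(1)[of a] Q.inv_solve_right'[of "\<one>\<^sub>Q" \<nu> ?b] by auto
    finally show ?thesis .
  qed
  \<comment> \<open>Two deltas at \<alpha>_i convolve to the delta at 2\<alpha>_i, which is the unit
    class here; the trivial character has the same image.\<close>
  have 1: "(\<Sum>\<nu>\<in>carrier Q. m \<mu> \<nu> * qchar \<nu> (rt a)) = (if \<mu> = \<one>\<^sub>Q then 1 else 0)" if \<mu>: "\<mu> \<in> carrier Q" for \<mu>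
  proof -
    have "(\<Sum>\<nu>\<in>carrier Q. m \<mu> \<nu> * qchar \<nu> (rt a)) =
        (\<Sum>\<mu>'\<in>carrier Q. (\<Sum>\<nu>\<in>carrier Q. f (\<mu> \<cdot> inv\<^sub>Q \<mu>') \<nu> * qchar \<nu> (rt a)) *
          (\<Sum>\<nu>'\<in>carrier Q. f \<nu>' \<mu>' * qchar \<nu>' (rt a)))"
      by (rule conv) (rule qchar_mult)
    also have "\<dots> = (\<Sum>\<mu>'\<in>carrier Q. if \<mu>' = ?b then (if \<mu> \<cdot> inv\<^sub>Q ?b = ?b then 1 else 0) else 0)"
      using \<mu> by (intro sum.cong refl) (simp add: row col)
    also have "\<dots> = (if \<mu> \<cdot> inv\<^sub>Q ?b = ?b then 1 else 0)"
      using finite_Q cls_rt(1)[of a] by simp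
    also have "\<mu> \<cdot> inv\<^sub>Q ?b = ?b \<longleftrightarrow> \<mu> = \<one>\<^sub>Q"
      using \<mu> cls_rt(1)[of a] Q.inv_solve_right'[of ?b \<mu> ?b] bb by auto
    finally show ?thesis .
  qed
  have 2: "(\<Sum>\<nu>\<in>carrier Q. m \<mu> \<nu> * 1) = (if \<mu> = \<one>\<^sub>Q then 1 else 0)" if \<mu>: "\<mu> \<in> carrier Q" for \<mu>
  proof -
    have "(\<Sum>\<nu>\<in>carrier Q. m \<mu> \<nu> * 1) =
        (\<Sum>\<mu>'\<in>carrier Q. (\<Sum>\<nu>\<in>carrier Q. f (\<mu> \<cdot> inv\<^sub>Q \<mu>') \<nu> * 1) * (\<Sum>\<nu>'\<in>carrier Q. f \<nu>' \<mu>' * 1))"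
      by (rule conv) simp
    also have "\<dots> = (\<Sum>\<mu>'\<in>carrier Q. if \<mu>' = \<one>\<^sub>Q then (if \<mu> = \<one>\<^sub>Q then 1 else 0) else 0)"
      using \<mu> by (intro sum.cong refl) (auto simp: f_sum_left f_sum_right)
    finally show ?thesis using finite_Q by simp
  qed
  have "(\<Sum>\<nu>\<in>carrier Q. m \<mu> \<nu> * (qchar \<nu> (rt a) - 1)) = 0" if "\<mu> \<in> carrier Q" for \<mu>
    using 1[OF that] 2[OF that] by (simp add: right_diff_distrib sum_subtractf)
  \<comment> \<open>Evaluated at the class of \<alpha>_i, the kernel vector is q^(2 d_i) -
    1.\<close>
  with inv[unfolded invertible_on_iff[OF finite_Q], THEN spec, of "\<lambda>\<nu>. qchar \<nu> (rt a) - 1"]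
  have "qchar ?b (rt a) = 1" using cls_rt(1)[of a] by simp
  moreover have "qchar ?b (rt a) = t i i"
  proof -
    have "\<chi> (rep ?b) i = q powi int_ip ip (rt a) (\<alpha> i)" using rep_power[OF rt_in_L, of a i] by simp
    moreover have "q powi int_ip ip (wt (rep ?b)) (\<alpha> i) = \<chi> (rep ?b) i"
      using q_powi_weight[of "rep ?b" "[i]"] by (simp add: weight_def)
    moreover have "q powi int_ip ip (\<alpha> i) (\<alpha> i) = t i i"
      using q_powi_weight[of "\<alpha>_coords i" "[i]"] by (simp add: weight_def t_def flip: \<alpha>_wt)
    ultimately show ?thesis by (simp add: qchar_def flip: a)
  qed
  ultimately show False using t_diag[of i] q_power[of i] by simp
qed

lemma K_tensor_mult: "c \<in> carrier Q \<Longrightarrow> c' \<in> carrier Q \<Longrightarrow> b \<in> carrier Q \<Longrightarrow> b' \<in> carrier Q \<Longrightarrow>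
    (K c \<otimes>\<^sub>C K c') * (K b \<otimes>\<^sub>C K b') = K (c \<cdot> b) \<otimes>\<^sub>C K (c' \<cdot> b')"
  by (simp add: times_tensor_tensor K_mult)

text \<open>Commuting past e \<otimes> g multiplies the coefficient at (\<mu>, \<nu>) by q^(\<nu> -
  \<mu>, \<beta>), and quasi-periodicity turns this into a shift of both indices. The scalar
  q^(-(\<beta>, \<beta>)) is left over because the second index is shifted when the first has
  already moved.\<close>

lemma graded_R\<^sub>0_commute:
  assumes e: "e \<in> graded_piece \<alpha> E (rt n)" and g: "g \<in> graded_piece \<alpha> F (rt n)"
  defines "b \<equiv> cls L' (rt n)"
  shows "(e \<otimes>\<^sub>C g) * R\<^sub>0 = inverse (qchar b (rt n)) *\<^sub>C (R\<^sub>0 * (K b \<otimes>\<^sub>C K (inv\<^sub>Q b)) * (e \<otimes>\<^sub>C g))"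
proof -
  have b: "b \<in> carrier Q" "inv\<^sub>Q b \<in> carrier Q" using cls_rt(1) by (simp_all add: b_def)
  have "R\<^sub>0 * (K b \<otimes>\<^sub>C K (inv\<^sub>Q b)) = (\<Sum>\<mu>\<in>carrier Q. \<Sum>\<nu>\<in>carrier Q.
      f (\<mu> \<cdot> b \<cdot> inv\<^sub>Q b) (\<nu> \<cdot> inv\<^sub>Q b \<cdot> b) *\<^sub>C (K (\<mu> \<cdot> b) \<otimes>\<^sub>C K (\<nu> \<cdot> inv\<^sub>Q b)))"
    unfolding R\<^sub>0 sum_distrib_right using b by (intro sum.cong refl) (simp add: K_tensor_mult Q.m_assoc)
  also have "\<dots> = (\<Sum>\<mu>\<in>carrier Q. \<Sum>\<nu>\<in>carrier Q. f (\<mu> \<cdot> inv\<^sub>Q b) (\<nu> \<cdot> b) *\<^sub>C (K \<mu> \<otimes>\<^sub>C K \<nu>))"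
    by (rule Q.sum_shift2[OF b, of "\<lambda>\<mu> \<nu>. f (\<mu> \<cdot> inv\<^sub>Q b) (\<nu> \<cdot> b) *\<^sub>C (K \<mu> \<otimes>\<^sub>C K \<nu>)"])
  finally have R0K: "R\<^sub>0 * (K b \<otimes>\<^sub>C K (inv\<^sub>Q b)) =
      (\<Sum>\<mu>\<in>carrier Q. \<Sum>\<nu>\<in>carrier Q. f (\<mu> \<cdot> inv\<^sub>Q b) (\<nu> \<cdot> b) *\<^sub>C (K \<mu> \<otimes>\<^sub>C K \<nu>))" .
  have coeff: "inverse (qchar b (rt n)) * f (\<mu> \<cdot> inv\<^sub>Q b) (\<nu> \<cdot> b) =
      f \<mu> \<nu> * (qchar \<nu> (rt n) * inverse (qchar \<mu> (rt n)))"
    if "\<mu> \<in> carrier Q" "\<nu> \<in> carrier Q" for \<mu> \<nu>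
  proof -
    have "f (\<mu> \<cdot> inv\<^sub>Q b) (\<nu> \<cdot> b) = inverse (qchar (\<mu> \<cdot> inv\<^sub>Q b) (rt n)) * (qchar \<nu> (rt n) * f \<mu> \<nu>)"
      using f_unshift(3)[of "\<mu> \<cdot> inv\<^sub>Q b" \<nu> n] f_unshift(1)[OF that, of n] that b by (simp add: b_def)
    then show ?thesis using that b by (simp add: qchar_mult qchar_inv qchar_nz field_simps)
  qed
  have "(e \<otimes>\<^sub>C g) * (K \<mu> \<otimes>\<^sub>C K \<nu>) = (qchar \<nu> (rt n) * inverse (qchar \<mu> (rt n))) *\<^sub>C ((K \<mu> \<otimes>\<^sub>C K \<nu>) * (e \<otimes>\<^sub>C g))"
    if "\<mu> \<in> carrier Q" "\<nu> \<in> carrier Q" for \<mu> \<nu>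
    by (simp add: times_tensor_tensor K_graded_E[OF that(1) e] K_graded_F[OF that(2) g]
        cbilinearD[OF cbilinear_tensor] mult.commute)
  then have "(e \<otimes>\<^sub>C g) * R\<^sub>0 = (\<Sum>\<mu>\<in>carrier Q. \<Sum>\<nu>\<in>carrier Q.
      (inverse (qchar b (rt n)) * f (\<mu> \<cdot> inv\<^sub>Q b) (\<nu> \<cdot> b)) *\<^sub>C ((K \<mu> \<otimes>\<^sub>C K \<nu>) * (e \<otimes>\<^sub>C g)))"
    unfolding R\<^sub>0 sum_distrib_left by (intro sum.cong refl) (simp add: coeff)
  also have "\<dots> = inverse (qchar b (rt n)) *\<^sub>C (R\<^sub>0 * (K b \<otimes>\<^sub>C K (inv\<^sub>Q b)) * (e \<otimes>\<^sub>C g))"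
    unfolding R0K by (simp add: sum_distrib_right cvec.scale_sum_right)
  finally show ?thesis .
qed

lemma swap_R\<^sub>0_R\<^sub>0: "tensor_swap R\<^sub>0 * R\<^sub>0 = (\<Sum>\<mu>\<in>carrier Q. \<Sum>\<nu>\<in>carrier Q. m \<mu> \<nu> *\<^sub>C (K \<mu> \<otimes>\<^sub>C K \<nu>))"
proof -
  let ?C = "carrier Q"
  have sw: "tensor_swap R\<^sub>0 = (\<Sum>\<mu>'\<in>?C. \<Sum>\<nu>'\<in>?C. f \<nu>' \<mu>' *\<^sub>C (K \<mu>' \<otimes>\<^sub>C K \<nu>'))"
    unfolding R\<^sub>0 by (simp add: clin_sum[OF clinear_tensor_swap] clin_scale[OF clinear_tensor_swap] tensor_swap_tensor)
      (rule sum.swap)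
  have "(K \<mu>' \<otimes>\<^sub>C K \<nu>') * R\<^sub>0 = (\<Sum>\<mu>\<in>?C. \<Sum>\<nu>\<in>?C. f (\<mu> \<cdot> inv\<^sub>Q \<mu>') (\<nu> \<cdot> inv\<^sub>Q \<nu>') *\<^sub>C (K \<mu> \<otimes>\<^sub>C K \<nu>))"
    if c: "\<mu>' \<in> ?C" "\<nu>' \<in> ?C" for \<mu>' \<nu>'
  proof -
    have "(K \<mu>' \<otimes>\<^sub>C K \<nu>') * R\<^sub>0 = (\<Sum>\<mu>\<in>?C. \<Sum>\<nu>\<in>?C.
        f (\<mu> \<cdot> \<mu>' \<cdot> inv\<^sub>Q \<mu>') (\<nu> \<cdot> \<nu>' \<cdot> inv\<^sub>Q \<nu>') *\<^sub>C (K (\<mu> \<cdot> \<mu>') \<otimes>\<^sub>C K (\<nu> \<cdot> \<nu>')))"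
      unfolding R\<^sub>0 sum_distrib_left using c
      by (intro sum.cong refl) (simp add: K_tensor_mult Q.m_comm[of \<mu>'] Q.m_comm[of \<nu>'] Q.m_assoc)
    also have "\<dots> = (\<Sum>\<mu>\<in>?C. \<Sum>\<nu>\<in>?C. f (\<mu> \<cdot> inv\<^sub>Q \<mu>') (\<nu> \<cdot> inv\<^sub>Q \<nu>') *\<^sub>C (K \<mu> \<otimes>\<^sub>C K \<nu>))"
      by (rule Q.sum_shift2[OF c, of "\<lambda>\<mu> \<nu>. f (\<mu> \<cdot> inv\<^sub>Q \<mu>') (\<nu> \<cdot> inv\<^sub>Q \<nu>') *\<^sub>C (K \<mu> \<otimes>\<^sub>C K \<nu>)"])
    finally show ?thesis .
  qed
  then have "tensor_swap R\<^sub>0 * R\<^sub>0 = (\<Sum>\<mu>'\<in>?C. \<Sum>\<nu>'\<in>?C. \<Sum>\<mu>\<in>?C. \<Sum>\<nu>\<in>?C.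
      (f (\<mu> \<cdot> inv\<^sub>Q \<mu>') (\<nu> \<cdot> inv\<^sub>Q \<nu>') * f \<nu>' \<mu>') *\<^sub>C (K \<mu> \<otimes>\<^sub>C K \<nu>))"
    unfolding sw sum_distrib_right by (intro sum.cong refl) (simp add: cvec.scale_sum_right mult.commute)
  \<comment> \<open>With the four sums grouped in pairs, one exchange is enough.\<close>
  also have "\<dots> = (\<Sum>(\<mu>', \<nu>')\<in>?C \<times> ?C. \<Sum>(\<mu>, \<nu>)\<in>?C \<times> ?C.
      (f (\<mu> \<cdot> inv\<^sub>Q \<mu>') (\<nu> \<cdot> inv\<^sub>Q \<nu>') * f \<nu>' \<mu>') *\<^sub>C (K \<mu> \<otimes>\<^sub>C K \<nu>))"
    by (simp flip: sum.cartesian_product)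
  also have "\<dots> = (\<Sum>(\<mu>, \<nu>)\<in>?C \<times> ?C. \<Sum>(\<mu>', \<nu>')\<in>?C \<times> ?C.
      (f (\<mu> \<cdot> inv\<^sub>Q \<mu>') (\<nu> \<cdot> inv\<^sub>Q \<nu>') * f \<nu>' \<mu>') *\<^sub>C (K \<mu> \<otimes>\<^sub>C K \<nu>))"
    unfolding split_def by (rule sum.swap)
  also have "\<dots> = (\<Sum>\<mu>\<in>?C. \<Sum>\<nu>\<in>?C. m \<mu> \<nu> *\<^sub>C (K \<mu> \<otimes>\<^sub>C K \<nu>))"
    by (simp add: m_def cvec.scale_sum_left flip: sum.cartesian_product)
  finally show ?thesis .
qed

end

section \<open>Homogeneous expansion of the monodromy element and both implications\<close>

context R_matrix_setting
begin

context
  fixes P :: "(('g \<Rightarrow> complex) \<times> 'h) set" and g :: "('g \<Rightarrow> complex) \<times> 'h \<Rightarrow> 'h"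
  assumes finite_P: "finite P"
    and P: "\<And>p. p \<in> P \<Longrightarrow> fst p \<in> nat_span \<alpha> \<and> g p \<in> graded_piece \<alpha> F (fst p) \<and> snd p \<in> graded_piece \<alpha> E (fst p)"
    and indep_P: "indep_family P snd" and \<Theta>: "\<Theta> = (\<Sum>p\<in>P. g p \<otimes>\<^sub>C snd p)"
begin

text \<open>The scalar of \<open>graded_R\<^sub>0_commute\<close> is absorbed here, so that the
  coefficients in \<open>monodromy\<close> are the entries of m themselves.\<close>

definition XX :: "('g \<Rightarrow> complex) set \<times> (('g \<Rightarrow> complex) \<times> 'h) \<times> (('g \<Rightarrow> complex) \<times> 'h) \<Rightarrow> 'h" where
  "XX = (\<lambda>(\<mu>, p, p'). inverse (qchar (cls L' (fst p)) (fst p)) *\<^sub>C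
    (K (\<mu> \<cdot> cls L' (fst p)) * (snd p * g p')))"

definition YY :: "('g \<Rightarrow> complex) set \<times> (('g \<Rightarrow> complex) \<times> 'h) \<times> (('g \<Rightarrow> complex) \<times> 'h) \<Rightarrow> 'h" where
  "YY = (\<lambda>(\<nu>, p, p'). K (\<nu> \<cdot> inv\<^sub>Q cls L' (fst p)) * (g p * snd p'))"

lemma cls_P: "p \<in> P \<Longrightarrow> cls L' (fst p) \<in> carrier Q"
  using nat_span_rt P cls_rt(1) by metis

lemma monodromy: "tensor_swap R * R =
  (\<Sum>r\<in>P \<times> P. \<Sum>\<mu>\<in>carrier Q. \<Sum>\<nu>\<in>carrier Q. m \<mu> \<nu> *\<^sub>C (XX (\<mu>, r) \<otimes>\<^sub>C YY (\<nu>, r)))"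
proof -
  have term_eq: "tensor_swap R\<^sub>0 * (snd p \<otimes>\<^sub>C g p) * R\<^sub>0 * (g p' \<otimes>\<^sub>C snd p') =
      (\<Sum>\<mu>\<in>carrier Q. \<Sum>\<nu>\<in>carrier Q. m \<mu> \<nu> *\<^sub>C (XX (\<mu>, p, p') \<otimes>\<^sub>C YY (\<nu>, p, p')))" if p: "p \<in> P" for p p'
  proof -
    obtain n where n: "fst p = rt n" using P[OF p] nat_span_rt by blast
    let ?b = "cls L' (fst p)"
    have b: "?b \<in> carrier Q" "inv\<^sub>Q ?b \<in> carrier Q" using cls_P[OF p] by simp_all
    have "(snd p \<otimes>\<^sub>C g p) * R\<^sub>0 = inverse (qchar ?b (fst p)) *\<^sub>C (R\<^sub>0 * (K ?b \<otimes>\<^sub>C K (inv\<^sub>Q ?b)) * (snd p \<otimes>\<^sub>C g p))"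
      using graded_R\<^sub>0_commute[of "snd p" n "g p"] P[OF p] by (simp add: n)
    then have "tensor_swap R\<^sub>0 * (snd p \<otimes>\<^sub>C g p) * R\<^sub>0 * (g p' \<otimes>\<^sub>C snd p') =
        inverse (qchar ?b (fst p)) *\<^sub>C (tensor_swap R\<^sub>0 * R\<^sub>0 * ((K ?b \<otimes>\<^sub>C K (inv\<^sub>Q ?b)) * ((snd p * g p') \<otimes>\<^sub>C (g p * snd p'))))"
      by (simp add: mult.assoc times_tensor_tensor)
    also have "\<dots> = (\<Sum>\<mu>\<in>carrier Q. \<Sum>\<nu>\<in>carrier Q. m \<mu> \<nu> *\<^sub>C (XX (\<mu>, p, p') \<otimes>\<^sub>C YY (\<nu>, p, p')))"
      unfolding swap_R\<^sub>0_R\<^sub>0 sum_distrib_right cvec.scale_sum_right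
    proof (rule sum.cong[OF refl], rule sum.cong[OF refl])
      fix \<mu> \<nu> assume c: "\<mu> \<in> carrier Q" "\<nu> \<in> carrier Q"
      have "(K \<mu> \<otimes>\<^sub>C K \<nu>) * ((K ?b \<otimes>\<^sub>C K (inv\<^sub>Q ?b)) * ((snd p * g p') \<otimes>\<^sub>C (g p * snd p'))) =
          (K (\<mu> \<cdot> ?b) * (snd p * g p')) \<otimes>\<^sub>C (K (\<nu> \<cdot> inv\<^sub>Q ?b) * (g p * snd p'))"
        using c b by (simp add: times_tensor_tensor K_mult[symmetric] mult.assoc)
      then show "inverse (qchar ?b (fst p)) *\<^sub>C (m \<mu> \<nu> *\<^sub>C (K \<mu> \<otimes>\<^sub>C K \<nu>) *
            ((K ?b \<otimes>\<^sub>C K (inv\<^sub>Q ?b)) * ((snd p * g p') \<otimes>\<^sub>C (g p * snd p')))) =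
          m \<mu> \<nu> *\<^sub>C (XX (\<mu>, p, p') \<otimes>\<^sub>C YY (\<nu>, p, p'))"
        by (simp add: XX_def YY_def cbilinearD[OF cbilinear_tensor] mult.commute)
    qed
    finally show ?thesis .
  qed
  have "tensor_swap R * R = (\<Sum>p\<in>P. \<Sum>p'\<in>P. tensor_swap R\<^sub>0 * (snd p \<otimes>\<^sub>C g p) * R\<^sub>0 * (g p' \<otimes>\<^sub>C snd p'))"
    unfolding R tensor_swap_mult \<Theta>
    by (simp add: clin_sum[OF clinear_tensor_swap] tensor_swap_tensor sum_distrib_left sum_distrib_right mult.assoc)
      (rule sum.swap)
  also have "\<dots> = (\<Sum>p\<in>P. \<Sum>p'\<in>P. \<Sum>\<mu>\<in>carrier Q. \<Sum>\<nu>\<in>carrier Q. m \<mu> \<nu> *\<^sub>C (XX (\<mu>, p, p') \<otimes>\<^sub>C YY (\<nu>, p, p')))"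
    by (intro sum.cong[OF refl]) (rule term_eq)
  finally show ?thesis by (simp add: sum.cartesian_product')
qed

lemma graded_preimage:
  assumes "p \<in> P"
  obtains x y where "g p = eval F x" "snd p = eval E y" "fst p \<noteq> 0 \<Longrightarrow> B x 1 = 0"
  using P[OF assms] B_span_word_1 by (auto simp: graded_piece_eval)

lemma factorizable_imp_invertible:
  assumes "factorizable \<Delta> \<epsilon> S R"
  shows "invertible_on (carrier Q) m"
  unfolding invertible_on_iff[OF finite_Q]
proof (intro allI impI ballI)
  fix v c assume v: "\<forall>\<mu>\<in>carrier Q. (\<Sum>\<nu>\<in>carrier Q. m \<mu> \<nu> * v \<nu>) = 0" and c: "c \<in> carrier Q"
  obtain \<Phi> where \<Phi>: "clinear \<Phi>"
    "\<And>c x y. c \<in> carrier Q \<Longrightarrow> \<Phi> (K c * eval F x * eval E y) = v c * B x 1 * B y 1"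
    by (rule triangular_functional[of v 1 1]) (rule that; assumption)
  have zero: "(\<Sum>\<nu>\<in>carrier Q. m \<mu> \<nu> * \<Phi> (YY (\<nu>, p, p'))) = 0"
    if "\<mu> \<in> carrier Q" and p: "p \<in> P" "p' \<in> P" for \<mu> p p'
  proof -
    obtain x y where x: "g p = eval F x" "fst p \<noteq> 0 \<Longrightarrow> B x 1 = 0" by (rule graded_preimage[OF p(1)]) (rule that; assumption)
    obtain x' y' where y: "snd p' = eval E y'" by (rule graded_preimage[OF p(2)]) (rule that; assumption)
    \<comment> \<open>For a nonzero weight the class is shifted, but then B x 1 = 0; for weight 0
      there is no shift. So v always enters at \<nu> itself, and the row sums of m against v
      appear.\<close>
    have Y: "\<Phi> (YY (\<nu>, p, p')) = v \<nu> * (B x 1 * B y' 1)" if \<nu>: "\<nu> \<in> carrier Q" for \<nu>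
    proof (cases "fst p = 0")
      case True
      then have "\<nu> \<cdot> inv\<^sub>Q cls L' (fst p) = \<nu>" using \<nu> by (simp add: cls_0)
      then show ?thesis using \<Phi>(2)[OF \<nu>, of x y'] by (simp add: YY_def x y mult.assoc)
    next
      case False
      then show ?thesis
        using \<Phi>(2)[of "\<nu> \<cdot> inv\<^sub>Q cls L' (fst p)" x y'] \<nu> cls_P[OF p(1)] x(2)
        by (simp add: YY_def x(1) y mult.assoc)
    qed
    have "(\<Sum>\<nu>\<in>carrier Q. m \<mu> \<nu> * \<Phi> (YY (\<nu>, p, p'))) = (\<Sum>\<nu>\<in>carrier Q. m \<mu> \<nu> * v \<nu>) * (B x 1 * B y' 1)"
      unfolding sum_distrib_right by (intro sum.cong refl) (simp add: Y)
    then show ?thesis using v \<open>\<mu> \<in> carrier Q\<close> by simp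
  qed
  have "right_slice \<Phi> (tensor_swap R * R) = (\<Sum>r\<in>P \<times> P. \<Sum>\<mu>\<in>carrier Q.
      (\<Sum>\<nu>\<in>carrier Q. m \<mu> \<nu> * \<Phi> (YY (\<nu>, r))) *\<^sub>C XX (\<mu>, r))"
    unfolding monodromy
    by (simp add: clin_sum[OF clinear_right_slice[OF \<Phi>(1)]] clin_scale[OF clinear_right_slice[OF \<Phi>(1)]]
        right_slice_tensor[OF \<Phi>(1)] cvec.scale_sum_left)
  also have "\<dots> = 0" using zero by (intro sum.neutral ballI) auto
  finally have "right_slice \<Phi> (tensor_swap R * R) = right_slice (\<lambda>_. 0) (tensor_swap R * R)"
    by (simp add: right_slice_def tensor_lift_def linext_def)
  moreover have "inj_on (\<lambda>\<phi>. right_slice \<phi> (tensor_swap R * R)) {\<phi>. clinear \<phi>}"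
    using assms by (simp add: factorizable_def right_slice_def bij_betw_def)
  ultimately have "\<Phi> = (\<lambda>_. 0)"
    using \<Phi>(1) clinear_const_0 by (intro inj_onD[of _ "{\<phi>. clinear \<phi>}" \<Phi> "\<lambda>_. 0"]) (assumption | simp)+
  then show "v c = 0" using \<Phi>(2)[OF c, of 1 1] by (simp add: B_1)
qed

lemma invertible_imp_factorizable:
  assumes inv: "invertible_on (carrier Q) m"
  shows "factorizable \<Delta> \<epsilon> S R"
proof -
  have dist: "cls L' (\<alpha> i) \<noteq> cls L' (- \<alpha> i)" for i
    by (rule m_invertible_distinct[OF inv])
  have right: "right_slice \<phi> \<Theta> = (\<Sum>p\<in>P. \<phi> (snd p) *\<^sub>C g p)"
    and left: "left_slice \<phi> \<Theta> = (\<Sum>p\<in>P. \<phi> (g p) *\<^sub>C snd p)" if "clinear \<phi>" for \<phi>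
    unfolding \<Theta> by (simp_all add: clin_sum[OF clinear_right_slice[OF that]] right_slice_tensor[OF that]
        clin_sum[OF clinear_left_slice[OF that]] left_slice_tensor[OF that])
  \<comment> \<open>The u^+ components are independent, so any coefficients of a dependency are
    values of a functional on them. Its slice of \<Theta> is that dependency, hence it vanishes on
    u^+.\<close>
  have indep_g: "indep_family P g"
    unfolding indep_family_def
  proof (intro allI impI ballI)
    fix a p assume 0: "(\<Sum>p\<in>P. a p *\<^sub>C g p) = 0" and p: "p \<in> P"
    obtain \<phi> :: "'h \<Rightarrow> complex" where \<phi>: "clinear \<phi>" "\<And>p. p \<in> P \<Longrightarrow> \<phi> (snd p) = a p"
      by (rule indep_family_functional[OF finite_P indep_P, of a]) (rule that; assumption)
    have "right_slice \<phi> \<Theta> = 0" using 0 \<phi> by (simp add: right)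
    moreover obtain y where "snd p = eval E y" by (rule graded_preimage[OF p]) (rule that; assumption)
    ultimately show "a p = 0"
      using right_slice_\<Theta>_nondegenerate[OF dist \<phi>(1)] \<phi>(2)[OF p] by metis
  qed
  \<comment> \<open>A vector outside the span would be detected by a functional that kills the
    family and therefore has zero slice.\<close>
  have span_E: "eval E x \<in> cvec.span (snd ` P)" for x
  proof (rule ccontr)
    assume "eval E x \<notin> cvec.span (snd ` P)"
    then obtain \<phi> :: "'h \<Rightarrow> complex" where \<phi>: "clinear \<phi>" "\<And>z. z \<in> snd ` P \<Longrightarrow> \<phi> z = 0" "\<phi> (eval E x) = 1"
      by (rule functional_separates) (rule that; assumption)
    have "right_slice \<phi> \<Theta> = 0" using \<phi> by (simp add: right)
    from right_slice_\<Theta>_nondegenerate[OF dist \<phi>(1) this, of x] \<phi>(3) show False by simp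
  qed
  have span_F: "eval F x \<in> cvec.span (g ` P)" for x
  proof (rule ccontr)
    assume "eval F x \<notin> cvec.span (g ` P)"
    then obtain \<phi> :: "'h \<Rightarrow> complex" where \<phi>: "clinear \<phi>" "\<And>z. z \<in> g ` P \<Longrightarrow> \<phi> z = 0" "\<phi> (eval F x) = 1"
      by (rule functional_separates) (rule that; assumption)
    have "left_slice \<phi> \<Theta> = 0" using \<phi> by (simp add: left)
    from left_slice_\<Theta>_nondegenerate[OF dist \<phi>(1) this, of x] \<phi>(3) show False by simp
  qed
  let ?I = "carrier Q \<times> (P \<times> P)"
  have finI: "finite ?I" using finite_Q finite_P by simp
  \<comment> \<open>The family \<open>YY\<close> without its shift in K. The triangular functionals
    apply to it directly; \<open>XX\<close> and \<open>YY\<close> then inherit independence by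
    counting.\<close>
  define Y :: "('g \<Rightarrow> complex) set \<times> (('g \<Rightarrow> complex) \<times> 'h) \<times> (('g \<Rightarrow> complex) \<times> 'h) \<Rightarrow> 'h" where "Y = (\<lambda>(\<nu>, p, p'). K \<nu> * (g p * snd p'))"
  have indep_Y: "indep_family ?I Y"
    unfolding indep_family_def
  proof (intro allI impI ballI)
    fix a r assume 0: "(\<Sum>r\<in>?I. a r *\<^sub>C Y r) = 0" and r: "r \<in> ?I"
    have "\<forall>p\<in>P. \<exists>xy. g p = eval F (fst xy) \<and> snd p = eval E (snd xy)"
    proof
      fix p assume "p \<in> P"
      then obtain x y where "g p = eval F x" "snd p = eval E y" by (rule graded_preimage) (rule that; assumption)
      then show "\<exists>xy. g p = eval F (fst xy) \<and> snd p = eval E (snd xy)" by (intro exI[of _ "(x, y)"]) simp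
    qed
    from bchoice[OF this] obtain xy where xy: "\<forall>p\<in>P. g p = eval F (fst (xy p)) \<and> snd p = eval E (snd (xy p))" ..
    obtain c p\<^sub>0 p\<^sub>0' where r0: "r = (c, p\<^sub>0, p\<^sub>0')" "c \<in> carrier Q" "p\<^sub>0 \<in> P" "p\<^sub>0' \<in> P" using r by auto
    \<comment> \<open>A functional supported on the class c isolates the coefficients at c, while z
      and w stay free as test elements.\<close>
    have BB: "(\<Sum>p'\<in>P. (\<Sum>p\<in>P. a (c, p, p') * B (fst (xy p)) z) * B (snd (xy p')) w) = 0" for z w
    proof -
      obtain \<Phi> where \<Phi>: "clinear \<Phi>" "\<And>c' x y. c' \<in> carrier Q \<Longrightarrow>
          \<Phi> (K c' * eval F x * eval E y) = (if c' = c then 1 else 0) * B x z * B y w"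
        by (rule triangular_functional[of "\<lambda>c'. if c' = c then 1 else 0" z w]) (rule that; assumption)
      have "0 = \<Phi> (\<Sum>r\<in>?I. a r *\<^sub>C Y r)" by (simp only: 0 clin_0[OF \<Phi>(1)])
      also have "\<dots> = (\<Sum>r\<in>?I. a r * \<Phi> (Y r))"
        by (simp add: clin_sum[OF \<Phi>(1)] clin_scale[OF \<Phi>(1)])
      also have "\<dots> = (\<Sum>(c', p, p')\<in>?I. if c' = c then a (c, p, p') * B (fst (xy p)) z * B (snd (xy p')) w else 0)"
      proof (rule sum.cong[OF refl])
        fix r assume "r \<in> ?I"
        then obtain c' p p' where r: "r = (c', p, p')" "c' \<in> carrier Q" "p \<in> P" "p' \<in> P" by auto
        have "\<Phi> (Y r) = (if c' = c then 1 else 0) * B (fst (xy p)) z * B (snd (xy p')) w"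
          using bspec[OF xy r(3)] bspec[OF xy r(4)] \<Phi>(2)[OF r(2), of "fst (xy p)" "snd (xy p')"]
          by (simp add: Y_def r(1) mult.assoc)
        then show "a r * \<Phi> (Y r) =
            (case r of (c', p, p') \<Rightarrow> if c' = c then a (c, p, p') * B (fst (xy p)) z * B (snd (xy p')) w else 0)"
          by (simp add: r(1) mult.assoc)
      qed
      also have "\<dots> = (\<Sum>c'\<in>carrier Q. if c' = c then \<Sum>p\<in>P. \<Sum>p'\<in>P. a (c, p, p') * B (fst (xy p)) z * B (snd (xy p')) w else 0)"
        unfolding sum.cartesian_product[symmetric] by (intro sum.cong refl) simp
      also have "\<dots> = (\<Sum>p\<in>P. \<Sum>p'\<in>P. a (c, p, p') * B (fst (xy p)) z * B (snd (xy p')) w)"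
        using r0 finite_Q by simp
      also have "\<dots> = (\<Sum>p'\<in>P. (\<Sum>p\<in>P. a (c, p, p') * B (fst (xy p)) z) * B (snd (xy p')) w)"
        unfolding sum_distrib_right by (rule sum.swap)
      finally show ?thesis by simp
    qed
    \<comment> \<open>The E factor is stripped first: varying w puts the combination into the
      radical, and independence in u^+ applies. Varying z then treats the F factor in the same
      way.\<close>
    have "(\<Sum>p\<in>P. a (c, p, p\<^sub>0') * B (fst (xy p)) z) = 0" for z
    proof -
      let ?s = "\<Sum>p'\<in>P. (\<Sum>p\<in>P. a (c, p, p') * B (fst (xy p)) z) *\<^sub>C snd (xy p')"
      have "?s \<in> radical B"
        using BB[of z] by (simp add: radical_def clin_sum[OF B_lin(2)[OF clinear_id]] clin_scale[OF B_lin(2)[OF clinear_id]] mult.commute)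
      then have "eval E ?s = 0" by (rule radical_eval(1))
      then have "(\<Sum>p'\<in>P. (\<Sum>p\<in>P. a (c, p, p') * B (fst (xy p)) z) *\<^sub>C snd p') = 0"
        using xy by (simp add: clin_sum[OF clinear_eval] clin_scale[OF clinear_eval])
      from indep_familyD[OF indep_P this r0(4)] show ?thesis .
    qed
    then have "(\<Sum>p\<in>P. a (c, p, p\<^sub>0') *\<^sub>C fst (xy p)) \<in> radical B"
      by (simp add: radical_def clin_sum[OF B_lin(2)[OF clinear_id]] clin_scale[OF B_lin(2)[OF clinear_id]] mult.commute)
    then have "eval F (\<Sum>p\<in>P. a (c, p, p\<^sub>0') *\<^sub>C fst (xy p)) = 0" by (rule radical_eval(2))
    then have "(\<Sum>p\<in>P. a (c, p, p\<^sub>0') *\<^sub>C g p) = 0"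
      using xy by (simp add: clin_sum[OF clinear_eval] clin_scale[OF clinear_eval])
    from indep_familyD[OF indep_g this r0(3)] show "a r = 0" by (simp add: r0)
  qed
  have prod_span: "K c * (x * y) \<in> cvec.span W"
    if c: "c \<in> carrier Q" and x: "x \<in> cvec.span U" and y: "y \<in> cvec.span V"
      and W: "\<And>u v. u \<in> U \<Longrightarrow> v \<in> V \<Longrightarrow> K c * (u * v) \<in> cvec.span W" for c x y and U V W :: "'h set"
    using x
  proof (induct x rule: cvec.span_induct_alt)
    case base
    show ?case by (simp add: cvec.span_zero)
  next
    case (step k u x)
    have "K c * (u * y) \<in> cvec.span W"
      using y
    proof (induct y rule: cvec.span_induct_alt)
      case (step k v y)
      then show ?case using W[OF \<open>u \<in> U\<close> step(1)] by (simp add: distrib_left cvec.span_add cvec.span_scale)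
    qed (simp add: cvec.span_zero)
    with step show ?case by (simp add: distrib_left distrib_right cvec.span_add cvec.span_scale)
  qed
  have YY_span: "cvec.span (YY ` ?I) = UNIV"
  proof -
    have "K c * prod_list (map F u) * prod_list (map E v) \<in> cvec.span (YY ` ?I)" if c: "c \<in> carrier Q" for c u v
    proof -
      have "K c * (eval F (word u) * eval E (word v)) \<in> cvec.span (YY ` ?I)"
      proof (rule prod_span[OF c span_F span_E])
        fix x y assume "x \<in> g ` P" "y \<in> snd ` P"
        then obtain p p' where p: "p \<in> P" "p' \<in> P" "x = g p" "y = snd p'" by blast
        \<comment> \<open>The shift built into \<open>YY\<close> is undone by starting from the
          class shifted by the weight of p.\<close>
        have "K c * (x * y) = YY (c \<cdot> cls L' (fst p), p, p')"
          using c cls_P[OF p(1)] by (simp add: YY_def p Q.m_assoc)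
        moreover have "YY (c \<cdot> cls L' (fst p), p, p') \<in> cvec.span (YY ` ?I)"
          using c cls_P[OF p(1)] p by (intro cvec.span_base imageI) simp
        ultimately show "K c * (x * y) \<in> cvec.span (YY ` ?I)" by simp
      qed
      then show ?thesis by (simp add: eval_word mult.assoc)
    qed
    then have "{K c * prod_list (map F u) * prod_list (map E v) | c u v. c \<in> carrier Q} \<subseteq> cvec.span (YY ` ?I)" by blast
    from cvec.span_minimal[OF this cvec.subspace_span] show ?thesis unfolding span_E_F_aux(1) by blast
  qed
  have XX_span: "cvec.span (XX ` ?I) = UNIV"
  proof -
    have "K c * prod_list (map E u) * prod_list (map F v) \<in> cvec.span (XX ` ?I)" if c: "c \<in> carrier Q" for c u v
    proof -
      have "K c * (eval E (word u) * eval F (word v)) \<in> cvec.span (XX ` ?I)"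
      proof (rule prod_span[OF c span_E span_F])
        fix x y assume "x \<in> snd ` P" "y \<in> g ` P"
        then obtain p p' where p: "p \<in> P" "p' \<in> P" "x = snd p" "y = g p'" by blast
        have i: "inv\<^sub>Q cls L' (fst p) \<in> carrier Q" using cls_P[OF p(1)] by simp
        have "K c * (x * y) = qchar (cls L' (fst p)) (fst p) *\<^sub>C XX (c \<cdot> inv\<^sub>Q cls L' (fst p), p, p')"
          using c cls_P[OF p(1)] by (simp add: XX_def p Q.m_assoc qchar_nz)
        moreover have "XX (c \<cdot> inv\<^sub>Q cls L' (fst p), p, p') \<in> cvec.span (XX ` ?I)"
          using c i p by (intro cvec.span_base imageI) simp
        ultimately show "K c * (x * y) \<in> cvec.span (XX ` ?I)" by (simp only: cvec.span_scale)
      qed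
      then show ?thesis by (simp add: eval_word mult.assoc)
    qed
    then have "{K c * prod_list (map E u) * prod_list (map F v) | c u v. c \<in> carrier Q} \<subseteq> cvec.span (XX ` ?I)" by blast
    from cvec.span_minimal[OF this cvec.subspace_span] show ?thesis unfolding span_E_F_aux(2) by blast
  qed
  have "bij_betw (\<lambda>\<phi>. right_slice \<phi> (tensor_swap R * R)) {\<phi>. clinear \<phi>} UNIV"
    by (rule right_slice_bijective[OF finite_Q finite_cartesian_product[OF finite_P finite_P]
          spanning_family_indep[OF finI indep_Y XX_span] XX_span
          spanning_family_indep[OF finI indep_Y YY_span] YY_span monodromy inv])
  moreover have "finite_dimensional TYPE('h)"
    unfolding finite_dimensional_def using YY_span finI by blast
  ultimately show ?thesis
    using hopf_algebra R_matrix by (simp add: factorizable_def right_slice_def)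
qed

end

lemma factorizable_iff_invertible: "factorizable \<Delta> \<epsilon> S R \<longleftrightarrow> invertible_on (carrier Q) m"
proof -
  obtain P g where *: "finite P"
    "\<And>p. p \<in> P \<Longrightarrow> fst p \<in> nat_span \<alpha> \<and> g p \<in> graded_piece \<alpha> F (fst p) \<and> snd p \<in> graded_piece \<alpha> E (fst p)"
    "indep_family P snd" "\<Theta> = (\<Sum>p\<in>P. g p \<otimes>\<^sub>C snd p)"
    by (rule \<Theta>_homogeneous) (rule that; assumption)
  show ?thesis
    using factorizable_imp_invertible[OF *] invertible_imp_factorizable[OF *] by blast
qed

end

theorem lemma5p4:
  fixes br :: "'g::complex_vector \<Rightarrow> 'g \<Rightarrow> 'g" and \<hh> :: "'g set" and \<kappa> :: "'g \<Rightarrow> 'g \<Rightarrow> complex"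
    and ip :: "('g \<Rightarrow> complex) \<Rightarrow> ('g \<Rightarrow> complex) \<Rightarrow> complex"
    and \<alpha> \<omega> :: "'i::finite \<Rightarrow> 'g \<Rightarrow> complex" and d :: "'i \<Rightarrow> nat" and l :: nat and q :: complex
    and L L' :: "('g \<Rightarrow> complex) set" and B :: "'i free_algebra \<Rightarrow> 'i free_algebra \<Rightarrow> complex"
    and K :: "('g \<Rightarrow> complex) set \<Rightarrow> 'h::complex_algebra_1" and E F :: "'i \<Rightarrow> 'h"
    and \<Delta> \<Delta>b :: "'h \<Rightarrow> ('h, 'h) tensor" and \<epsilon> :: "'h \<Rightarrow> complex" and S :: "'h \<Rightarrow> 'h"
    and \<Theta> R\<^sub>0 R :: "('h, 'h) tensor" and G\<^sub>1 G\<^sub>2 :: "('g \<Rightarrow> complex) set set"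
    and f :: "('g \<Rightarrow> complex) set \<Rightarrow> ('g \<Rightarrow> complex) set \<Rightarrow> complex"
  defines "Q \<equiv> lattice_group L Mod L'"
  assumes "small_quantum_group br \<hh> \<kappa> ip \<alpha> \<omega> d l q L L' B K E F \<Delta> \<epsilon> S"
    and "bar_coproduct \<alpha> L L' K E F \<Delta>b"
    and "quasi_R_matrix \<alpha> E F \<Delta> \<Delta>b \<Theta>"
    and "subgroup G\<^sub>1 Q" "cls L' ` int_span \<alpha> \<subseteq> G\<^sub>1"
    and "subgroup G\<^sub>2 Q" "cls L' ` int_span \<alpha> \<subseteq> G\<^sub>2"
    and "\<And>\<mu> \<nu>. \<mu> \<in> carrier Q \<Longrightarrow> \<nu> \<in> carrier Q \<Longrightarrow> (\<mu>, \<nu>) \<notin> G\<^sub>1 \<times> G\<^sub>2 \<Longrightarrow> f \<mu> \<nu> = 0"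
    and "system_E ip \<alpha> q L L' G\<^sub>1 G\<^sub>2 f"
    and "R\<^sub>0 = (\<Sum>\<mu>\<in>carrier Q. \<Sum>\<nu>\<in>carrier Q. f \<mu> \<nu> *\<^sub>C (K \<mu> \<otimes>\<^sub>C K \<nu>))"
    and "R = R\<^sub>0 * \<Theta>"
    and "R_matrix \<Delta> R"
  shows "factorizable \<Delta> \<epsilon> S R \<longleftrightarrow>
    invertible_on (carrier Q) (\<lambda>\<mu> \<nu>. \<Sum>\<mu>'\<in>carrier Q. \<Sum>\<nu>'\<in>carrier Q.
      f (\<mu> \<otimes>\<^bsub>Q\<^esub> inv\<^bsub>Q\<^esub> \<mu>') (\<nu> \<otimes>\<^bsub>Q\<^esub> inv\<^bsub>Q\<^esub> \<nu>') * f \<nu>' \<mu>')"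
proof -
  interpret R_matrix_setting br \<hh> \<kappa> ip \<alpha> \<omega> d l q L L' B K E F \<Delta> \<epsilon> S \<Delta>b \<Theta> R\<^sub>0 R G\<^sub>1 G\<^sub>2 f
    by (intro R_matrix_setting.intro quasi_R_setting.intro R_matrix_setting_axioms.intro
        quasi_R_setting_axioms.intro) (use assms in \<open>simp_all add: Q_def\<close>)
  show ?thesis
    using factorizable_iff_invertible unfolding Q_def m_def[abs_def] .
qed

end
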